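(* Let $\mathsf Q$ be a Gray presentation and let $(\mathsf P,\equiv)=(\mathsf Q_{\le 3},\sim^{\mathsf Q})$ be the associated rewriting system. If $\mathsf P$ is terminating and all the critical branchings of $(\mathsf P,\equiv)$ are confluent, then $\mathsf Q$ is a coherent Gray presentation.
   Context: **Precategories.** An $n$-precategory is an $n$-globular set $C$ (sets $C_0,\dots,C_n$ with source/target maps $\partial^-_i,\partial^+_i:C_{i+1}\to C_i$ satisfying the globular identities; $\partial^\epsilon_i$ also denotes iterated source/target) with identities $\mathrm{id}:C_{k-1}\to C_k$ and compositions $u\ast_i v\in C_{\max(k,l)}$ for $u\in C_k$, $v\in C_l$, $k,l>0$, $i=\min(k,l)-1$, $\partial^+_i(u)=\partial^-_i(v)$ ("$i$-composable"), such that: $\partial^\pm(\mathrm{id}_u)=u$; $\partial^\epsilon(u\ast_i v)$ is $u\ast_i\partial^\epsilon v$ if $k<l$, $\partial^\epsilon u\ast_i v$ if $k>l$, and $\partial^-u$ (resp. $\partial^+v$) for $\epsilon=-$ (resp. $+$) if $k=l$; composing with an identity on a cell of dimension $i$ via $\ast_i$ is trivial, and $\mathrm{id}_u\ast_i v=\mathrm{id}_{u\ast_i v}$, $v\ast_i\mathrm{id}_u=\mathrm{id}_{v\ast_i u}$ when $\dim u>i$ and $\dim v=i+1$; each $\ast_i$ is associative whenever both sides are defined; for $i<j$ and $u$ of dimension $i+1$, $u\ast_i(v\ast_j v')=(u\ast_i v)\ast_j(u\ast_i v')$ and $(v\ast_j v')\ast_i u=(v\ast_i u)\ast_j(v'\ast_i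 u)$ whenever the left sides are defined. Morphisms preserve all the structure. **Prepolygraphs.** A $0$-prepolygraph is a set $\mathsf P_0$, with $\mathsf P^*_0=\mathsf P_0$. An $(n+1)$-prepolygraph is an $n$-prepolygraph $(\mathsf P_0,\dots,\mathsf P_n)$, generating a free $n$-precategory with $i$-cells $\mathsf P^*_i$, together with a set $\mathsf P_{n+1}$ of $(n+1)$-generators with source and target in $\mathsf P^*_n$ (parallel if $n\ge1$); its free $(n+1)$-precategory $\mathsf P^*$ is obtained by freely adjoining the elements of $\mathsf P_{n+1}$ as $(n+1)$-cells. $\mathsf P_{\le k}$ is the underlying $k$-prepolygraph. Every $2$-cell of $\mathsf P^*$ is uniquely a $\ast_1$-composite of whiskers $l\ast_0\alpha\ast_0 r$ with $\alpha\in\mathsf P_2$, $l,r\in\mathsf P^*_1$; their number is its length $|\cdot|$. **Presented precategory.** A congruence on an $n$-precategory $C$ is an equivalence relation on $C_n$ relating only cells with the same source and target and stable under $u\mapsto v\ast_i u\ast_i w$ for all $i<n$ and $v,w\in C_{i+1}$. For an $(n+1)$-prepolygraph $\mathsf P$, $\overline{\mathsf P}=(\mathsf P_{\le n})^*/{\sim^{\mathsf P}}$ where $\sim^{\mathsf P}$ is the smallest congruence with $\partial^-(A)\sim^{\mathsf P}\partial^+(A)$ for all $A\in\mathsf P_{n+1}$. **Gray presentation.** A $4$-prepolygraph $\mathsf P$ containing the following distinguished generators. (a) For $\alpha:f\Rightarrow f'$, $\beta:h\Rightarrow h'$ in $\mathsf P_2$ and $g\in\mathsf P^*_1$ with $\alpha,g,\beta$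 $0$-composable, a $3$-generator (interchange generator) $X_{\alpha,g,\beta}:(\alpha\ast_0 g\ast_0 h)\ast_1(f'\ast_0 g\ast_0\beta)\Rrightarrow(f\ast_0 g\ast_0\beta)\ast_1(\alpha\ast_0 g\ast_0 h')$. (b) For $A:\phi\Rrightarrow\phi'$, $B:\psi\Rrightarrow\psi'$ in $\mathsf P_3$, $e,h,e',h'\in\mathsf P^*_1$, $\chi\in\mathsf P^*_2$ such that $(e\ast_0\phi\ast_0 h)\ast_1\chi\ast_1(e'\ast_0\psi\ast_0 h')$ is defined, a $4$-generator (independence generator) from $((e\ast_0 A\ast_0 h)\ast_1\chi\ast_1(e'\ast_0\psi\ast_0 h'))\ast_2((e\ast_0\phi'\ast_0 h)\ast_1\chi\ast_1(e'\ast_0 B\ast_0 h'))$ to $((e\ast_0\phi\ast_0 h)\ast_1\chi\ast_1(e'\ast_0 B\ast_0 h'))\ast_2((e\ast_0 A\ast_0 h)\ast_1\chi\ast_1(e'\ast_0\psi'\ast_0 h'))$. (c) For $0$-composable $A,g,\beta$ with $A:\phi\Rrightarrow\phi':f\Rightarrow f'$ in $\mathsf P_3$, $g\in\mathsf P^*_1$, $\beta:h\Rightarrow h'$ in $\mathsf P_2$, a $4$-generator (interchange naturality generator) from $((A\ast_0 g\ast_0 h)\ast_1(f'\ast_0 g\ast_0\beta))\ast_2 X_{\phi',g\ast_0\beta}$ to $X_{\phi,g\ast_0\beta}\ast_2((f\ast_0 g\ast_0\beta)\ast_1(A\ast_0 g\ast_0 h'))$; and for $0$-composable $\alpha,g,B$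 with $\alpha:f\Rightarrow f'$ in $\mathsf P_2$, $B:\psi\Rrightarrow\psi':h\Rightarrow h'$ in $\mathsf P_3$, a $4$-generator from $((\alpha\ast_0 g\ast_0 h)\ast_1(f'\ast_0 g\ast_0 B))\ast_2 X_{\alpha\ast_0 g,\psi'}$ to $X_{\alpha\ast_0 g,\psi}\ast_2((f\ast_0 g\ast_0 B)\ast_1(\alpha\ast_0 g\ast_0 h'))$. Here, for $0$-composable $\phi,\psi\in\mathsf P^*_2$ with whisker decompositions $\phi=\phi_1\ast_1\cdots\ast_1\phi_k$, $\psi=\psi_1\ast_1\cdots\ast_1\psi_{k'}$, $\phi_i=f_i\ast_0\alpha_i\ast_0 g_i$, $\psi_j=f'_j\ast_0\beta_j\ast_0 g'_j$, the $3$-cell $X_{\phi,\psi}:(\phi\ast_0\partial^-_1\psi)\ast_1(\partial^+_1\phi\ast_0\psi)\Rrightarrow(\partial^-_1\phi\ast_0\psi)\ast_1(\phi\ast_0\partial^+_1\psi)$ is the $\ast_2$-composite of $kk'$ elementary swaps, which first move $\phi_k$ successively past $\psi_1,\dots,\psi_{k'}$, then $\phi_{k-1}$ past $\psi_1,\dots,\psi_{k'}$, and so on; the elementary swap of consecutive $\phi_i,\psi_j$ in an interleaving is $\lambda\ast_1(f_i\ast_0 X_{\alpha_i,\,g_i\ast_0 f'_j,\,\beta_j}\ast_0 g'_j)\ast_1\rho$, where $\lambda,\rho$ are the parts of the interleaving before and after. **Coherence.** A $3$-precategory is coherent if any two parallel $3$-cells are equal. For a $3$-precategory $C$, its localization $C^\top$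 is the $3$-precategory obtained by formally inverting all $3$-cells (with respect to $\ast_2$), i.e. the image of $C$ under the left adjoint to the inclusion of $3$-precategories with all $3$-cells invertible; it has the same cells as $C$ in dimensions $\le2$. A Gray presentation $\mathsf Q$ is coherent when $\overline{\mathsf Q}^\top$ is coherent. **Rewriting.** A rewriting system $(\mathsf P,\equiv)$ is a $3$-prepolygraph $\mathsf P$ with a congruence $\equiv$ on $\mathsf P^*$. A rewriting step is a $3$-cell $\lambda\ast_1(l\ast_0 A\ast_0 r)\ast_1\rho$ with $A\in\mathsf P_3$, $l,r\in\mathsf P_1^*$, $\lambda,\rho\in\mathsf P_2^*$; a rewriting path is any $3$-cell of $\mathsf P^*$ (uniquely a $\ast_2$-composite of steps). $\mathsf P$ is terminating if there is no infinite sequence of rewriting steps $\phi_0\Rrightarrow\phi_1\Rrightarrow\cdots$. A branching is a pair of rewriting paths $F_1:\phi\Rrightarrow\phi_1$, $F_2:\phi\Rrightarrow\phi_2$ with the same source; its symmetric branching is $(F_2,F_1)$; it is local if both are steps; it is confluent if there are rewriting paths $G_i:\phi_i\Rrightarrow\psi$ with $F_1\ast_2G_1\equiv F_2\ast_2G_2$. **Critical branchings** (for $\mathsf P=\mathsf Q_{\le3}$). A local branching $(S_1,S_2)$ is: trivial if $S_1=S_2$; minimal if whenever $S_i=\lambda\ast_1(l\ast_0S'_i\ast_0r)\ast_1\rho$ ($i=1,2$) for a local branching $(S'_1,S'_2)$, $1$-cells $l,r$ and $2$-cells $\lambda,\rho$, then $l,r,\lambda,\rho$ are identities; independent if $S_1=(l_1\ast_0A_1\ast_0r_1)\ast_1\chi\ast_1(l_2\ast_0\phi_2\ast_0r_2)$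 and $S_2=(l_1\ast_0\phi_1\ast_0r_1)\ast_1\chi\ast_1(l_2\ast_0A_2\ast_0r_2)$ with $A_i:\phi_i\Rrightarrow\phi'_i$ in $\mathsf P_3$; natural if either $S_1=(A\ast_0g\ast_0h)\ast_1(f'\ast_0g\ast_0\psi)$ with $A:\phi\Rrightarrow\phi':f\Rightarrow f'$ in $\mathsf P_3$, $g\in\mathsf P_1^*$, $\psi:h\Rightarrow h'$ in $\mathsf P_2^*$, and $S_2$ is the elementary swap of the last whisker of $\phi$ with the first whisker of $g\ast_0\psi$ in $(\phi\ast_0g\ast_0h)\ast_1(f'\ast_0g\ast_0\psi)$, or, symmetrically, $S_1=(\phi\ast_0g\ast_0h)\ast_1(f'\ast_0g\ast_0B)$ with $\phi:f\Rightarrow f'$ in $\mathsf P_2^*$, $B:\psi\Rrightarrow\psi':h\Rightarrow h'$ in $\mathsf P_3$ and $S_2$ is the elementary swap of the last whisker of $\phi\ast_0g$ with the first whisker of $\psi$. It is critical if it is minimal and neither it nor its symmetric branching is trivial, independent or natural. *)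

theory Defs
  imports Main
begin


section \<open>Precategories\<close>

datatype sign = Neg | Pos

text \<open>
  A globular set with identities and compositions: \<open>bd C e i\<close> maps \<open>(i+1)\<close>-cells to
  \<open>i\<close>-cells (\<open>Neg\<close>: source, \<open>Pos\<close>: target), \<open>idn C i\<close> maps \<open>i\<close>-cells to \<open>(i+1)\<close>-cells, and
  \<open>cmp C k l u v\<close> is the composite \<open>u *\<^sub>i v\<close> of a \<open>k\<close>-cell and an \<open>l\<close>-cell, where
  \<open>i = min k l - 1\<close>.  Dimensions are explicit because the sets \<open>cells C k\<close> may overlap.
\<close>

record 'c precat =
  cells :: "nat \<Rightarrow> 'c set"
  bd :: "sign \<Rightarrow> nat \<Rightarrow> 'c \<Rightarrow> 'c"
  idn :: "nat \<Rightarrow> 'c \<Rightarrow> 'c"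
  cmp :: "nat \<Rightarrow> nat \<Rightarrow> 'c \<Rightarrow> 'c \<Rightarrow> 'c"

text \<open>The iterated boundary from dimension \<open>k\<close> down to dimension \<open>i \<le> k\<close>.\<close>

primrec bdto :: "'c precat \<Rightarrow> sign \<Rightarrow> nat \<Rightarrow> nat \<Rightarrow> 'c \<Rightarrow> 'c" where
  "bdto C e i 0 u = u"
| "bdto C e i (Suc k) u = (if i \<le> k then bdto C e i k (bd C e k u) else u)"

definition composable :: "'c precat \<Rightarrow> nat \<Rightarrow> nat \<Rightarrow> 'c \<Rightarrow> 'c \<Rightarrow> bool" where
  "composable C k l u v \<longleftrightarrow> 0 < k \<and> 0 < l \<and> u \<in> cells C k \<and> v \<in> cells C l \<and>
     bdto C Pos (min k l - 1) k u = bdto C Neg (min k l - 1) l v"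

locale precategory =
  fixes n :: nat and C :: "'c precat"
  assumes bd_cell: "\<lbrakk>i < n; u \<in> cells C (Suc i)\<rbrakk> \<Longrightarrow> bd C e i u \<in> cells C i"
    and globular: "\<lbrakk>Suc i < n; u \<in> cells C (Suc (Suc i))\<rbrakk> \<Longrightarrow>
      bd C e i (bd C Neg (Suc i) u) = bd C e i (bd C Pos (Suc i) u)"
    and idn_cell: "\<lbrakk>i < n; u \<in> cells C i\<rbrakk> \<Longrightarrow> idn C i u \<in> cells C (Suc i)"
    and bd_idn: "\<lbrakk>i < n; u \<in> cells C i\<rbrakk> \<Longrightarrow> bd C e i (idn C i u) = u"
    and cmp_cell: "\<lbrakk>max k l \<le> n; composable C k l u v\<rbrakk> \<Longrightarrow> cmp C k l u v \<in> cells C (max k l)"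
    and bd_cmp_less: "\<lbrakk>k < l; l \<le> n; composable C k l u v\<rbrakk> \<Longrightarrow>
      bd C e (l - 1) (cmp C k l u v) = cmp C k (l - 1) u (bd C e (l - 1) v)"
    and bd_cmp_greater: "\<lbrakk>l < k; k \<le> n; composable C k l u v\<rbrakk> \<Longrightarrow>
      bd C e (k - 1) (cmp C k l u v) = cmp C (k - 1) l (bd C e (k - 1) u) v"
    and src_cmp: "\<lbrakk>k \<le> n; composable C k k u v\<rbrakk> \<Longrightarrow>
      bd C Neg (k - 1) (cmp C k k u v) = bd C Neg (k - 1) u"
    and tgt_cmp: "\<lbrakk>k \<le> n; composable C k k u v\<rbrakk> \<Longrightarrow>
      bd C Pos (k - 1) (cmp C k k u v) = bd C Pos (k - 1) v"
    and cmp_idn_right: "\<lbrakk>i < k; k \<le> n; u \<in> cells C k\<rbrakk> \<Longrightarrow>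
      cmp C k (Suc i) u (idn C i (bdto C Pos i k u)) = u"
    and cmp_idn_left: "\<lbrakk>i < k; k \<le> n; u \<in> cells C k\<rbrakk> \<Longrightarrow>
      cmp C (Suc i) k (idn C i (bdto C Neg i k u)) u = u"
    and idn_cmp_right: "\<lbrakk>i < k; k < n; composable C k (Suc i) u v\<rbrakk> \<Longrightarrow>
      cmp C (Suc k) (Suc i) (idn C k u) v = idn C k (cmp C k (Suc i) u v)"
    and idn_cmp_left: "\<lbrakk>i < k; k < n; composable C (Suc i) k v u\<rbrakk> \<Longrightarrow>
      cmp C (Suc i) (Suc k) v (idn C k u) = idn C k (cmp C (Suc i) k v u)"
    and cmp_assoc: "\<lbrakk>k \<le> n; l \<le> n; m \<le> n;
      min k l = Suc i; min (max k l) m = Suc i; min l m = Suc i; min k (max l m) = Suc i;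
      composable C k l u v; composable C (max k l) m (cmp C k l u v) w;
      composable C l m v w; composable C k (max l m) u (cmp C l m v w)\<rbrakk> \<Longrightarrow>
      cmp C (max k l) m (cmp C k l u v) w = cmp C k (max l m) u (cmp C l m v w)"
    and cmp_distrib_left: "\<lbrakk>k \<le> n; l \<le> n; Suc i < min k l; composable C k l v v';
      composable C (Suc i) (max k l) u (cmp C k l v v')\<rbrakk> \<Longrightarrow>
      cmp C (Suc i) (max k l) u (cmp C k l v v')
        = cmp C k l (cmp C (Suc i) k u v) (cmp C (Suc i) l u v')"
    and cmp_distrib_right: "\<lbrakk>k \<le> n; l \<le> n; Suc i < min k l; composable C k l v v';
      composable C (max k l) (Suc i) (cmp C k l v v') u\<rbrakk> \<Longrightarrow>
      cmp C (max k l) (Suc i) (cmp C k l v v') u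
        = cmp C k l (cmp C k (Suc i) v u) (cmp C l (Suc i) v' u)"

definition precat_morphism :: "nat \<Rightarrow> 'c precat \<Rightarrow> 'd precat \<Rightarrow> (nat \<Rightarrow> 'c \<Rightarrow> 'd) \<Rightarrow> bool" where
  "precat_morphism n C D h \<longleftrightarrow>
     (\<forall>k\<le>n. \<forall>u\<in>cells C k. h k u \<in> cells D k) \<and>
     (\<forall>i<n. \<forall>u\<in>cells C (Suc i). \<forall>e. h i (bd C e i u) = bd D e i (h (Suc i) u)) \<and>
     (\<forall>i<n. \<forall>u\<in>cells C i. h (Suc i) (idn C i u) = idn D i (h i u)) \<and>
     (\<forall>k\<le>n. \<forall>l\<le>n. \<forall>u v. composable C k l u v \<longrightarrow>
        h (max k l) (cmp C k l u v) = cmp D k l (h k u) (h l v))"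

text \<open>Congruences relate cells of the top dimension \<open>n > 0\<close> only.\<close>

definition congruence :: "nat \<Rightarrow> 'c precat \<Rightarrow> ('c \<times> 'c) set \<Rightarrow> bool" where
  "congruence n C R \<longleftrightarrow> R \<subseteq> cells C n \<times> cells C n \<and> equiv (cells C n) R \<and>
     (\<forall>(u, u')\<in>R. \<forall>e. bd C e (n - 1) u = bd C e (n - 1) u') \<and>
     (\<forall>(u, u')\<in>R. \<forall>i<n. \<forall>v w. composable C (Suc i) n v u \<and>
        composable C n (Suc i) (cmp C (Suc i) n v u) w \<longrightarrow>
        (cmp C n (Suc i) (cmp C (Suc i) n v u) w,
         cmp C n (Suc i) (cmp C (Suc i) n v u') w) \<in> R)"

definition generated_congruence :: "nat \<Rightarrow> 'c precat \<Rightarrow> ('c \<times> 'c) set \<Rightarrow> ('c \<times> 'c) set" where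
  "generated_congruence n C S = \<Inter>{R. congruence n C R \<and> S \<subseteq> R}"

text \<open>
  In the quotient, cells of dimension below \<open>n\<close> are represented by singletons, \<open>n\<close>-cells by
  equivalence classes.
\<close>

definition quot_class :: "nat \<Rightarrow> ('c \<times> 'c) set \<Rightarrow> nat \<Rightarrow> 'c set \<Rightarrow> 'c set" where
  "quot_class n R k U = (if k = n then R `` U else U)"

definition quotient_precat :: "nat \<Rightarrow> 'c precat \<Rightarrow> ('c \<times> 'c) set \<Rightarrow> 'c set precat" where
  "quotient_precat n C R =
    \<lparr> cells = (\<lambda>k. (\<lambda>u. quot_class n R k {u}) ` cells C k),
      bd = (\<lambda>e i U. bd C e i ` U),
      idn = (\<lambda>i U. quot_class n R (Suc i) (idn C i ` U)),
      cmp = (\<lambda>k l U V. quot_class n R (max k l) {cmp C k l u v | u v. u \<in> U \<and> v \<in> V}) \<rparr>"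

definition coherent :: "nat \<Rightarrow> 'c precat \<Rightarrow> bool" where
  "coherent n C \<longleftrightarrow> (\<forall>u\<in>cells C n. \<forall>v\<in>cells C n.
     (\<forall>e. bd C e (n - 1) u = bd C e (n - 1) v) \<longrightarrow> u = v)"


section \<open>Paths\<close>

datatype ('x, 'w) path = Path (psrc: 'x) (edges: "'w list")

primrec endpoint :: "('w \<Rightarrow> 'x) \<Rightarrow> 'x \<Rightarrow> 'w list \<Rightarrow> 'x" where
  "endpoint t x [] = x"
| "endpoint t x (w # ws) = endpoint t (t w) ws"

primrec chain :: "(sign \<Rightarrow> 'w \<Rightarrow> 'x) \<Rightarrow> 'x \<Rightarrow> 'w list \<Rightarrow> bool" where
  "chain d x [] \<longleftrightarrow> True"
| "chain d x (w # ws) \<longleftrightarrow> d Neg w = x \<and> chain d (d Pos w) ws"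

definition paths :: "'x set \<Rightarrow> 'w set \<Rightarrow> (sign \<Rightarrow> 'w \<Rightarrow> 'x) \<Rightarrow> ('x, 'w) path set" where
  "paths V E d = {p. psrc p \<in> V \<and> set (edges p) \<subseteq> E \<and> chain d (psrc p) (edges p)}"

primrec path_bd :: "(sign \<Rightarrow> 'w \<Rightarrow> 'x) \<Rightarrow> sign \<Rightarrow> ('x, 'w) path \<Rightarrow> 'x" where
  "path_bd d Neg p = psrc p"
| "path_bd d Pos p = endpoint (d Pos) (psrc p) (edges p)"

abbreviation id_path :: "'x \<Rightarrow> ('x, 'w) path" where
  "id_path x \<equiv> Path x []"

definition pcomp :: "('x, 'w) path \<Rightarrow> ('x, 'w) path \<Rightarrow> ('x, 'w) path" (infixr "\<odot>" 65) where
  "p \<odot> q = Path (psrc p) (edges p @ edges q)"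


section \<open>Localization\<close>

text \<open>
  The \<open>n\<close>-cells of the localization of \<open>C\<close> are zigzags of \<open>n\<close>-cells of \<open>C\<close>, where \<open>(F, Neg)\<close>
  stands for the formal inverse of \<open>F\<close>, modulo the congruence making \<open>F \<mapsto> (F, Pos)\<close> functorial
  and \<open>(F, Neg)\<close> inverse to \<open>(F, Pos)\<close>.
\<close>

datatype 'c zcell = Base (the_base: 'c) | Zigzag (the_zigzag: "('c, 'c \<times> sign) path")

fun edge_bd :: "nat \<Rightarrow> 'c precat \<Rightarrow> sign \<Rightarrow> 'c \<times> sign \<Rightarrow> 'c" where
  "edge_bd n C e (F, Pos) = bd C e (n - 1) F"
| "edge_bd n C Neg (F, Neg) = bd C Pos (n - 1) F"
| "edge_bd n C Pos (F, Neg) = bd C Neg (n - 1) F"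

definition zigzags :: "nat \<Rightarrow> 'c precat \<Rightarrow> ('c, 'c \<times> sign) path set" where
  "zigzags n C = paths (cells C (n - 1)) (cells C n \<times> UNIV) (edge_bd n C)"

fun zigzag_cmp :: "nat \<Rightarrow> 'c precat \<Rightarrow> nat \<Rightarrow> nat \<Rightarrow> 'c zcell \<Rightarrow> 'c zcell \<Rightarrow> 'c zcell" where
  "zigzag_cmp n C k l (Base u) (Base v) = Base (cmp C k l u v)"
| "zigzag_cmp n C k l (Base u) (Zigzag z) =
     Zigzag (Path (cmp C k (n - 1) u (psrc z)) (map (\<lambda>(F, e). (cmp C k n u F, e)) (edges z)))"
| "zigzag_cmp n C k l (Zigzag z) (Base v) =
     Zigzag (Path (cmp C (n - 1) l (psrc z) v) (map (\<lambda>(F, e). (cmp C n l F v, e)) (edges z)))"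
| "zigzag_cmp n C k l (Zigzag z) (Zigzag z') = Zigzag (z \<odot> z')"

definition zigzag_precat :: "nat \<Rightarrow> 'c precat \<Rightarrow> 'c zcell precat" where
  "zigzag_precat n C =
    \<lparr> cells = (\<lambda>k. if k = n then Zigzag ` zigzags n C else Base ` cells C k),
      bd = (\<lambda>e i u. if Suc i = n then Base (path_bd (edge_bd n C) e (the_zigzag u))
                    else Base (bd C e i (the_base u))),
      idn = (\<lambda>i u. if Suc i = n then Zigzag (id_path (the_base u))
                   else Base (idn C i (the_base u))),
      cmp = zigzag_cmp n C \<rparr>"

inductive_set zigzag_rel :: "nat \<Rightarrow> 'c precat \<Rightarrow> ('c zcell \<times> 'c zcell) set"
  for n :: nat and C :: "'c precat" where
  zz_cmp: "composable C n n F G \<Longrightarrow>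
    (Zigzag (Path (bd C Neg (n - 1) F) [(F, Pos), (G, Pos)]),
     Zigzag (Path (bd C Neg (n - 1) F) [(cmp C n n F G, Pos)])) \<in> zigzag_rel n C"
| zz_idn: "x \<in> cells C (n - 1) \<Longrightarrow>
    (Zigzag (Path x [(idn C (n - 1) x, Pos)]), Zigzag (id_path x)) \<in> zigzag_rel n C"
| zz_inv_right: "F \<in> cells C n \<Longrightarrow>
    (Zigzag (Path (bd C Neg (n - 1) F) [(F, Pos), (F, Neg)]),
     Zigzag (id_path (bd C Neg (n - 1) F))) \<in> zigzag_rel n C"
| zz_inv_left: "F \<in> cells C n \<Longrightarrow>
    (Zigzag (Path (bd C Pos (n - 1) F) [(F, Neg), (F, Pos)]),
     Zigzag (id_path (bd C Pos (n - 1) F))) \<in> zigzag_rel n C"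

definition localization :: "nat \<Rightarrow> 'c precat \<Rightarrow> 'c zcell set precat" where
  "localization n C = quotient_precat n (zigzag_precat n C)
     (generated_congruence n (zigzag_precat n C) (zigzag_rel n C))"


section \<open>Prepolygraphs and free precategories\<close>

text \<open>
  The cells of dimension 1, 2 and 3 of a free precategory are paths whose edges are respectively
  the 1-generators, the whiskers \<open>l *\<^sub>0 a *\<^sub>0 r\<close> of 2-generators and the whiskers
  \<open>\<lambda> *\<^sub>1 (l *\<^sub>0 A *\<^sub>0 r) *\<^sub>1 \<rho>\<close> of 3-generators: the axioms of precategories allow every composite
  to be written uniquely in this form.  That \<open>free_precat\<close> below is obtained by freely adjoining the
  generators dimension by dimension is proved at the end (\<open>free_precategory\<close>, \<open>free_extension1\<close>,
  \<open>free_unique1\<close>, and so on up to dimension 3).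
\<close>

datatype ('x, 'a) whisker = Whisker 'x 'a 'x

datatype ('x, 'y, 'a) step = Step 'y 'x 'a 'x 'y

type_synonym ('a0, 'a1) cell1 = "('a0, 'a1) path"
type_synonym ('a0, 'a1, 'a2) cell2 = "(('a0, 'a1) cell1, (('a0, 'a1) cell1, 'a2) whisker) path"
type_synonym ('a0, 'a1, 'a2, 'a3) cell3 =
  "(('a0, 'a1, 'a2) cell2, (('a0, 'a1) cell1, ('a0, 'a1, 'a2) cell2, 'a3) step) path"

record ('a0, 'a1, 'a2, 'a3) prepolygraph3 =
  gens0 :: "'a0 set"
  gens1 :: "'a1 set"
  d0 :: "sign \<Rightarrow> 'a1 \<Rightarrow> 'a0"
  gens2 :: "'a2 set"
  d1 :: "sign \<Rightarrow> 'a2 \<Rightarrow> ('a0, 'a1) cell1"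
  gens3 :: "'a3 set"
  d2 :: "sign \<Rightarrow> 'a3 \<Rightarrow> ('a0, 'a1, 'a2) cell2"

record ('a0, 'a1, 'a2, 'a3, 'a4) prepolygraph4 = "('a0, 'a1, 'a2, 'a3) prepolygraph3" +
  gens4 :: "'a4 set"
  d3 :: "sign \<Rightarrow> 'a4 \<Rightarrow> ('a0, 'a1, 'a2, 'a3) cell3"

subsection \<open>Composition and whiskering\<close>

text \<open>
  \<open>\<odot>\<close> is \<open>*\<^sub>0\<close> on 1-cells, \<open>*\<^sub>1\<close> on 2-cells and \<open>*\<^sub>2\<close> on 3-cells; \<open>\<rhd>\<close>, \<open>\<lhd>\<close> are \<open>*\<^sub>0\<close> of a 1-cell
  and a 2-cell; \<open>\<rhd>\<^sub>0\<close>, \<open>\<lhd>\<^sub>0\<close> are \<open>*\<^sub>0\<close> of a 1-cell and a 3-cell; \<open>\<rhd>\<^sub>1\<close>, \<open>\<lhd>\<^sub>1\<close> are \<open>*\<^sub>1\<close> of a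
  2-cell and a 3-cell.  The triangle points to the cell of higher dimension.
\<close>

primrec lwhisk :: "('a0, 'a1) cell1 \<Rightarrow> (('a0, 'a1) cell1, 'a2) whisker
    \<Rightarrow> (('a0, 'a1) cell1, 'a2) whisker" where
  "lwhisk f (Whisker l a r) = Whisker (f \<odot> l) a r"

primrec rwhisk :: "(('a0, 'a1) cell1, 'a2) whisker \<Rightarrow> ('a0, 'a1) cell1
    \<Rightarrow> (('a0, 'a1) cell1, 'a2) whisker" where
  "rwhisk (Whisker l a r) g = Whisker l a (r \<odot> g)"

definition lwhisk2 :: "('a0, 'a1) cell1 \<Rightarrow> ('a0, 'a1, 'a2) cell2 \<Rightarrow> ('a0, 'a1, 'a2) cell2"
    (infixr "\<rhd>" 71) where
  "f \<rhd> \<phi> = Path (f \<odot> psrc \<phi>) (map (lwhisk f) (edges \<phi>))"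

definition rwhisk2 :: "('a0, 'a1, 'a2) cell2 \<Rightarrow> ('a0, 'a1) cell1 \<Rightarrow> ('a0, 'a1, 'a2) cell2"
    (infixl "\<lhd>" 70) where
  "\<phi> \<lhd> g = Path (psrc \<phi> \<odot> g) (map (\<lambda>w. rwhisk w g) (edges \<phi>))"

primrec lstep0 :: "('a0, 'a1) cell1 \<Rightarrow> (('a0, 'a1) cell1, ('a0, 'a1, 'a2) cell2, 'a3) step
    \<Rightarrow> (('a0, 'a1) cell1, ('a0, 'a1, 'a2) cell2, 'a3) step" where
  "lstep0 f (Step \<kappa> l A r \<rho>) = Step (f \<rhd> \<kappa>) (f \<odot> l) A r (f \<rhd> \<rho>)"

primrec rstep0 :: "(('a0, 'a1) cell1, ('a0, 'a1, 'a2) cell2, 'a3) step \<Rightarrow> ('a0, 'a1) cell1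
    \<Rightarrow> (('a0, 'a1) cell1, ('a0, 'a1, 'a2) cell2, 'a3) step" where
  "rstep0 (Step \<kappa> l A r \<rho>) g = Step (\<kappa> \<lhd> g) l A (r \<odot> g) (\<rho> \<lhd> g)"

primrec lstep1 :: "('a0, 'a1, 'a2) cell2 \<Rightarrow> (('a0, 'a1) cell1, ('a0, 'a1, 'a2) cell2, 'a3) step
    \<Rightarrow> (('a0, 'a1) cell1, ('a0, 'a1, 'a2) cell2, 'a3) step" where
  "lstep1 \<chi> (Step \<kappa> l A r \<rho>) = Step (\<chi> \<odot> \<kappa>) l A r \<rho>"

primrec rstep1 :: "(('a0, 'a1) cell1, ('a0, 'a1, 'a2) cell2, 'a3) step \<Rightarrow> ('a0, 'a1, 'a2) cell2
    \<Rightarrow> (('a0, 'a1) cell1, ('a0, 'a1, 'a2) cell2, 'a3) step" where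
  "rstep1 (Step \<kappa> l A r \<rho>) \<chi> = Step \<kappa> l A r (\<rho> \<odot> \<chi>)"

definition lwhisk30 :: "('a0, 'a1) cell1 \<Rightarrow> ('a0, 'a1, 'a2, 'a3) cell3
    \<Rightarrow> ('a0, 'a1, 'a2, 'a3) cell3" (infixr "\<rhd>\<^sub>0" 71) where
  "f \<rhd>\<^sub>0 F = Path (f \<rhd> psrc F) (map (lstep0 f) (edges F))"

definition rwhisk30 :: "('a0, 'a1, 'a2, 'a3) cell3 \<Rightarrow> ('a0, 'a1) cell1
    \<Rightarrow> ('a0, 'a1, 'a2, 'a3) cell3" (infixl "\<lhd>\<^sub>0" 70) where
  "F \<lhd>\<^sub>0 g = Path (psrc F \<lhd> g) (map (\<lambda>s. rstep0 s g) (edges F))"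

definition lwhisk31 :: "('a0, 'a1, 'a2) cell2 \<Rightarrow> ('a0, 'a1, 'a2, 'a3) cell3
    \<Rightarrow> ('a0, 'a1, 'a2, 'a3) cell3" (infixr "\<rhd>\<^sub>1" 68) where
  "\<chi> \<rhd>\<^sub>1 F = Path (\<chi> \<odot> psrc F) (map (lstep1 \<chi>) (edges F))"

definition rwhisk31 :: "('a0, 'a1, 'a2, 'a3) cell3 \<Rightarrow> ('a0, 'a1, 'a2) cell2
    \<Rightarrow> ('a0, 'a1, 'a2, 'a3) cell3" (infixl "\<lhd>\<^sub>1" 67) where
  "F \<lhd>\<^sub>1 \<chi> = Path (psrc F \<odot> \<chi>) (map (\<lambda>s. rstep1 s \<chi>) (edges F))"

subsection \<open>Boundaries and cells\<close>

abbreviation bd0 :: "('a0, 'a1, 'a2, 'a3, 'z) prepolygraph3_scheme \<Rightarrow> sign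
    \<Rightarrow> ('a0, 'a1) cell1 \<Rightarrow> 'a0" where
  "bd0 P \<equiv> path_bd (d0 P)"

primrec whisker_bd :: "('a0, 'a1, 'a2, 'a3, 'z) prepolygraph3_scheme \<Rightarrow> sign
    \<Rightarrow> (('a0, 'a1) cell1, 'a2) whisker \<Rightarrow> ('a0, 'a1) cell1" where
  "whisker_bd P e (Whisker l a r) = l \<odot> d1 P e a \<odot> r"

abbreviation bd1 :: "('a0, 'a1, 'a2, 'a3, 'z) prepolygraph3_scheme \<Rightarrow> sign
    \<Rightarrow> ('a0, 'a1, 'a2) cell2 \<Rightarrow> ('a0, 'a1) cell1" where
  "bd1 P \<equiv> path_bd (whisker_bd P)"

primrec step_bd :: "('a0, 'a1, 'a2, 'a3, 'z) prepolygraph3_scheme \<Rightarrow> sign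
    \<Rightarrow> (('a0, 'a1) cell1, ('a0, 'a1, 'a2) cell2, 'a3) step \<Rightarrow> ('a0, 'a1, 'a2) cell2" where
  "step_bd P e (Step \<kappa> l A r \<rho>) = \<kappa> \<odot> (l \<rhd> d2 P e A \<lhd> r) \<odot> \<rho>"

abbreviation bd2 :: "('a0, 'a1, 'a2, 'a3, 'z) prepolygraph3_scheme \<Rightarrow> sign
    \<Rightarrow> ('a0, 'a1, 'a2, 'a3) cell3 \<Rightarrow> ('a0, 'a1, 'a2) cell2" where
  "bd2 P \<equiv> path_bd (step_bd P)"

definition cells1 :: "('a0, 'a1, 'a2, 'a3, 'z) prepolygraph3_scheme \<Rightarrow> ('a0, 'a1) cell1 set" where
  "cells1 P = paths (gens0 P) (gens1 P) (d0 P)"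

text \<open>\<open>between P l f r\<close>: the 1-cells \<open>l\<close>, \<open>f\<close>, \<open>r\<close> are 0-composable.\<close>

definition between :: "('a0, 'a1, 'a2, 'a3, 'z) prepolygraph3_scheme
    \<Rightarrow> ('a0, 'a1) cell1 \<Rightarrow> ('a0, 'a1) cell1 \<Rightarrow> ('a0, 'a1) cell1 \<Rightarrow> bool" where
  "between P l f r \<longleftrightarrow> l \<in> cells1 P \<and> f \<in> cells1 P \<and> r \<in> cells1 P \<and>
     bd0 P Pos l = bd0 P Neg f \<and> bd0 P Pos f = bd0 P Neg r"

definition whiskers :: "('a0, 'a1, 'a2, 'a3, 'z) prepolygraph3_scheme
    \<Rightarrow> (('a0, 'a1) cell1, 'a2) whisker set" where
  "whiskers P = {Whisker l a r | l a r. a \<in> gens2 P \<and> between P l (d1 P Neg a) r}"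

definition cells2 :: "('a0, 'a1, 'a2, 'a3, 'z) prepolygraph3_scheme
    \<Rightarrow> ('a0, 'a1, 'a2) cell2 set" where
  "cells2 P = paths (cells1 P) (whiskers P) (whisker_bd P)"

text \<open>\<open>sandwich P \<kappa> l \<phi> r \<rho>\<close>: the 2-cell \<open>\<lambda> *\<^sub>1 (l *\<^sub>0 \<phi> *\<^sub>0 r) *\<^sub>1 \<rho>\<close> is defined.\<close>

definition sandwich :: "('a0, 'a1, 'a2, 'a3, 'z) prepolygraph3_scheme \<Rightarrow> ('a0, 'a1, 'a2) cell2
    \<Rightarrow> ('a0, 'a1) cell1 \<Rightarrow> ('a0, 'a1, 'a2) cell2 \<Rightarrow> ('a0, 'a1) cell1
    \<Rightarrow> ('a0, 'a1, 'a2) cell2 \<Rightarrow> bool" where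
  "sandwich P \<kappa> l \<phi> r \<rho> \<longleftrightarrow> \<kappa> \<in> cells2 P \<and> \<phi> \<in> cells2 P \<and> \<rho> \<in> cells2 P \<and>
     between P l (bd1 P Neg \<phi>) r \<and>
     bd1 P Pos \<kappa> = bd1 P Neg (l \<rhd> \<phi> \<lhd> r) \<and> bd1 P Pos (l \<rhd> \<phi> \<lhd> r) = bd1 P Neg \<rho>"

definition steps :: "('a0, 'a1, 'a2, 'a3, 'z) prepolygraph3_scheme
    \<Rightarrow> (('a0, 'a1) cell1, ('a0, 'a1, 'a2) cell2, 'a3) step set" where
  "steps P = {Step \<kappa> l A r \<rho> | \<kappa> l A r \<rho>. A \<in> gens3 P \<and> sandwich P \<kappa> l (d2 P Neg A) r \<rho>}"

definition cells3 :: "('a0, 'a1, 'a2, 'a3, 'z) prepolygraph3_scheme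
    \<Rightarrow> ('a0, 'a1, 'a2, 'a3) cell3 set" where
  "cells3 P = paths (cells2 P) (steps P) (step_bd P)"

definition prepolygraph3 :: "('a0, 'a1, 'a2, 'a3, 'z) prepolygraph3_scheme \<Rightarrow> bool" where
  "prepolygraph3 P \<longleftrightarrow>
     (\<forall>a\<in>gens1 P. \<forall>e. d0 P e a \<in> gens0 P) \<and>
     (\<forall>a\<in>gens2 P. (\<forall>e. d1 P e a \<in> cells1 P) \<and>
        (\<forall>e. bd0 P e (d1 P Neg a) = bd0 P e (d1 P Pos a))) \<and>
     (\<forall>A\<in>gens3 P. (\<forall>e. d2 P e A \<in> cells2 P) \<and>
        (\<forall>e. bd1 P e (d2 P Neg A) = bd1 P e (d2 P Pos A)))"

definition prepolygraph4 :: "('a0, 'a1, 'a2, 'a3, 'a4, 'z) prepolygraph4_scheme \<Rightarrow> bool" where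
  "prepolygraph4 P \<longleftrightarrow> prepolygraph3 P \<and>
     (\<forall>R\<in>gens4 P. (\<forall>e. d3 P e R \<in> cells3 P) \<and>
        (\<forall>e. bd2 P e (d3 P Neg R) = bd2 P e (d3 P Pos R)))"

text \<open>The generators as cells of the free precategory.\<close>

definition gen1 :: "('a0, 'a1, 'a2, 'a3, 'z) prepolygraph3_scheme \<Rightarrow> 'a1
    \<Rightarrow> ('a0, 'a1) cell1" where
  "gen1 P a = Path (d0 P Neg a) [a]"

definition gen2 :: "('a0, 'a1, 'a2, 'a3, 'z) prepolygraph3_scheme \<Rightarrow> 'a2
    \<Rightarrow> ('a0, 'a1, 'a2) cell2" where
  "gen2 P a = Path (d1 P Neg a)
     [Whisker (id_path (bd0 P Neg (d1 P Neg a))) a (id_path (bd0 P Pos (d1 P Neg a)))]"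

definition gen3 :: "('a0, 'a1, 'a2, 'a3, 'z) prepolygraph3_scheme \<Rightarrow> 'a3
    \<Rightarrow> ('a0, 'a1, 'a2, 'a3) cell3" where
  "gen3 P A = (let \<phi> = d2 P Neg A; f = bd1 P Neg \<phi>; f' = bd1 P Pos \<phi> in
     Path \<phi> [Step (id_path f) (id_path (bd0 P Neg f)) A (id_path (bd0 P Pos f)) (id_path f')])"

datatype ('a0, 'a1, 'a2, 'a3) cell =
    Cell0 'a0
  | Cell1 "('a0, 'a1) cell1"
  | Cell2 "('a0, 'a1, 'a2) cell2"
  | Cell3 "('a0, 'a1, 'a2, 'a3) cell3"

fun free_cells :: "('a0, 'a1, 'a2, 'a3, 'z) prepolygraph3_scheme \<Rightarrow> nat
    \<Rightarrow> ('a0, 'a1, 'a2, 'a3) cell set" where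
  "free_cells P k = (if k = 0 then Cell0 ` gens0 P else if k = 1 then Cell1 ` cells1 P
     else if k = 2 then Cell2 ` cells2 P else if k = 3 then Cell3 ` cells3 P else {})"

fun free_bd :: "('a0, 'a1, 'a2, 'a3, 'z) prepolygraph3_scheme \<Rightarrow> sign
    \<Rightarrow> ('a0, 'a1, 'a2, 'a3) cell \<Rightarrow> ('a0, 'a1, 'a2, 'a3) cell" where
  "free_bd P e (Cell0 x) = undefined"
| "free_bd P e (Cell1 f) = Cell0 (bd0 P e f)"
| "free_bd P e (Cell2 \<phi>) = Cell1 (bd1 P e \<phi>)"
| "free_bd P e (Cell3 F) = Cell2 (bd2 P e F)"

fun free_idn :: "('a0, 'a1, 'a2, 'a3) cell \<Rightarrow> ('a0, 'a1, 'a2, 'a3) cell" where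
  "free_idn (Cell0 x) = Cell1 (id_path x)"
| "free_idn (Cell1 f) = Cell2 (id_path f)"
| "free_idn (Cell2 \<phi>) = Cell3 (id_path \<phi>)"
| "free_idn (Cell3 F) = undefined"

fun free_cmp :: "('a0, 'a1, 'a2, 'a3) cell \<Rightarrow> ('a0, 'a1, 'a2, 'a3) cell
    \<Rightarrow> ('a0, 'a1, 'a2, 'a3) cell" where
  "free_cmp (Cell1 f) (Cell1 g) = Cell1 (f \<odot> g)"
| "free_cmp (Cell1 f) (Cell2 \<psi>) = Cell2 (f \<rhd> \<psi>)"
| "free_cmp (Cell1 f) (Cell3 G) = Cell3 (f \<rhd>\<^sub>0 G)"
| "free_cmp (Cell2 \<phi>) (Cell1 g) = Cell2 (\<phi> \<lhd> g)"
| "free_cmp (Cell2 \<phi>) (Cell2 \<psi>) = Cell2 (\<phi> \<odot> \<psi>)"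
| "free_cmp (Cell2 \<phi>) (Cell3 G) = Cell3 (\<phi> \<rhd>\<^sub>1 G)"
| "free_cmp (Cell3 F) (Cell1 g) = Cell3 (F \<lhd>\<^sub>0 g)"
| "free_cmp (Cell3 F) (Cell2 \<psi>) = Cell3 (F \<lhd>\<^sub>1 \<psi>)"
| "free_cmp (Cell3 F) (Cell3 G) = Cell3 (F \<odot> G)"
| "free_cmp u v = undefined"

definition free_precat :: "('a0, 'a1, 'a2, 'a3, 'z) prepolygraph3_scheme
    \<Rightarrow> ('a0, 'a1, 'a2, 'a3) cell precat" where
  "free_precat P = \<lparr> cells = free_cells P, bd = (\<lambda>e i. free_bd P e), idn = (\<lambda>i. free_idn),
     cmp = (\<lambda>k l. free_cmp) \<rparr>"

definition presentation_cong :: "('a0, 'a1, 'a2, 'a3, 'a4, 'z) prepolygraph4_scheme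
    \<Rightarrow> (('a0, 'a1, 'a2, 'a3) cell \<times> ('a0, 'a1, 'a2, 'a3) cell) set" where
  "presentation_cong P = generated_congruence 3 (free_precat P)
     {(Cell3 (d3 P Neg R), Cell3 (d3 P Pos R)) | R. R \<in> gens4 P}"

definition presented_precat :: "('a0, 'a1, 'a2, 'a3, 'a4, 'z) prepolygraph4_scheme
    \<Rightarrow> ('a0, 'a1, 'a2, 'a3) cell set precat" where
  "presented_precat P = quotient_precat 3 (free_precat P) (presentation_cong P)"


section \<open>Gray presentations\<close>

record ('a0, 'a1, 'a2, 'a3, 'a4) gray = "('a0, 'a1, 'a2, 'a3, 'a4) prepolygraph4" +
  interchange :: "'a2 \<Rightarrow> ('a0, 'a1) cell1 \<Rightarrow> 'a2 \<Rightarrow> 'a3"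

text \<open>The composites of the first \<open>i\<close> whiskers of a 2-cell, and of the remaining ones.\<close>

definition pre2 :: "nat \<Rightarrow> ('a0, 'a1, 'a2) cell2 \<Rightarrow> ('a0, 'a1, 'a2) cell2" where
  "pre2 i \<phi> = Path (psrc \<phi>) (take i (edges \<phi>))"

definition suf2 :: "('a0, 'a1, 'a2, 'a3, 'z) prepolygraph3_scheme \<Rightarrow> nat
    \<Rightarrow> ('a0, 'a1, 'a2) cell2 \<Rightarrow> ('a0, 'a1, 'a2) cell2" where
  "suf2 P i \<phi> = Path (bd1 P Pos (pre2 i \<phi>)) (drop i (edges \<phi>))"

text \<open>
  \<open>swap Q \<phi> \<psi> i j\<close> is the elementary swap of the \<open>i\<close>-th whisker of \<open>\<phi>\<close> and the \<open>j\<close>-th whisker of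
  \<open>\<psi>\<close> (counted from 0), in the interleaving where \<open>\<phi>\<^sub>0, \<dots>, \<phi>\<^sub>i\<^sub>-\<^sub>1\<close>, \<open>\<psi>\<^sub>0, \<dots>, \<psi>\<^sub>j\<^sub>-\<^sub>1\<close> come before
  them and \<open>\<psi>\<^sub>j\<^sub>+\<^sub>1, \<dots>\<close>, \<open>\<phi>\<^sub>i\<^sub>+\<^sub>1, \<dots>\<close> after.
\<close>

definition swap :: "('a0, 'a1, 'a2, 'a3, 'a4, 'z) gray_scheme \<Rightarrow> ('a0, 'a1, 'a2) cell2
    \<Rightarrow> ('a0, 'a1, 'a2) cell2 \<Rightarrow> nat \<Rightarrow> nat \<Rightarrow> ('a0, 'a1, 'a2, 'a3) cell3" where
  "swap Q \<phi> \<psi> i j = (case (edges \<phi> ! i, edges \<psi> ! j) of (Whisker f a g, Whisker f' b g') \<Rightarrow>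
     (let \<kappa> = (pre2 i \<phi> \<lhd> bd1 Q Neg \<psi>) \<odot> (whisker_bd Q Neg (Whisker f a g) \<rhd> pre2 j \<psi>);
          \<rho> = (whisker_bd Q Pos (Whisker f a g) \<rhd> suf2 Q (Suc j) \<psi>)
                \<odot> (suf2 Q (Suc i) \<phi> \<lhd> bd1 Q Pos \<psi>)
      in \<kappa> \<rhd>\<^sub>1 (f \<rhd>\<^sub>0 gen3 Q (interchange Q a (g \<odot> f') b) \<lhd>\<^sub>0 g') \<lhd>\<^sub>1 \<rho>))"

text \<open>The 3-cell \<open>X\<^bsub>\<phi>,\<psi>\<^esub>\<close>.\<close>

definition interchange_cell :: "('a0, 'a1, 'a2, 'a3, 'a4, 'z) gray_scheme \<Rightarrow> ('a0, 'a1, 'a2) cell2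
    \<Rightarrow> ('a0, 'a1, 'a2) cell2 \<Rightarrow> ('a0, 'a1, 'a2, 'a3) cell3" where
  "interchange_cell Q \<phi> \<psi> =
     foldl (\<odot>) (id_path ((\<phi> \<lhd> bd1 Q Neg \<psi>) \<odot> (bd1 Q Pos \<phi> \<rhd> \<psi>)))
       [swap Q \<phi> \<psi> i j. i \<leftarrow> rev [0..<length (edges \<phi>)], j \<leftarrow> [0..<length (edges \<psi>)]]"

definition has_interchange_gens :: "('a0, 'a1, 'a2, 'a3, 'a4, 'z) gray_scheme \<Rightarrow> bool" where
  "has_interchange_gens Q \<longleftrightarrow>
     (\<forall>a\<in>gens2 Q. \<forall>b\<in>gens2 Q. \<forall>g. between Q (d1 Q Neg a) g (d1 Q Neg b) \<longrightarrow>
       (let f = d1 Q Neg a; f' = d1 Q Pos a; h = d1 Q Neg b; h' = d1 Q Pos b;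
            X = interchange Q a g b
        in X \<in> gens3 Q \<and>
           d2 Q Neg X = (gen2 Q a \<lhd> (g \<odot> h)) \<odot> ((f' \<odot> g) \<rhd> gen2 Q b) \<and>
           d2 Q Pos X = ((f \<odot> g) \<rhd> gen2 Q b) \<odot> (gen2 Q a \<lhd> (g \<odot> h'))))"

text \<open>
  The 4-generators matter only through their boundaries, so the independence and naturality
  generators are required to exist but are not named.
\<close>

definition has_gen4 :: "('a0, 'a1, 'a2, 'a3, 'a4, 'z) prepolygraph4_scheme
    \<Rightarrow> ('a0, 'a1, 'a2, 'a3) cell3 \<Rightarrow> ('a0, 'a1, 'a2, 'a3) cell3 \<Rightarrow> bool" where
  "has_gen4 Q F G \<longleftrightarrow> (\<exists>R\<in>gens4 Q. d3 Q Neg R = F \<and> d3 Q Pos R = G)"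

definition has_independence_gens :: "('a0, 'a1, 'a2, 'a3, 'a4, 'z) prepolygraph4_scheme \<Rightarrow> bool"
  where
  "has_independence_gens Q \<longleftrightarrow>
     (\<forall>A\<in>gens3 Q. \<forall>B\<in>gens3 Q. \<forall>e h e' h'. \<forall>\<chi>\<in>cells2 Q.
       (let \<phi> = d2 Q Neg A; \<phi>' = d2 Q Pos A; \<psi> = d2 Q Neg B; \<psi>' = d2 Q Pos B in
        between Q e (bd1 Q Neg \<phi>) h \<and> between Q e' (bd1 Q Neg \<psi>) h' \<and>
        bd1 Q Pos (e \<rhd> \<phi> \<lhd> h) = bd1 Q Neg \<chi> \<and> bd1 Q Pos \<chi> = bd1 Q Neg (e' \<rhd> \<psi> \<lhd> h') \<longrightarrow>
        has_gen4 Q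
          (((e \<rhd>\<^sub>0 gen3 Q A \<lhd>\<^sub>0 h) \<lhd>\<^sub>1 (\<chi> \<odot> (e' \<rhd> \<psi> \<lhd> h')))
            \<odot> (((e \<rhd> \<phi>' \<lhd> h) \<odot> \<chi>) \<rhd>\<^sub>1 (e' \<rhd>\<^sub>0 gen3 Q B \<lhd>\<^sub>0 h')))
          ((((e \<rhd> \<phi> \<lhd> h) \<odot> \<chi>) \<rhd>\<^sub>1 (e' \<rhd>\<^sub>0 gen3 Q B \<lhd>\<^sub>0 h'))
            \<odot> ((e \<rhd>\<^sub>0 gen3 Q A \<lhd>\<^sub>0 h) \<lhd>\<^sub>1 (\<chi> \<odot> (e' \<rhd> \<psi>' \<lhd> h'))))))"

definition has_naturality_gens :: "('a0, 'a1, 'a2, 'a3, 'a4, 'z) gray_scheme \<Rightarrow> bool" where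
  "has_naturality_gens Q \<longleftrightarrow>
     (\<forall>A\<in>gens3 Q. \<forall>b\<in>gens2 Q. \<forall>g.
       (let \<phi> = d2 Q Neg A; \<phi>' = d2 Q Pos A; f = bd1 Q Neg \<phi>; f' = bd1 Q Pos \<phi>;
            h = d1 Q Neg b; h' = d1 Q Pos b; \<beta> = gen2 Q b in
        between Q f g h \<longrightarrow>
        has_gen4 Q
          (((gen3 Q A \<lhd>\<^sub>0 (g \<odot> h)) \<lhd>\<^sub>1 ((f' \<odot> g) \<rhd> \<beta>)) \<odot> interchange_cell Q \<phi>' (g \<rhd> \<beta>))
          (interchange_cell Q \<phi> (g \<rhd> \<beta>) \<odot> (((f \<odot> g) \<rhd> \<beta>) \<rhd>\<^sub>1 (gen3 Q A \<lhd>\<^sub>0 (g \<odot> h')))))) \<and>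
     (\<forall>a\<in>gens2 Q. \<forall>B\<in>gens3 Q. \<forall>g.
       (let \<psi> = d2 Q Neg B; \<psi>' = d2 Q Pos B; f = d1 Q Neg a; f' = d1 Q Pos a;
            h = bd1 Q Neg \<psi>; h' = bd1 Q Pos \<psi>; \<alpha> = gen2 Q a in
        between Q f g h \<longrightarrow>
        has_gen4 Q
          (((\<alpha> \<lhd> (g \<odot> h)) \<rhd>\<^sub>1 ((f' \<odot> g) \<rhd>\<^sub>0 gen3 Q B)) \<odot> interchange_cell Q (\<alpha> \<lhd> g) \<psi>')
          (interchange_cell Q (\<alpha> \<lhd> g) \<psi> \<odot> (((f \<odot> g) \<rhd>\<^sub>0 gen3 Q B) \<lhd>\<^sub>1 (\<alpha> \<lhd> (g \<odot> h'))))))"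

definition gray_presentation :: "('a0, 'a1, 'a2, 'a3, 'a4, 'z) gray_scheme \<Rightarrow> bool" where
  "gray_presentation Q \<longleftrightarrow> prepolygraph4 Q \<and> has_interchange_gens Q \<and>
     has_independence_gens Q \<and> has_naturality_gens Q"

definition coherent_gray_presentation :: "('a0, 'a1, 'a2, 'a3, 'a4, 'z) gray_scheme \<Rightarrow> bool" where
  "coherent_gray_presentation Q \<longleftrightarrow>
     gray_presentation Q \<and> coherent 3 (localization 3 (presented_precat Q))"


section \<open>Rewriting\<close>

text \<open>
  Rewriting paths are the 3-cells \<open>cells3 P\<close>.  A record extending \<open>prepolygraph3\<close> is used as its
  underlying 3-prepolygraph.
\<close>

definition rewriting_step :: "('a0, 'a1, 'a2, 'a3, 'z) prepolygraph3_scheme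
    \<Rightarrow> ('a0, 'a1, 'a2, 'a3) cell3 \<Rightarrow> bool" where
  "rewriting_step P S \<longleftrightarrow> (\<exists>A\<in>gens3 P. \<exists>\<kappa> l r \<rho>.
     sandwich P \<kappa> l (d2 P Neg A) r \<rho> \<and> S = \<kappa> \<rhd>\<^sub>1 (l \<rhd>\<^sub>0 gen3 P A \<lhd>\<^sub>0 r) \<lhd>\<^sub>1 \<rho>)"

definition terminating :: "('a0, 'a1, 'a2, 'a3, 'z) prepolygraph3_scheme \<Rightarrow> bool" where
  "terminating P \<longleftrightarrow> \<not> (\<exists>S :: nat \<Rightarrow> ('a0, 'a1, 'a2, 'a3) cell3.
     \<forall>i. rewriting_step P (S i) \<and> bd2 P Pos (S i) = bd2 P Neg (S (Suc i)))"

definition branching :: "('a0, 'a1, 'a2, 'a3, 'z) prepolygraph3_scheme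
    \<Rightarrow> ('a0, 'a1, 'a2, 'a3) cell3 \<Rightarrow> ('a0, 'a1, 'a2, 'a3) cell3 \<Rightarrow> bool" where
  "branching P F\<^sub>1 F\<^sub>2 \<longleftrightarrow> F\<^sub>1 \<in> cells3 P \<and> F\<^sub>2 \<in> cells3 P \<and> bd2 P Neg F\<^sub>1 = bd2 P Neg F\<^sub>2"

definition local_branching :: "('a0, 'a1, 'a2, 'a3, 'z) prepolygraph3_scheme
    \<Rightarrow> ('a0, 'a1, 'a2, 'a3) cell3 \<Rightarrow> ('a0, 'a1, 'a2, 'a3) cell3 \<Rightarrow> bool" where
  "local_branching P S\<^sub>1 S\<^sub>2 \<longleftrightarrow>
     branching P S\<^sub>1 S\<^sub>2 \<and> rewriting_step P S\<^sub>1 \<and> rewriting_step P S\<^sub>2"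

definition confluent_branching :: "('a0, 'a1, 'a2, 'a3, 'z) prepolygraph3_scheme
    \<Rightarrow> (('a0, 'a1, 'a2, 'a3) cell \<times> ('a0, 'a1, 'a2, 'a3) cell) set
    \<Rightarrow> ('a0, 'a1, 'a2, 'a3) cell3 \<Rightarrow> ('a0, 'a1, 'a2, 'a3) cell3 \<Rightarrow> bool" where
  "confluent_branching P R F\<^sub>1 F\<^sub>2 \<longleftrightarrow> (\<exists>G\<^sub>1\<in>cells3 P. \<exists>G\<^sub>2\<in>cells3 P.
     bd2 P Pos F\<^sub>1 = bd2 P Neg G\<^sub>1 \<and> bd2 P Pos F\<^sub>2 = bd2 P Neg G\<^sub>2 \<and>
     bd2 P Pos G\<^sub>1 = bd2 P Pos G\<^sub>2 \<and> (Cell3 (F\<^sub>1 \<odot> G\<^sub>1), Cell3 (F\<^sub>2 \<odot> G\<^sub>2)) \<in> R)"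

definition minimal_branching :: "('a0, 'a1, 'a2, 'a3, 'z) prepolygraph3_scheme
    \<Rightarrow> ('a0, 'a1, 'a2, 'a3) cell3 \<Rightarrow> ('a0, 'a1, 'a2, 'a3) cell3 \<Rightarrow> bool" where
  "minimal_branching P S\<^sub>1 S\<^sub>2 \<longleftrightarrow> (\<forall>S\<^sub>1' S\<^sub>2' \<kappa> l r \<rho>.
     local_branching P S\<^sub>1' S\<^sub>2' \<and> sandwich P \<kappa> l (bd2 P Neg S\<^sub>1') r \<rho> \<and>
     S\<^sub>1 = \<kappa> \<rhd>\<^sub>1 (l \<rhd>\<^sub>0 S\<^sub>1' \<lhd>\<^sub>0 r) \<lhd>\<^sub>1 \<rho> \<and> S\<^sub>2 = \<kappa> \<rhd>\<^sub>1 (l \<rhd>\<^sub>0 S\<^sub>2' \<lhd>\<^sub>0 r) \<lhd>\<^sub>1 \<rho> \<longrightarrow>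
     edges l = [] \<and> edges r = [] \<and> edges \<kappa> = [] \<and> edges \<rho> = [])"

definition independent_branching :: "('a0, 'a1, 'a2, 'a3, 'z) prepolygraph3_scheme
    \<Rightarrow> ('a0, 'a1, 'a2, 'a3) cell3 \<Rightarrow> ('a0, 'a1, 'a2, 'a3) cell3 \<Rightarrow> bool" where
  "independent_branching P S\<^sub>1 S\<^sub>2 \<longleftrightarrow> (\<exists>A\<^sub>1\<in>gens3 P. \<exists>A\<^sub>2\<in>gens3 P. \<exists>l\<^sub>1 r\<^sub>1 l\<^sub>2 r\<^sub>2. \<exists>\<chi>\<in>cells2 P.
     let \<phi>\<^sub>1 = d2 P Neg A\<^sub>1; \<phi>\<^sub>2 = d2 P Neg A\<^sub>2 in
     between P l\<^sub>1 (bd1 P Neg \<phi>\<^sub>1) r\<^sub>1 \<and> between P l\<^sub>2 (bd1 P Neg \<phi>\<^sub>2) r\<^sub>2 \<and>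
     bd1 P Pos (l\<^sub>1 \<rhd> \<phi>\<^sub>1 \<lhd> r\<^sub>1) = bd1 P Neg \<chi> \<and> bd1 P Pos \<chi> = bd1 P Neg (l\<^sub>2 \<rhd> \<phi>\<^sub>2 \<lhd> r\<^sub>2) \<and>
     S\<^sub>1 = (l\<^sub>1 \<rhd>\<^sub>0 gen3 P A\<^sub>1 \<lhd>\<^sub>0 r\<^sub>1) \<lhd>\<^sub>1 (\<chi> \<odot> (l\<^sub>2 \<rhd> \<phi>\<^sub>2 \<lhd> r\<^sub>2)) \<and>
     S\<^sub>2 = ((l\<^sub>1 \<rhd> \<phi>\<^sub>1 \<lhd> r\<^sub>1) \<odot> \<chi>) \<rhd>\<^sub>1 (l\<^sub>2 \<rhd>\<^sub>0 gen3 P A\<^sub>2 \<lhd>\<^sub>0 r\<^sub>2))"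

text \<open>
  The elementary swap of the last whisker of \<open>\<phi>\<close> with the first whisker of \<open>\<psi>\<close> exists only if
  both 2-cells have positive length.
\<close>

definition natural_branching :: "('a0, 'a1, 'a2, 'a3, 'a4, 'z) gray_scheme
    \<Rightarrow> ('a0, 'a1, 'a2, 'a3) cell3 \<Rightarrow> ('a0, 'a1, 'a2, 'a3) cell3 \<Rightarrow> bool" where
  "natural_branching Q S\<^sub>1 S\<^sub>2 \<longleftrightarrow>
     (\<exists>A\<in>gens3 Q. \<exists>g. \<exists>\<psi>\<in>cells2 Q.
       let \<phi> = d2 Q Neg A; f = bd1 Q Neg \<phi>; f' = bd1 Q Pos \<phi>; h = bd1 Q Neg \<psi> in
       between Q f g h \<and> edges \<phi> \<noteq> [] \<and> edges \<psi> \<noteq> [] \<and>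
       S\<^sub>1 = (gen3 Q A \<lhd>\<^sub>0 (g \<odot> h)) \<lhd>\<^sub>1 ((f' \<odot> g) \<rhd> \<psi>) \<and>
       S\<^sub>2 = swap Q \<phi> (g \<rhd> \<psi>) (length (edges \<phi>) - 1) 0) \<or>
     (\<exists>\<phi>\<in>cells2 Q. \<exists>g. \<exists>B\<in>gens3 Q.
       let \<psi> = d2 Q Neg B; f = bd1 Q Neg \<phi>; f' = bd1 Q Pos \<phi>; h = bd1 Q Neg \<psi> in
       between Q f g h \<and> edges \<phi> \<noteq> [] \<and> edges \<psi> \<noteq> [] \<and>
       S\<^sub>1 = (\<phi> \<lhd> (g \<odot> h)) \<rhd>\<^sub>1 ((f' \<odot> g) \<rhd>\<^sub>0 gen3 Q B) \<and>
       S\<^sub>2 = swap Q (\<phi> \<lhd> g) \<psi> (length (edges \<phi>) - 1) 0)"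

definition critical_branching :: "('a0, 'a1, 'a2, 'a3, 'a4, 'z) gray_scheme
    \<Rightarrow> ('a0, 'a1, 'a2, 'a3) cell3 \<Rightarrow> ('a0, 'a1, 'a2, 'a3) cell3 \<Rightarrow> bool" where
  "critical_branching Q S\<^sub>1 S\<^sub>2 \<longleftrightarrow> local_branching Q S\<^sub>1 S\<^sub>2 \<and> minimal_branching Q S\<^sub>1 S\<^sub>2 \<and>
     S\<^sub>1 \<noteq> S\<^sub>2 \<and>
     \<not> independent_branching Q S\<^sub>1 S\<^sub>2 \<and> \<not> independent_branching Q S\<^sub>2 S\<^sub>1 \<and>
     \<not> natural_branching Q S\<^sub>1 S\<^sub>2 \<and> \<not> natural_branching Q S\<^sub>2 S\<^sub>1"


section \<open>Freeness of the free precategory\<close>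

lemma endpoint_append [simp]: "endpoint t x (xs @ ys) = endpoint t (endpoint t x xs) ys"
  by (induction xs arbitrary: x) auto

lemma chain_append [simp]: "chain d x (xs @ ys) \<longleftrightarrow> chain d x xs \<and> chain d (endpoint (d Pos) x xs) ys"
  by (induction xs arbitrary: x) auto

lemma pcomp_assoc: "(p \<odot> q) \<odot> r = p \<odot> q \<odot> r"
  by (simp add: pcomp_def)

lemma pcomp_id_right [simp]: "p \<odot> id_path x = p"
  by (simp add: pcomp_def)

lemma pcomp_id_left: "x = psrc p \<Longrightarrow> id_path x \<odot> p = p"
  by (simp add: pcomp_def)

lemma psrc_pcomp [simp]: "psrc (p \<odot> q) = psrc p" by (simp add: pcomp_def)
lemma edges_pcomp [simp]: "edges (p \<odot> q) = edges p @ edges q" by (simp add: pcomp_def)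

lemma tgt_pcomp: "path_bd d Pos p = psrc q \<Longrightarrow> path_bd d Pos (p \<odot> q) = path_bd d Pos q"
  by simp

lemma pcomp_paths: "\<lbrakk>p \<in> paths V E d; q \<in> paths V E d; path_bd d Pos p = psrc q\<rbrakk> \<Longrightarrow> p \<odot> q \<in> paths V E d"
  by (auto simp: paths_def)

lemma id_paths: "x \<in> V \<Longrightarrow> id_path x \<in> paths V E d"
  by (simp add: paths_def)

lemma endpoint_in: "\<lbrakk>\<And>e w. w \<in> E \<Longrightarrow> t w \<in> V; x \<in> V; set ws \<subseteq> E\<rbrakk> \<Longrightarrow> endpoint t x ws \<in> V"
  by (induction ws arbitrary: x) auto

lemma bd_paths: "\<lbrakk>\<And>e w. w \<in> E \<Longrightarrow> d e w \<in> V; p \<in> paths V E d\<rbrakk> \<Longrightarrow> path_bd d e p \<in> V"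
  by (cases e) (auto simp: paths_def intro!: endpoint_in[where E=E])

definition pmap where "pmap v w p = Path (v (psrc p)) (map w (edges p))"

lemma lwhisk2_pmap: "f \<rhd> \<phi> = pmap ((\<odot>) f) (lwhisk f) \<phi>" by (simp add: lwhisk2_def pmap_def)
lemma rwhisk2_pmap: "\<phi> \<lhd> f = pmap (\<lambda>g. g \<odot> f) (\<lambda>w. rwhisk w f) \<phi>" by (simp add: rwhisk2_def pmap_def)
lemma lwhisk30_pmap: "f \<rhd>\<^sub>0 \<phi> = pmap ((\<rhd>) f) (lstep0 f) \<phi>" by (simp add: lwhisk30_def pmap_def)
lemma rwhisk30_pmap: "\<phi> \<lhd>\<^sub>0 f = pmap (\<lambda>g. g \<lhd> f) (\<lambda>w. rstep0 w f) \<phi>" by (simp add: rwhisk30_def pmap_def)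
lemma lwhisk31_pmap: "f \<rhd>\<^sub>1 \<phi> = pmap ((\<odot>) f) (lstep1 f) \<phi>" by (simp add: lwhisk31_def pmap_def)
lemma rwhisk31_pmap: "\<phi> \<lhd>\<^sub>1 f = pmap (\<lambda>g. g \<odot> f) (\<lambda>w. rstep1 w f) \<phi>" by (simp add: rwhisk31_def pmap_def)

lemma pmap_paths:
  assumes "p \<in> paths V E d" "K (psrc p)"
    and "\<And>x. x \<in> E \<Longrightarrow> K (d Neg x) \<Longrightarrow> w x \<in> E' \<and> (\<forall>e. d' e (w x) = v (d e x)) \<and> K (d Pos x)"
    and "v (psrc p) \<in> V'"
  shows "pmap v w p \<in> paths V' E' d'" "path_bd d' e (pmap v w p) = v (path_bd d e p)"
proof -
  have *: "\<lbrakk>K x; set ws \<subseteq> E; chain d x ws\<rbrakk> \<Longrightarrow>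
     chain d' (v x) (map w ws) \<and> set (map w ws) \<subseteq> E' \<and> endpoint (d' Pos) (v x) (map w ws) = v (endpoint (d Pos) x ws)
     " for x ws
  proof (induction ws arbitrary: x)
    case (Cons a ws)
    then have a: "w a \<in> E'" "\<forall>e. d' e (w a) = v (d e a)" "K (d Pos a)" using assms(3)[of a] by auto
    with Cons.IH[of "d Pos a"] Cons.prems show ?case by auto
  qed simp
  from *[of "psrc p" "edges p"] assms(1,2,4)
  show "pmap v w p \<in> paths V' E' d'" "path_bd d' e (pmap v w p) = v (path_bd d e p)"
    by (auto simp: paths_def pmap_def; cases e; simp)+
qed

lemma pmap_comp: "pmap v w (pmap v' w' p) = pmap (v \<circ> v') (w \<circ> w') p"
  by (simp add: pmap_def)

lemma pmap_pcomp: "pmap v w (p \<odot> q) = pmap v w p \<odot> pmap v w q"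
  by (simp add: pmap_def pcomp_def)

lemma pmap_cong: "\<lbrakk>v (psrc p) = v' (psrc p); \<And>x. x \<in> set (edges p) \<Longrightarrow> w x = w' x\<rbrakk> \<Longrightarrow> pmap v w p = pmap v' w' p"
  by (simp add: pmap_def)

lemma pmap_id: "\<lbrakk>v (psrc p) = psrc p; \<And>x. x \<in> set (edges p) \<Longrightarrow> w x = x\<rbrakk> \<Longrightarrow> pmap v w p = p"
  by (cases p) (simp add: pmap_def map_idI)

lemma psrc_pmap [simp]: "psrc (pmap v w p) = v (psrc p)" by (simp add: pmap_def)

lemmas whisker_pmap = lwhisk2_pmap rwhisk2_pmap lwhisk30_pmap rwhisk30_pmap lwhisk31_pmap rwhisk31_pmap

lemma lwhisk_comp: "lwhisk f (lwhisk g w) = lwhisk (f \<odot> g) w" by (cases w) (simp add: pcomp_assoc)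
lemma rwhisk_comp: "rwhisk (rwhisk w f) g = rwhisk w (f \<odot> g)" by (cases w) (simp add: pcomp_assoc)
lemma lrwhisk: "rwhisk (lwhisk f w) g = lwhisk f (rwhisk w g)" by (cases w) (simp)

lemma l2_comp: "f \<rhd> g \<rhd> \<phi> = (f \<odot> g) \<rhd> \<phi>"
  by (auto simp: whisker_pmap pmap_comp pcomp_assoc lwhisk_comp intro!: pmap_cong)
lemma r2_comp: "(\<phi> \<lhd> f) \<lhd> g = \<phi> \<lhd> (f \<odot> g)"
  by (auto simp: whisker_pmap pmap_comp pcomp_assoc rwhisk_comp intro!: pmap_cong)
lemma lr2: "(f \<rhd> \<phi>) \<lhd> g = f \<rhd> (\<phi> \<lhd> g)"
  by (auto simp: whisker_pmap pmap_comp pcomp_assoc lrwhisk intro!: pmap_cong)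
lemma l2_pcomp: "f \<rhd> (\<phi> \<odot> \<psi>) = (f \<rhd> \<phi>) \<odot> (f \<rhd> \<psi>)" by (simp add: whisker_pmap pmap_pcomp)
lemma r2_pcomp: "(\<phi> \<odot> \<psi>) \<lhd> f = (\<phi> \<lhd> f) \<odot> (\<psi> \<lhd> f)" by (simp add: whisker_pmap pmap_pcomp)

lemma lstep0_comp: "lstep0 f (lstep0 g s) = lstep0 (f \<odot> g) s" by (cases s) (simp add: pcomp_assoc l2_comp)
lemma rstep0_comp: "rstep0 (rstep0 s f) g = rstep0 s (f \<odot> g)" by (cases s) (simp add: pcomp_assoc r2_comp)
lemma lrstep0: "rstep0 (lstep0 f s) g = lstep0 f (rstep0 s g)" by (cases s) (simp add: lr2)
lemma lstep1_comp: "lstep1 f (lstep1 g s) = lstep1 (f \<odot> g) s" by (cases s) (simp add: pcomp_assoc)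
lemma rstep1_comp: "rstep1 (rstep1 s f) g = rstep1 s (f \<odot> g)" by (cases s) (simp add: pcomp_assoc)
lemma lrstep1: "rstep1 (lstep1 f s) g = lstep1 f (rstep1 s g)" by (cases s) simp
lemma l0l1: "lstep0 f (lstep1 \<chi> s) = lstep1 (f \<rhd> \<chi>) (lstep0 f s)" by (cases s) (simp add: l2_pcomp)
lemma l0r1: "lstep0 f (rstep1 s \<chi>) = rstep1 (lstep0 f s) (f \<rhd> \<chi>)" by (cases s) (simp add: l2_pcomp)
lemma r0l1: "rstep0 (lstep1 \<chi> s) f = lstep1 (\<chi> \<lhd> f) (rstep0 s f)" by (cases s) (simp add: r2_pcomp)
lemma r0r1: "rstep0 (rstep1 s \<chi>) f = rstep1 (rstep0 s f) (\<chi> \<lhd> f)" by (cases s) (simp add: r2_pcomp)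

lemma l30_comp: "f \<rhd>\<^sub>0 g \<rhd>\<^sub>0 F = (f \<odot> g) \<rhd>\<^sub>0 F"
  unfolding whisker_pmap(3-6) by (auto simp: pmap_comp l2_comp lstep0_comp intro!: pmap_cong)
lemma r30_comp: "(F \<lhd>\<^sub>0 f) \<lhd>\<^sub>0 g = F \<lhd>\<^sub>0 (f \<odot> g)"
  unfolding whisker_pmap(3-6) by (auto simp: pmap_comp r2_comp rstep0_comp intro!: pmap_cong)
lemma lr30: "(f \<rhd>\<^sub>0 F) \<lhd>\<^sub>0 g = f \<rhd>\<^sub>0 (F \<lhd>\<^sub>0 g)"
  unfolding whisker_pmap(3-6) by (auto simp: pmap_comp lr2 lrstep0 intro!: pmap_cong)
lemma l31_comp: "f \<rhd>\<^sub>1 g \<rhd>\<^sub>1 F = (f \<odot> g) \<rhd>\<^sub>1 F"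
  unfolding whisker_pmap(3-6) by (auto simp: pmap_comp pcomp_assoc lstep1_comp intro!: pmap_cong)
lemma r31_comp: "(F \<lhd>\<^sub>1 f) \<lhd>\<^sub>1 g = F \<lhd>\<^sub>1 (f \<odot> g)"
  unfolding whisker_pmap(3-6) by (auto simp: pmap_comp pcomp_assoc rstep1_comp intro!: pmap_cong)
lemma lr31: "(f \<rhd>\<^sub>1 F) \<lhd>\<^sub>1 g = f \<rhd>\<^sub>1 (F \<lhd>\<^sub>1 g)"
  unfolding whisker_pmap(3-6) by (auto simp: pmap_comp pcomp_assoc lrstep1 intro!: pmap_cong)
lemma l30l31: "f \<rhd>\<^sub>0 (\<chi> \<rhd>\<^sub>1 F) = (f \<rhd> \<chi>) \<rhd>\<^sub>1 (f \<rhd>\<^sub>0 F)"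
  unfolding whisker_pmap(3-6) by (auto simp: pmap_comp l2_pcomp l0l1 intro!: pmap_cong)
lemma l30r31: "f \<rhd>\<^sub>0 (F \<lhd>\<^sub>1 \<chi>) = (f \<rhd>\<^sub>0 F) \<lhd>\<^sub>1 (f \<rhd> \<chi>)"
  unfolding whisker_pmap(3-6) by (auto simp: pmap_comp l2_pcomp l0r1 intro!: pmap_cong)
lemma r30l31: "(\<chi> \<rhd>\<^sub>1 F) \<lhd>\<^sub>0 f = (\<chi> \<lhd> f) \<rhd>\<^sub>1 (F \<lhd>\<^sub>0 f)"
  unfolding whisker_pmap(3-6) by (auto simp: pmap_comp r2_pcomp r0l1 intro!: pmap_cong)
lemma r30r31: "(F \<lhd>\<^sub>1 \<chi>) \<lhd>\<^sub>0 f = (F \<lhd>\<^sub>0 f) \<lhd>\<^sub>1 (\<chi> \<lhd> f)"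
  unfolding whisker_pmap(3-6) by (auto simp: pmap_comp r2_pcomp r0r1 intro!: pmap_cong)
lemma w3_pcomp:
  "f \<rhd>\<^sub>0 (F \<odot> G) = (f \<rhd>\<^sub>0 F) \<odot> (f \<rhd>\<^sub>0 G)" "(F \<odot> G) \<lhd>\<^sub>0 f = (F \<lhd>\<^sub>0 f) \<odot> (G \<lhd>\<^sub>0 f)"
  "\<chi> \<rhd>\<^sub>1 (F \<odot> G) = (\<chi> \<rhd>\<^sub>1 F) \<odot> (\<chi> \<rhd>\<^sub>1 G)" "(F \<odot> G) \<lhd>\<^sub>1 \<chi> = (F \<lhd>\<^sub>1 \<chi>) \<odot> (G \<lhd>\<^sub>1 \<chi>)"
  by (simp_all add: whisker_pmap(3-6) pmap_pcomp)

lemma whisker_id_path [simp]: "f \<rhd> id_path g = id_path (f \<odot> g)" "id_path g \<lhd> f = id_path (g \<odot> f)"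
  "f \<rhd>\<^sub>0 id_path \<phi> = id_path (f \<rhd> \<phi>)" "id_path \<phi> \<lhd>\<^sub>0 f = id_path (\<phi> \<lhd> f)"
  "\<chi> \<rhd>\<^sub>1 id_path \<phi> = id_path (\<chi> \<odot> \<phi>)" "id_path \<phi> \<lhd>\<^sub>1 \<chi> = id_path (\<phi> \<odot> \<chi>)"
  by (simp_all add: whisker_pmap pmap_def)

lemma psrc_whisker [simp]: "psrc (f \<rhd> \<phi>) = f \<odot> psrc \<phi>" "psrc (\<phi> \<lhd> f) = psrc \<phi> \<odot> f"
  "psrc (f \<rhd>\<^sub>0 F) = f \<rhd> psrc F" "psrc (F \<lhd>\<^sub>0 f) = psrc F \<lhd> f"
  "psrc (\<chi> \<rhd>\<^sub>1 F) = \<chi> \<odot> psrc F" "psrc (F \<lhd>\<^sub>1 \<chi>) = psrc F \<odot> \<chi>"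
  by (simp_all add: whisker_pmap)

lemma path_bd_def': "path_bd d e p = (case e of Neg \<Rightarrow> psrc p | Pos \<Rightarrow> endpoint (d Pos) (psrc p) (edges p))"
  by (cases e) auto

lemma src_pcomp [simp]: "path_bd d Neg (p \<odot> q) = path_bd d Neg p" by simp

lemma pcomp_bd: "path_bd d Pos p = path_bd d Neg q \<Longrightarrow> path_bd d Pos (p \<odot> q) = path_bd d Pos q"
  by simp

declare path_bd.simps [simp del]
lemma path_bd_id [simp]: "path_bd d e (id_path x) = x" by (cases e) (auto simp: path_bd.simps)
lemma psrc_bd: "psrc p = path_bd d Neg p" by (simp add: path_bd.simps)

lemma forall_sign: "(\<forall>e. P e) \<longleftrightarrow> P Neg \<and> P Pos"
  by (metis sign.exhaust)

lemma pathsE_glob: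
  assumes "p \<in> paths V E d" and "\<And>w. w \<in> E \<Longrightarrow> F (d Neg w) = F (d Pos w)"
  shows "F (path_bd d Neg p) = F (path_bd d Pos p)"
proof -
  have "\<lbrakk>set ws \<subseteq> E; chain d x ws\<rbrakk> \<Longrightarrow> F x = F (endpoint (d Pos) x ws)" for x ws
    by (induction ws arbitrary: x) (use assms(2) in auto)
  then show ?thesis using assms(1) by (auto simp: paths_def path_bd.simps)
qed

lemma paths_Neg: "p \<in> paths V E d \<Longrightarrow> path_bd d Neg p \<in> V" by (simp add: paths_def path_bd.simps)

context
  fixes P :: "('a0, 'a1, 'a2, 'a3, 'z) prepolygraph3_scheme"
  assumes P: "prepolygraph3 P"
begin

lemma cells1_pcomp: "\<lbrakk>f \<in> cells1 P; g \<in> cells1 P; bd0 P Pos f = bd0 P Neg g\<rbrakk> \<Longrightarrow> f \<odot> g \<in> cells1 P"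
  unfolding cells1_def by (rule pcomp_paths) (auto simp: psrc_bd[of g "d0 P"])

lemma bd0_pcomp: "bd0 P Pos f = bd0 P Neg g \<Longrightarrow> bd0 P e (f \<odot> g) = (case e of Neg \<Rightarrow> bd0 P Neg f | Pos \<Rightarrow> bd0 P Pos g)"
  by (cases e) (auto simp: path_bd.simps)
lemma bd1_pcomp: "bd1 P Pos f = bd1 P Neg g \<Longrightarrow> bd1 P e (f \<odot> g) = (case e of Neg \<Rightarrow> bd1 P Neg f | Pos \<Rightarrow> bd1 P Pos g)"
  by (cases e) (auto simp: path_bd.simps)
lemma bd2_pcomp: "bd2 P Pos f = bd2 P Neg g \<Longrightarrow> bd2 P e (f \<odot> g) = (case e of Neg \<Rightarrow> bd2 P Neg f | Pos \<Rightarrow> bd2 P Pos g)"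
  by (cases e) (auto simp: path_bd.simps)

lemma bd0_in: "f \<in> cells1 P \<Longrightarrow> bd0 P e f \<in> gens0 P"
  unfolding cells1_def by (erule bd_paths[rotated]) (use P in \<open>auto simp: prepolygraph3_def\<close>)

lemma gen2_bd: "a \<in> gens2 P \<Longrightarrow> d1 P e a \<in> cells1 P" "a \<in> gens2 P \<Longrightarrow> bd0 P e' (d1 P e a) = bd0 P e' (d1 P Neg a)"
  using P by (cases e; simp add: prepolygraph3_def)+

lemma gen3_bd: "A \<in> gens3 P \<Longrightarrow> d2 P e A \<in> cells2 P" "A \<in> gens3 P \<Longrightarrow> bd1 P e' (d2 P e A) = bd1 P e' (d2 P Neg A)"
  using P by (cases e; simp add: prepolygraph3_def)+

lemma between_comp: "between P l f r \<Longrightarrow> l \<odot> f \<odot> r \<in> cells1 P \<and> bd0 P Neg (l \<odot> f \<odot> r) = bd0 P Neg l \<and> bd0 P Pos (l \<odot> f \<odot> r) = bd0 P Pos r"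
  by (auto simp: between_def bd0_pcomp intro!: cells1_pcomp)

lemma between_gen2: "\<lbrakk>a \<in> gens2 P; between P l (d1 P Neg a) r\<rbrakk> \<Longrightarrow> between P l (d1 P e a) r"
  unfolding between_def by (simp add: gen2_bd(1) gen2_bd(2)[of _ _ e])

lemma whisker_bd_in: "w \<in> whiskers P \<Longrightarrow> whisker_bd P e w \<in> cells1 P"
  unfolding whiskers_def using between_gen2[where e=e] between_comp by fastforce

lemma whisker_glob: "w \<in> whiskers P \<Longrightarrow> bd0 P e (whisker_bd P Neg w) = bd0 P e (whisker_bd P Pos w)"
  unfolding whiskers_def apply (auto) 
  subgoal for l a r using between_gen2[of a l r Neg] between_gen2[of a l r Pos] between_comp
    by (cases e) metis+
  done

lemma bd1_in: "\<phi> \<in> cells2 P \<Longrightarrow> bd1 P e \<phi> \<in> cells1 P"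
  unfolding cells2_def by (erule bd_paths[rotated]) (auto intro: whisker_bd_in)

lemma glob2: "\<phi> \<in> cells2 P \<Longrightarrow> bd0 P e (bd1 P Pos \<phi>) = bd0 P e (bd1 P Neg \<phi>)"
  unfolding cells2_def by (erule pathsE_glob[symmetric, where F = "bd0 P e"]) (rule whisker_glob)

lemma cells2_pcomp: "\<lbrakk>f \<in> cells2 P; g \<in> cells2 P; bd1 P Pos f = bd1 P Neg g\<rbrakk> \<Longrightarrow> f \<odot> g \<in> cells2 P"
  unfolding cells2_def by (rule pcomp_paths) (auto simp: psrc_bd[of g "whisker_bd P"])

lemma lwhisker: "\<lbrakk>w \<in> whiskers P; f \<in> cells1 P; bd0 P Pos f = bd0 P Neg (whisker_bd P Neg w)\<rbrakk>
  \<Longrightarrow> lwhisk f w \<in> whiskers P \<and> whisker_bd P e (lwhisk f w) = f \<odot> whisker_bd P e w"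
  unfolding whiskers_def by (auto simp: pcomp_assoc between_def bd0_pcomp cells1_pcomp)

lemma rwhisker: "\<lbrakk>w \<in> whiskers P; f \<in> cells1 P; bd0 P Pos (whisker_bd P Neg w) = bd0 P Neg f\<rbrakk>
  \<Longrightarrow> rwhisk w f \<in> whiskers P \<and> whisker_bd P e (rwhisk w f) = whisker_bd P e w \<odot> f"
  unfolding whiskers_def by (auto simp: pcomp_assoc between_def bd0_pcomp cells1_pcomp)

lemma lwhisk2_in:
  assumes "f \<in> cells1 P" "\<phi> \<in> cells2 P" "bd0 P Pos f = bd0 P Neg (bd1 P Neg \<phi>)"
  shows "f \<rhd> \<phi> \<in> cells2 P" "bd1 P e (f \<rhd> \<phi>) = f \<odot> bd1 P e \<phi>"
proof -
  have s: "psrc \<phi> = bd1 P Neg \<phi>" by (rule psrc_bd)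
  have 1: "\<phi> \<in> paths (cells1 P) (whiskers P) (whisker_bd P)" using assms(2) by (simp add: cells2_def)
  have 2: "(\<lambda>g. bd0 P Pos f = bd0 P Neg g) (psrc \<phi>)" using assms(3) s by simp
  have 3: "(lwhisk f) x \<in> whiskers P \<and> (\<forall>e. whisker_bd P e ((lwhisk f) x) = ((\<odot>) f) (whisker_bd P e x)) \<and> (\<lambda>g. bd0 P Pos f = bd0 P Neg g) (whisker_bd P Pos x)"
    if "x \<in> whiskers P" "(\<lambda>g. bd0 P Pos f = bd0 P Neg g) (whisker_bd P Neg x)" for x
    using lwhisker[OF that(1) assms(1)] that whisker_glob[OF that(1)] by metis
  have 4: "((\<odot>) f) (psrc \<phi>) \<in> cells1 P" using assms(3) s bd1_in[OF assms(2)] assms(1) by (simp add: cells1_pcomp)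
  note * = pmap_paths[where K="\<lambda>g. bd0 P Pos f = bd0 P Neg g" and w="lwhisk f" and v="(\<odot>) f", OF 1 2 3 4]
  show "f \<rhd> \<phi> \<in> cells2 P" unfolding lwhisk2_pmap by (subst cells2_def) (rule *(1))
  show "bd1 P e (f \<rhd> \<phi>) = f \<odot> bd1 P e \<phi>" unfolding lwhisk2_pmap by (rule *(2))
qed

lemma rwhisk2_in:
  assumes "f \<in> cells1 P" "\<phi> \<in> cells2 P" "bd0 P Pos (bd1 P Neg \<phi>) = bd0 P Neg f"
  shows "\<phi> \<lhd> f \<in> cells2 P" "bd1 P e (\<phi> \<lhd> f) = bd1 P e \<phi> \<odot> f"
proof -
  have s: "psrc \<phi> = bd1 P Neg \<phi>" by (rule psrc_bd)
  have 1: "\<phi> \<in> paths (cells1 P) (whiskers P) (whisker_bd P)" using assms(2) by (simp add: cells2_def)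
  have 2: "(\<lambda>g. bd0 P Pos g = bd0 P Neg f) (psrc \<phi>)" using assms(3) s by simp
  have 3: "(\<lambda>w. rwhisk w f) x \<in> whiskers P \<and> (\<forall>e. whisker_bd P e ((\<lambda>w. rwhisk w f) x) = (\<lambda>g. g \<odot> f) (whisker_bd P e x)) \<and> (\<lambda>g. bd0 P Pos g = bd0 P Neg f) (whisker_bd P Pos x)"
    if "x \<in> whiskers P" "(\<lambda>g. bd0 P Pos g = bd0 P Neg f) (whisker_bd P Neg x)" for x
    using rwhisker[OF that(1) assms(1)] that whisker_glob[OF that(1)] by metis
  have 4: "(\<lambda>g. g \<odot> f) (psrc \<phi>) \<in> cells1 P" using assms(3) s bd1_in[OF assms(2)] assms(1) by (simp add: cells1_pcomp)
  note * = pmap_paths[where K="\<lambda>g. bd0 P Pos g = bd0 P Neg f" and w="\<lambda>w. rwhisk w f" and v="\<lambda>g. g \<odot> f", OF 1 2 3 4]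
  show "\<phi> \<lhd> f \<in> cells2 P" unfolding rwhisk2_pmap by (subst cells2_def) (rule *(1))
  show "bd1 P e (\<phi> \<lhd> f) = bd1 P e \<phi> \<odot> f" unfolding rwhisk2_pmap by (rule *(2))
qed

lemma whisk2_in:
  assumes "between P l (bd1 P Neg \<phi>) r" "\<phi> \<in> cells2 P"
  shows "l \<rhd> \<phi> \<lhd> r \<in> cells2 P" "bd1 P e (l \<rhd> \<phi> \<lhd> r) = l \<odot> bd1 P e \<phi> \<odot> r"
    "bd0 P Neg (bd1 P e (l \<rhd> \<phi> \<lhd> r)) = bd0 P Neg l"  "bd0 P Pos (bd1 P e (l \<rhd> \<phi> \<lhd> r)) = bd0 P Pos r"
proof -
  have a: "l \<rhd> \<phi> \<in> cells2 P" "\<And>e. bd1 P e (l \<rhd> \<phi>) = l \<odot> bd1 P e \<phi>" "l \<in> cells1 P" "r \<in> cells1 P" "bd0 P Pos l = bd0 P Neg (bd1 P Neg \<phi>)"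
    "bd0 P Pos (bd1 P Neg \<phi>) = bd0 P Neg r"
    using assms lwhisk2_in[of l \<phi>] by (auto simp: between_def)
  have b: "bd0 P Pos (bd1 P Neg (l \<rhd> \<phi>)) = bd0 P Neg r"
    using a by (simp add: bd0_pcomp)
  show "l \<rhd> \<phi> \<lhd> r \<in> cells2 P" and c: "bd1 P e (l \<rhd> \<phi> \<lhd> r) = l \<odot> bd1 P e \<phi> \<odot> r"
    using rwhisk2_in[OF a(4) a(1) b] a by (auto simp: pcomp_assoc)
  have "bd0 P Pos l = bd0 P Neg (bd1 P e \<phi>)" "bd0 P Pos (bd1 P e \<phi>) = bd0 P Neg r"
    using a glob2[OF assms(2)] by (metis sign.exhaust)+
  then show "bd0 P Neg (bd1 P e (l \<rhd> \<phi> \<lhd> r)) = bd0 P Neg l"  "bd0 P Pos (bd1 P e (l \<rhd> \<phi> \<lhd> r)) = bd0 P Pos r"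
    unfolding c by (simp_all add: bd0_pcomp)
qed

lemma between_gen3: "\<lbrakk>A \<in> gens3 P; sandwich P k l (d2 P Neg A) r m\<rbrakk> \<Longrightarrow> sandwich P k l (d2 P e A) r m"
  unfolding sandwich_def using whisk2_in[of l "d2 P Neg A" r] whisk2_in[of l "d2 P e A" r]
  by (auto simp: gen3_bd(1) gen3_bd(2)[of _ _ e] )

lemma sandwich_in:
  assumes "sandwich P k l \<phi> r m"
  shows "k \<odot> (l \<rhd> \<phi> \<lhd> r) \<odot> m \<in> cells2 P" 
    "bd1 P Neg (k \<odot> (l \<rhd> \<phi> \<lhd> r) \<odot> m) = bd1 P Neg k"
    "bd1 P Pos (k \<odot> (l \<rhd> \<phi> \<lhd> r) \<odot> m) = bd1 P Pos m"
  using assms whisk2_in[of l \<phi> r] by (auto simp: sandwich_def bd1_pcomp intro!: cells2_pcomp)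

lemma step_bd_in: "w \<in> steps P \<Longrightarrow> step_bd P e w \<in> cells2 P"
  unfolding steps_def using between_gen3[where e=e] sandwich_in(1) by fastforce

lemma step_glob: "w \<in> steps P \<Longrightarrow> bd1 P e (step_bd P Neg w) = bd1 P e (step_bd P Pos w)"
  unfolding steps_def apply (auto) 
  subgoal for l k a r m using between_gen3[of a l k r m Neg] between_gen3[of a l k r m Pos] sandwich_in
    by (cases e) metis+
  done

lemma bd2_in: "\<phi> \<in> cells3 P \<Longrightarrow> bd2 P e \<phi> \<in> cells2 P"
  unfolding cells3_def by (erule bd_paths[rotated]) (auto intro: step_bd_in)

lemma glob3: "\<phi> \<in> cells3 P \<Longrightarrow> bd1 P e (bd2 P Pos \<phi>) = bd1 P e (bd2 P Neg \<phi>)"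
  unfolding cells3_def by (erule pathsE_glob[symmetric, where F = "bd1 P e"]) (rule step_glob)

lemma cells3_pcomp: "\<lbrakk>f \<in> cells3 P; g \<in> cells3 P; bd2 P Pos f = bd2 P Neg g\<rbrakk> \<Longrightarrow> f \<odot> g \<in> cells3 P"
  unfolding cells3_def by (rule pcomp_paths) (auto simp: psrc_bd[of g "step_bd P"])

lemma gen1_in: "a \<in> gens1 P \<Longrightarrow> gen1 P a \<in> cells1 P \<and> bd0 P e (gen1 P a) = d0 P e a"
  using P by (cases e) (auto simp: gen1_def cells1_def paths_def path_bd.simps prepolygraph3_def)

lemma gen2_in: "a \<in> gens2 P \<Longrightarrow> gen2 P a \<in> cells2 P \<and> bd1 P e (gen2 P a) = d1 P e a"
proof -
  assume a: "a \<in> gens2 P"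
  have b: "between P (id_path (bd0 P Neg (d1 P Neg a))) (d1 P Neg a) (id_path (bd0 P Pos (d1 P Neg a)))"
    using gen2_bd[OF a] bd0_in by (auto simp: between_def cells1_def id_paths)
  have c: "bd0 P Neg (d1 P Neg a) = psrc (d1 P e a)" for e
    using gen2_bd(2)[OF a, of Neg e] by (simp add: path_bd.simps)
  show ?thesis
  proof (intro conjI)
    show "gen2 P a \<in> cells2 P" using gen2_bd(1)[OF a] b a
      by (auto simp: gen2_def cells2_def paths_def whiskers_def pcomp_id_left path_bd.simps)
    show "bd1 P e (gen2 P a) = d1 P e a"
      by (cases e) (simp_all add: gen2_def pcomp_id_left c[of Pos] c[of Neg, symmetric] path_bd.simps(2) psrc_bd[of _ "d0 P"] path_bd.simps(1)[of "whisker_bd P"])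
  qed
qed

lemma lstep0_in: "\<lbrakk>s \<in> steps P; f \<in> cells1 P; bd0 P Pos f = bd0 P Neg (bd1 P Neg (step_bd P Neg s))\<rbrakk>
  \<Longrightarrow> lstep0 f s \<in> steps P \<and> step_bd P e (lstep0 f s) = f \<rhd> step_bd P e s"
proof -
  assume a: "s \<in> steps P" "f \<in> cells1 P" "bd0 P Pos f = bd0 P Neg (bd1 P Neg (step_bd P Neg s))"
  then obtain k l A r m where s: "s = Step k l A r m" "A \<in> gens3 P" "sandwich P k l (d2 P Neg A) r m"
    by (auto simp: steps_def)
  note sa = s(3)[unfolded sandwich_def]
  have w: "l \<rhd> d2 P Neg A \<lhd> r \<in> cells2 P" "\<And>e. bd1 P e (l \<rhd> d2 P Neg A \<lhd> r) = l \<odot> bd1 P e (d2 P Neg A) \<odot> r"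
    using whisk2_in sa by blast+
  have b: "bd0 P Pos f = bd0 P Neg (bd1 P Neg k)" using a s sandwich_in(2)[OF s(3)] by simp
  then have b2: "bd0 P Pos f = bd0 P Neg (bd1 P Pos k)" using glob2 sa by metis
  then have b3: "bd0 P Pos f = bd0 P Neg l" using sa w whisk2_in(3)[of l "d2 P Neg A" r] by metis
  have b4: "bd0 P Pos f = bd0 P Neg (bd1 P Neg m)" using sa w whisk2_in(3)[of l "d2 P Neg A" r] b3 by metis
  have be: "between P (f \<odot> l) (bd1 P Neg (d2 P Neg A)) r" using sa b3 a(2)
    by (simp add: between_def cells1_pcomp bd0_pcomp)
  have e: "(f \<odot> l) \<rhd> d2 P Neg A \<lhd> r = f \<rhd> (l \<rhd> d2 P Neg A \<lhd> r)" by (simp add: l2_comp lr2)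
  have "sandwich P (f \<rhd> k) (f \<odot> l) (d2 P Neg A) r (f \<rhd> m)"
    unfolding sandwich_def e using be lwhisk2_in[OF a(2) _ b] lwhisk2_in[OF a(2) _ b4]
       lwhisk2_in[OF a(2) w(1)] whisk2_in(3)[of l "d2 P Neg A" r] b3 sa by auto
  then show ?thesis using s(1,2) by (auto simp: steps_def l2_pcomp l2_comp lr2)
qed

lemma rstep0_in: "\<lbrakk>s \<in> steps P; f \<in> cells1 P; bd0 P Pos (bd1 P Neg (step_bd P Neg s)) = bd0 P Neg f\<rbrakk>
  \<Longrightarrow> rstep0 s f \<in> steps P \<and> step_bd P e (rstep0 s f) = step_bd P e s \<lhd> f"
proof -
  assume a: "s \<in> steps P" "f \<in> cells1 P" "bd0 P Pos (bd1 P Neg (step_bd P Neg s)) = bd0 P Neg f"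
  then obtain k l A r m where s: "s = Step k l A r m" "A \<in> gens3 P" "sandwich P k l (d2 P Neg A) r m"
    by (auto simp: steps_def)
  note sa = s(3)[unfolded sandwich_def]
  have w: "l \<rhd> d2 P Neg A \<lhd> r \<in> cells2 P" "\<And>e. bd1 P e (l \<rhd> d2 P Neg A \<lhd> r) = l \<odot> bd1 P e (d2 P Neg A) \<odot> r"
    using whisk2_in sa by blast+
  have b: "bd0 P Pos (bd1 P Neg k) = bd0 P Neg f" using a s sandwich_in(2)[OF s(3)] by simp
  then have b2: "bd0 P Pos (bd1 P Pos k) = bd0 P Neg f" using glob2 sa by metis
  then have b3: "bd0 P Pos r = bd0 P Neg f" using sa w whisk2_in(4)[of l "d2 P Neg A" r] by metis
  have b4: "bd0 P Pos (bd1 P Neg m) = bd0 P Neg f" using sa w whisk2_in(4)[of l "d2 P Neg A" r] b3 by metis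
  have be: "between P l (bd1 P Neg (d2 P Neg A)) (r \<odot> f)" using sa b3 a(2)
    by (simp add: between_def cells1_pcomp bd0_pcomp)
  have e: "l \<rhd> d2 P Neg A \<lhd> (r \<odot> f) = (l \<rhd> d2 P Neg A \<lhd> r) \<lhd> f" by (simp add: r2_comp)
  have "sandwich P (k \<lhd> f) l (d2 P Neg A) (r \<odot> f) (m \<lhd> f)"
    unfolding sandwich_def e using be rwhisk2_in[OF a(2) _ b] rwhisk2_in[OF a(2) _ b4]
       rwhisk2_in[OF a(2) w(1)] whisk2_in(4)[of l "d2 P Neg A" r] b3 sa by auto
  then show ?thesis using s(1,2) by (auto simp: steps_def r2_pcomp r2_comp)
qed

lemma lstep1_in: "\<lbrakk>s \<in> steps P; f \<in> cells2 P; bd1 P Pos f = bd1 P Neg (step_bd P Neg s)\<rbrakk>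
  \<Longrightarrow> lstep1 f s \<in> steps P \<and> step_bd P e (lstep1 f s) = f \<odot> step_bd P e s"
  unfolding steps_def by (auto simp: pcomp_assoc sandwich_def bd1_pcomp cells2_pcomp)

lemma rstep1_in: "\<lbrakk>s \<in> steps P; f \<in> cells2 P; bd1 P Pos (step_bd P Neg s) = bd1 P Neg f\<rbrakk>
  \<Longrightarrow> rstep1 s f \<in> steps P \<and> step_bd P e (rstep1 s f) = step_bd P e s \<odot> f"
  unfolding steps_def by (auto simp: pcomp_assoc sandwich_def bd1_pcomp cells2_pcomp)

lemma step_glob0: "w \<in> steps P \<Longrightarrow> bd0 P e (bd1 P Neg (step_bd P Neg w)) = bd0 P e (bd1 P Neg (step_bd P Pos w))"
  by (simp add: step_glob)

lemma lwhisk30_in: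
  assumes "f \<in> cells1 P" "\<phi> \<in> cells3 P" "bd0 P Pos f = bd0 P Neg (bd1 P Neg (bd2 P Neg \<phi>))"
  shows "f \<rhd>\<^sub>0 \<phi> \<in> cells3 P" "bd2 P e (f \<rhd>\<^sub>0 \<phi>) = f \<rhd> bd2 P e \<phi>"
proof -
  have s: "psrc \<phi> = bd2 P Neg \<phi>" by (rule psrc_bd)
  have 1: "\<phi> \<in> paths (cells2 P) (steps P) (step_bd P)" using assms(2) by (simp add: cells3_def)
  have 2: "(\<lambda>g. bd0 P Pos f = bd0 P Neg (bd1 P Neg g)) (psrc \<phi>)" using assms(3) s by simp
  have 3: "(lstep0 f) x \<in> steps P \<and> (\<forall>e. step_bd P e ((lstep0 f) x) = ((\<rhd>) f) (step_bd P e x)) \<and> (\<lambda>g. bd0 P Pos f = bd0 P Neg (bd1 P Neg g)) (step_bd P Pos x)"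
    if "x \<in> steps P" "(\<lambda>g. bd0 P Pos f = bd0 P Neg (bd1 P Neg g)) (step_bd P Neg x)" for x
    using lstep0_in[OF that(1) assms(1)] that step_glob0[OF that(1)] by metis
  have 4: "((\<rhd>) f) (psrc \<phi>) \<in> cells2 P" using assms(3) s bd2_in[OF assms(2)] assms(1) by (simp add: lwhisk2_in)
  note * = pmap_paths[where K="\<lambda>g. bd0 P Pos f = bd0 P Neg (bd1 P Neg g)" and w="lstep0 f" and v="(\<rhd>) f", OF 1 2 3 4]
  show "f \<rhd>\<^sub>0 \<phi> \<in> cells3 P" unfolding lwhisk30_pmap by (subst cells3_def) (rule *(1))
  show "bd2 P e (f \<rhd>\<^sub>0 \<phi>) = f \<rhd> bd2 P e \<phi>" unfolding lwhisk30_pmap by (rule *(2))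
qed

lemma rwhisk30_in:
  assumes "f \<in> cells1 P" "\<phi> \<in> cells3 P" "bd0 P Pos (bd1 P Neg (bd2 P Neg \<phi>)) = bd0 P Neg f"
  shows "\<phi> \<lhd>\<^sub>0 f \<in> cells3 P" "bd2 P e (\<phi> \<lhd>\<^sub>0 f) = bd2 P e \<phi> \<lhd> f"
proof -
  have s: "psrc \<phi> = bd2 P Neg \<phi>" by (rule psrc_bd)
  have 1: "\<phi> \<in> paths (cells2 P) (steps P) (step_bd P)" using assms(2) by (simp add: cells3_def)
  have 2: "(\<lambda>g. bd0 P Pos (bd1 P Neg g) = bd0 P Neg f) (psrc \<phi>)" using assms(3) s by simp
  have 3: "(\<lambda>w. rstep0 w f) x \<in> steps P \<and> (\<forall>e. step_bd P e ((\<lambda>w. rstep0 w f) x) = (\<lambda>g. g \<lhd> f) (step_bd P e x)) \<and> (\<lambda>g. bd0 P Pos (bd1 P Neg g) = bd0 P Neg f) (step_bd P Pos x)"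
    if "x \<in> steps P" "(\<lambda>g. bd0 P Pos (bd1 P Neg g) = bd0 P Neg f) (step_bd P Neg x)" for x
    using rstep0_in[OF that(1) assms(1)] that step_glob0[OF that(1)] by metis
  have 4: "(\<lambda>g. g \<lhd> f) (psrc \<phi>) \<in> cells2 P" using assms(3) s bd2_in[OF assms(2)] assms(1) by (simp add: rwhisk2_in)
  note * = pmap_paths[where K="\<lambda>g. bd0 P Pos (bd1 P Neg g) = bd0 P Neg f" and w="\<lambda>w. rstep0 w f" and v="\<lambda>g. g \<lhd> f", OF 1 2 3 4]
  show "\<phi> \<lhd>\<^sub>0 f \<in> cells3 P" unfolding rwhisk30_pmap by (subst cells3_def) (rule *(1))
  show "bd2 P e (\<phi> \<lhd>\<^sub>0 f) = bd2 P e \<phi> \<lhd> f" unfolding rwhisk30_pmap by (rule *(2))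
qed

lemma lwhisk31_in:
  assumes "f \<in> cells2 P" "\<phi> \<in> cells3 P" "bd1 P Pos f = (bd1 P Neg (bd2 P Neg \<phi>))"
  shows "f \<rhd>\<^sub>1 \<phi> \<in> cells3 P" "bd2 P e (f \<rhd>\<^sub>1 \<phi>) = f \<odot> bd2 P e \<phi>"
proof -
  have s: "psrc \<phi> = bd2 P Neg \<phi>" by (rule psrc_bd)
  have 1: "\<phi> \<in> paths (cells2 P) (steps P) (step_bd P)" using assms(2) by (simp add: cells3_def)
  have 2: "(\<lambda>g. bd1 P Pos f = (bd1 P Neg g)) (psrc \<phi>)" using assms(3) s by simp
  have 3: "(lstep1 f) x \<in> steps P \<and> (\<forall>e. step_bd P e ((lstep1 f) x) = ((\<odot>) f) (step_bd P e x)) \<and> (\<lambda>g. bd1 P Pos f = (bd1 P Neg g)) (step_bd P Pos x)"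
    if "x \<in> steps P" "(\<lambda>g. bd1 P Pos f = (bd1 P Neg g)) (step_bd P Neg x)" for x
    using lstep1_in[OF that(1) assms(1)] that step_glob[OF that(1)] by metis
  have 4: "((\<odot>) f) (psrc \<phi>) \<in> cells2 P" using assms(3) s bd2_in[OF assms(2)] assms(1) by (simp add: cells2_pcomp)
  note * = pmap_paths[where K="\<lambda>g. bd1 P Pos f = (bd1 P Neg g)" and w="lstep1 f" and v="(\<odot>) f", OF 1 2 3 4]
  show "f \<rhd>\<^sub>1 \<phi> \<in> cells3 P" unfolding lwhisk31_pmap by (subst cells3_def) (rule *(1))
  show "bd2 P e (f \<rhd>\<^sub>1 \<phi>) = f \<odot> bd2 P e \<phi>" unfolding lwhisk31_pmap by (rule *(2))
qed

lemma rwhisk31_in: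
  assumes "f \<in> cells2 P" "\<phi> \<in> cells3 P" "(bd1 P Pos (bd2 P Neg \<phi>)) = bd1 P Neg f"
  shows "\<phi> \<lhd>\<^sub>1 f \<in> cells3 P" "bd2 P e (\<phi> \<lhd>\<^sub>1 f) = bd2 P e \<phi> \<odot> f"
proof -
  have s: "psrc \<phi> = bd2 P Neg \<phi>" by (rule psrc_bd)
  have 1: "\<phi> \<in> paths (cells2 P) (steps P) (step_bd P)" using assms(2) by (simp add: cells3_def)
  have 2: "(\<lambda>g. (bd1 P Pos g) = bd1 P Neg f) (psrc \<phi>)" using assms(3) s by simp
  have 3: "(\<lambda>w. rstep1 w f) x \<in> steps P \<and> (\<forall>e. step_bd P e ((\<lambda>w. rstep1 w f) x) = (\<lambda>g. g \<odot> f) (step_bd P e x)) \<and> (\<lambda>g. (bd1 P Pos g) = bd1 P Neg f) (step_bd P Pos x)"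
    if "x \<in> steps P" "(\<lambda>g. (bd1 P Pos g) = bd1 P Neg f) (step_bd P Neg x)" for x
    using rstep1_in[OF that(1) assms(1)] that step_glob[OF that(1)] by metis
  have 4: "(\<lambda>g. g \<odot> f) (psrc \<phi>) \<in> cells2 P" using assms(3) s bd2_in[OF assms(2)] assms(1) by (simp add: cells2_pcomp)
  note * = pmap_paths[where K="\<lambda>g. (bd1 P Pos g) = bd1 P Neg f" and w="\<lambda>w. rstep1 w f" and v="\<lambda>g. g \<odot> f", OF 1 2 3 4]
  show "\<phi> \<lhd>\<^sub>1 f \<in> cells3 P" unfolding rwhisk31_pmap by (subst cells3_def) (rule *(1))
  show "bd2 P e (\<phi> \<lhd>\<^sub>1 f) = bd2 P e \<phi> \<odot> f" unfolding rwhisk31_pmap by (rule *(2))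
qed

end

context
  fixes P :: "('a0, 'a1, 'a2, 'a3, 'z) prepolygraph3_scheme"
  assumes P: "prepolygraph3 P"
begin

lemma free_precat_sel [simp]: "cells (free_precat P) = free_cells P" "bd (free_precat P) e i = free_bd P e" "idn (free_precat P) i = free_idn"
  "cmp (free_precat P) k l = free_cmp" by (auto simp: free_precat_def fun_eq_iff)

lemma le3_iff: "k \<le> 3 \<longleftrightarrow> k = 0 \<or> k = 1 \<or> k = 2 \<or> k = (3::nat)" by auto

lemma bdto3 [simp]: 
  "bdto C e 0 1 u = bd C e 0 u" "bdto C e 0 2 u = bd C e 0 (bd C e 1 u)" "bdto C e 0 3 u = bd C e 0 (bd C e 1 (bd C e 2 u))"
  "bdto C e 1 1 u = u" "bdto C e 1 2 u = bd C e 1 u" "bdto C e 1 3 u = bd C e 1 (bd C e 2 u)"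
  "bdto C e 2 2 u = u" "bdto C e 2 3 u = bd C e 2 u" "bdto C e k k u = u"
  by (simp_all add: numeral_eq_Suc) (cases k; simp)

lemma free_composable:
  "composable (free_precat P) (Suc 0) (Suc 0) u v \<longleftrightarrow> (\<exists>f g. u = Cell1 f \<and> v = Cell1 g \<and> f \<in> cells1 P \<and> g \<in> cells1 P \<and> bd0 P Pos f = bd0 P Neg g)"
  "composable (free_precat P) (Suc 0) 2 u v \<longleftrightarrow> (\<exists>f g. u = Cell1 f \<and> v = Cell2 g \<and> f \<in> cells1 P \<and> g \<in> cells2 P \<and> bd0 P Pos f = bd0 P Neg (bd1 P Neg g))"
  "composable (free_precat P) (Suc 0) 3 u v \<longleftrightarrow> (\<exists>f g. u = Cell1 f \<and> v = Cell3 g \<and> f \<in> cells1 P \<and> g \<in> cells3 P \<and> bd0 P Pos f = bd0 P Neg (bd1 P Neg (bd2 P Neg g)))"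
  "composable (free_precat P) 2 (Suc 0) u v \<longleftrightarrow> (\<exists>f g. u = Cell2 f \<and> v = Cell1 g \<and> f \<in> cells2 P \<and> g \<in> cells1 P \<and> bd0 P Pos (bd1 P Neg f) = bd0 P Neg g)"
  "composable (free_precat P) 2 2 u v \<longleftrightarrow> (\<exists>f g. u = Cell2 f \<and> v = Cell2 g \<and> f \<in> cells2 P \<and> g \<in> cells2 P \<and> (bd1 P Pos f) = bd1 P Neg g)"
  "composable (free_precat P) 2 3 u v \<longleftrightarrow> (\<exists>f g. u = Cell2 f \<and> v = Cell3 g \<and> f \<in> cells2 P \<and> g \<in> cells3 P \<and> (bd1 P Pos f) = bd1 P Neg (bd2 P Neg g))"
  "composable (free_precat P) 3 (Suc 0) u v \<longleftrightarrow> (\<exists>f g. u = Cell3 f \<and> v = Cell1 g \<and> f \<in> cells3 P \<and> g \<in> cells1 P \<and> bd0 P Pos (bd1 P Neg (bd2 P Neg f)) = bd0 P Neg g)"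
  "composable (free_precat P) 3 2 u v \<longleftrightarrow> (\<exists>f g. u = Cell3 f \<and> v = Cell2 g \<and> f \<in> cells3 P \<and> g \<in> cells2 P \<and> bd1 P Pos (bd2 P Neg f) = bd1 P Neg g)"
  "composable (free_precat P) 3 3 u v \<longleftrightarrow> (\<exists>f g. u = Cell3 f \<and> v = Cell3 g \<and> f \<in> cells3 P \<and> g \<in> cells3 P \<and> bd2 P Pos f = bd2 P Neg g)"
          apply (simp_all add: composable_def)
          apply (simp_all add: numeral_eq_Suc)
  by (auto simp: glob2[OF P] glob3[OF P] bd2_in[OF P])

lemma pos_le3: "0 < k \<Longrightarrow> k \<le> 3 \<Longrightarrow> k = Suc 0 \<or> k = 2 \<or> k = (3::nat)" by auto

lemma composable_pos: "composable C k l u v \<Longrightarrow> 0 < k \<and> 0 < l" by (simp add: composable_def)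

lemmas free_typing = cells1_pcomp[OF P] bd0_pcomp[OF P] bd1_pcomp[OF P] bd2_pcomp[OF P] bd0_in[OF P] bd1_in[OF P] bd2_in[OF P] 
  cells2_pcomp[OF P] cells3_pcomp[OF P] lwhisk2_in[OF P] rwhisk2_in[OF P] lwhisk30_in[OF P] rwhisk30_in[OF P] 
  lwhisk31_in[OF P] rwhisk31_in[OF P] glob2[OF P] glob3[OF P]

lemmas whisker_laws = pcomp_assoc l2_comp r2_comp lr2 l2_pcomp r2_pcomp l30_comp r30_comp lr30 l31_comp r31_comp lr31
  l30l31 l30r31 r30l31 r30r31 w3_pcomp

lemma id_in: "x \<in> gens0 P \<Longrightarrow> id_path x \<in> cells1 P" "f \<in> cells1 P \<Longrightarrow> id_path f \<in> cells2 P"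
  "\<phi> \<in> cells2 P \<Longrightarrow> id_path \<phi> \<in> cells3 P"
  by (auto simp: cells1_def cells2_def cells3_def id_paths)

lemma paths_pmap_id: "\<lbrakk>p \<in> paths V E d; v (psrc p) = psrc p;
    \<And>x. x \<in> E \<Longrightarrow> K (d Neg x) \<Longrightarrow> w x = x \<and> K (d Pos x); K (psrc p)\<rbrakk> \<Longrightarrow> pmap v w p = p"
proof -
  assume a: "p \<in> paths V E d" "v (psrc p) = psrc p"
    "\<And>x. x \<in> E \<Longrightarrow> K (d Neg x) \<Longrightarrow> w x = x \<and> K (d Pos x)" "K (psrc p)"
  have "\<lbrakk>set ws \<subseteq> E; chain d x ws; K x\<rbrakk> \<Longrightarrow> map w ws = ws" for x ws
    by (induction ws arbitrary: x) (use a(3) in auto)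
  with a show ?thesis by (cases p) (auto simp: pmap_def paths_def)
qed

lemma lwhisker_id: "w \<in> whiskers P \<Longrightarrow> x = bd0 P Neg (whisker_bd P Neg w) \<Longrightarrow> lwhisk (id_path x) w = w"
  by (auto simp: whiskers_def between_def path_bd.simps pcomp_id_left bd0_pcomp[OF P])
lemma rwhisker_id: "w \<in> whiskers P \<Longrightarrow> rwhisk w (id_path x) = w"
  by (auto simp: whiskers_def between_def)

lemma l2_id: "\<phi> \<in> cells2 P \<Longrightarrow> id_path (bd0 P Neg (bd1 P Neg \<phi>)) \<rhd> \<phi> = \<phi>"
  unfolding cells2_def lwhisk2_pmap
  apply (rule paths_pmap_id[where K="\<lambda>g. bd0 P Neg g = bd0 P Neg (bd1 P Neg \<phi>)"], assumption)
    apply (simp add: path_bd.simps pcomp_id_left)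
  using lwhisker_id whisker_glob[OF P] apply metis
  apply (simp add: path_bd.simps)
  done
lemma r2_id: "\<phi> \<in> cells2 P \<Longrightarrow> \<phi> \<lhd> id_path x = \<phi>"
  unfolding cells2_def rwhisk2_pmap
  by (rule paths_pmap_id[where K="\<lambda>g. True"], assumption) (auto simp: rwhisker_id)

lemma lstep0_id: "s \<in> steps P \<Longrightarrow> x = bd0 P Neg (bd1 P Neg (step_bd P Neg s)) \<Longrightarrow> lstep0 (id_path x) s = s"
proof -
  assume a: "s \<in> steps P" "x = bd0 P Neg (bd1 P Neg (step_bd P Neg s))"
  then obtain k l A r m where s: "s = Step k l A r m" "A \<in> gens3 P" "sandwich P k l (d2 P Neg A) r m"
    by (auto simp: steps_def)
  note sa = s(3)[unfolded sandwich_def]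
  have w: "l \<rhd> d2 P Neg A \<lhd> r \<in> cells2 P"
    using whisk2_in[OF P] sa by blast
  have b: "x = bd0 P Neg (bd1 P Neg k)" using a s sandwich_in(2)[OF P s(3)] by simp
  then have b2: "x = bd0 P Neg (bd1 P Pos k)" using glob2[OF P] sa by metis
  then have b3: "x = bd0 P Neg l" using sa w whisk2_in(3)[OF P, of l "d2 P Neg A" r] by metis
  have b4: "x = bd0 P Neg (bd1 P Neg m)" using sa w whisk2_in(3)[OF P,of l "d2 P Neg A" r] b3 by metis
  show ?thesis unfolding s using sa b b4 b3 l2_id[of k] l2_id[of m] by (simp add: pcomp_id_left psrc_bd[of l "d0 P"])
qed
lemma rstep0_id: "s \<in> steps P \<Longrightarrow> rstep0 s (id_path x) = s"
  by (auto simp: steps_def sandwich_def r2_id)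
lemma lstep1_id: "s \<in> steps P \<Longrightarrow> x = (bd1 P Neg (step_bd P Neg s)) \<Longrightarrow> lstep1 (id_path x) s = s"
  by (auto simp: steps_def sandwich_def path_bd.simps pcomp_id_left)
lemma rstep1_id: "s \<in> steps P \<Longrightarrow> rstep1 s (id_path x) = s"
  by (auto simp: steps_def sandwich_def)

lemma l30_id: "\<phi> \<in> cells3 P \<Longrightarrow> id_path (bd0 P Neg (bd1 P Neg (bd2 P Neg \<phi>))) \<rhd>\<^sub>0 \<phi> = \<phi>"
  apply (subst lwhisk30_pmap)
  apply (rule paths_pmap_id[where K="\<lambda>g. bd0 P Neg (bd1 P Neg g) = bd0 P Neg (bd1 P Neg (bd2 P Neg \<phi>))"], simp only: cells3_def)
    apply (metis l2_id bd2_in[OF P] psrc_bd)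
  using lstep0_id step_glob[OF P] apply metis
  apply (simp add: path_bd.simps(1)[of "step_bd P"])
  done
lemma r30_id: "\<phi> \<in> cells3 P \<Longrightarrow> \<phi> \<lhd>\<^sub>0 id_path x = \<phi>"
  apply (subst rwhisk30_pmap)
  by (rule paths_pmap_id[where K="\<lambda>g. True" and E="steps P" and d = "step_bd P" and V="cells2 P"]) (auto simp: cells3_def paths_def rstep0_id r2_id)
lemma l31_id: "\<phi> \<in> cells3 P \<Longrightarrow> id_path ((bd1 P Neg (bd2 P Neg \<phi>))) \<rhd>\<^sub>1 \<phi> = \<phi>"
  apply (subst lwhisk31_pmap)
  apply (rule paths_pmap_id[where K="\<lambda>g. (bd1 P Neg g) = (bd1 P Neg (bd2 P Neg \<phi>))"], simp only: cells3_def)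
    apply (metis pcomp_id_left psrc_bd)
  using lstep1_id step_glob[OF P] apply metis
  apply (simp add: path_bd.simps(1)[of "step_bd P"])
  done
lemma r31_id: "\<phi> \<in> cells3 P \<Longrightarrow> \<phi> \<lhd>\<^sub>1 id_path x = \<phi>"
  apply (subst rwhisk31_pmap)
  by (rule paths_pmap_id[where K="\<lambda>g. True" and E="steps P" and d = "step_bd P" and V="cells2 P"]) (auto simp: cells3_def paths_def rstep1_id)

lemma pc_id: "id_path (bd0 P Neg f) \<odot> f = f" "id_path (bd1 P Neg \<phi>) \<odot> \<phi> = \<phi>" "id_path (bd2 P Neg F) \<odot> F = F"
  by (simp_all add: path_bd.simps pcomp_id_left)

lemmas ids = l2_id r2_id l30_id r30_id l31_id r31_id pc_id pcomp_id_right

lemma less3_iff: "i < 3 \<longleftrightarrow> i = 0 \<or> i = 1 \<or> i = (2::nat)" by auto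
lemma Suc_less3: "Suc i < 3 \<Longrightarrow> i = 0 \<or> i = (1::nat)" by auto
lemma lt_le3: "i < k \<Longrightarrow> k \<le> 3 \<Longrightarrow> (i = 0 \<and> k = 1) \<or> (i = 0 \<and> k = 2) \<or> (i = 0 \<and> k = 3) \<or> (i = 1 \<and> k = 2) \<or> (i = 1 \<and> k = 3) \<or> (i = 2 \<and> k = (3::nat))" by auto
lemma bdto3' [simp]: "bdto C e 0 (Suc 0) u = bd C e 0 u" "bdto C e (Suc 0) 2 u = bd C e 1 u" "bdto C e (Suc 0) 3 u = bd C e 1 (bd C e 2 u)"
  by (simp_all add: numeral_eq_Suc)
lemma free_precategory: "precategory 3 (free_precat P)"
proof
  fix i u e assume "i < 3" "u \<in> cells (free_precat P) (Suc i)"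
  then show "bd (free_precat P) e i u \<in> cells (free_precat P) i"
    by (auto simp: free_typing less3_iff)
next
  fix i u e assume "Suc i < 3" "u \<in> cells (free_precat P) (Suc (Suc i))"
  then show "bd (free_precat P) e i (bd (free_precat P) Neg (Suc i) u) = bd (free_precat P) e i (bd (free_precat P) Pos (Suc i) u)"
    using Suc_less3[of i] by (auto simp: free_typing)
next
  fix i u assume "i < 3" "u \<in> cells (free_precat P) i"
  then show "idn (free_precat P) i u \<in> cells (free_precat P) (Suc i)"
    by (auto simp: id_in less3_iff)
next
  fix i u e assume "i < 3" "u \<in> cells (free_precat P) i"
  then show "bd (free_precat P) e i (idn (free_precat P) i u) = u"
    by (auto simp: less3_iff)
next
  fix k l u v assume "max k l \<le> 3" "composable (free_precat P) k l u v"
  then show "cmp (free_precat P) k l u v \<in> cells (free_precat P) (max k l)"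
    using pos_le3[of k] pos_le3[of l] composable_pos[of "free_precat P" k l u v] by (auto simp: free_composable free_typing)
next
  fix k l u v e assume "k < l" "l \<le> 3" "composable (free_precat P) k l u v"
  then show "bd (free_precat P) e (l - 1) (cmp (free_precat P) k l u v) = cmp (free_precat P) k (l - 1) u (bd (free_precat P) e (l - 1) v)"
    using pos_le3[of k] pos_le3[of l] composable_pos[of "free_precat P" k l u v] by (auto simp: free_composable free_typing)
next
  fix k l u v e assume "l < k" "k \<le> 3" "composable (free_precat P) k l u v"
  then show "bd (free_precat P) e (k - 1) (cmp (free_precat P) k l u v) = cmp (free_precat P) (k - 1) l (bd (free_precat P) e (k - 1) u) v"
    using pos_le3[of k] pos_le3[of l] composable_pos[of "free_precat P" k l u v] by (auto simp: free_composable free_typing)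
next
  fix k u v assume "k \<le> 3" "composable (free_precat P) k k u v"
  then show "bd (free_precat P) Neg (k - 1) (cmp (free_precat P) k k u v) = bd (free_precat P) Neg (k - 1) u"
    using pos_le3[of k] composable_pos[of "free_precat P" k k u v] by (auto simp: free_composable free_typing)
next
  fix k u v assume "k \<le> 3" "composable (free_precat P) k k u v"
  then show "bd (free_precat P) Pos (k - 1) (cmp (free_precat P) k k u v) = bd (free_precat P) Pos (k - 1) v"
    using pos_le3[of k] composable_pos[of "free_precat P" k k u v] by (auto simp: free_composable free_typing)
next
  fix i k u assume "i < k" "k \<le> 3" "u \<in> cells (free_precat P) k"
  then show "cmp (free_precat P) k (Suc i) u (idn (free_precat P) i (bdto (free_precat P) Pos i k u)) = u"
    using lt_le3[of i k] by (auto simp: ids)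
next
  fix i k u assume "i < k" "k \<le> 3" "u \<in> cells (free_precat P) k"
  then show "cmp (free_precat P) (Suc i) k (idn (free_precat P) i (bdto (free_precat P) Neg i k u)) u = u"
    using lt_le3[of i k] by (auto simp: ids)
next
  fix i k u v assume a: "i < k" "k < 3" "composable (free_precat P) k (Suc i) u v"
  then have "(k = Suc 0 \<and> i = 0) \<or> (k = 2 \<and> i = 0) \<or> (k = 2 \<and> i = 1)" by auto
  then show "cmp (free_precat P) (Suc k) (Suc i) (idn (free_precat P) k u) v = idn (free_precat P) k (cmp (free_precat P) k (Suc i) u v)"
    using a(3) by (auto simp: free_composable simp flip: numeral_2_eq_2)
next
  fix i k u v assume a: "i < k" "k < 3" "composable (free_precat P) (Suc i) k v u"
  then have "(k = Suc 0 \<and> i = 0) \<or> (k = 2 \<and> i = 0) \<or> (k = 2 \<and> i = 1)" by auto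
  then show "cmp (free_precat P) (Suc i) (Suc k) v (idn (free_precat P) k u) = idn (free_precat P) k (cmp (free_precat P) (Suc i) k v u)"
    using a(3) by (auto simp: free_composable simp flip: numeral_2_eq_2)
next
  fix k l m i u v w
  assume a: "k \<le> 3" "l \<le> 3" "m \<le> 3" "composable (free_precat P) k l u v" "composable (free_precat P) l m v w" 
    "min k l = Suc i" "min (max k l) m = Suc i"
    "min l m = Suc i" "min k (max l m) = Suc i"
  then show "cmp (free_precat P) (max k l) m (cmp (free_precat P) k l u v) w = cmp (free_precat P) k (max l m) u (cmp (free_precat P) l m v w)"
    using pos_le3[of k] pos_le3[of l] pos_le3[of m] composable_pos[of "free_precat P" k l u v] composable_pos[of "free_precat P" l m v w] by (auto simp: free_composable whisker_laws)
next
  fix k l i u v v'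
  assume a: "k \<le> 3" "l \<le> 3" "Suc i < min k l" "composable (free_precat P) k l v v'" "composable (free_precat P) (Suc i) (max k l) u (cmp (free_precat P) k l v v')"
  then show "cmp (free_precat P) (Suc i) (max k l) u (cmp (free_precat P) k l v v') = cmp (free_precat P) k l (cmp (free_precat P) (Suc i) k u v) (cmp (free_precat P) (Suc i) l u v')"
    using pos_le3[of k] pos_le3[of l] pos_le3[of "Suc i"] composable_pos[of "free_precat P" k l v v']
    by (auto simp: free_composable whisker_laws simp flip: numeral_2_eq_2)
next
  fix k l i u v v'
  assume a: "k \<le> 3" "l \<le> 3" "Suc i < min k l" "composable (free_precat P) k l v v'" "composable (free_precat P) (max k l) (Suc i) (cmp (free_precat P) k l v v') u"
  then show "cmp (free_precat P) (max k l) (Suc i) (cmp (free_precat P) k l v v') u = cmp (free_precat P) k l (cmp (free_precat P) k (Suc i) v u) (cmp (free_precat P) l (Suc i) v' u)"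
    using pos_le3[of k] pos_le3[of l] pos_le3[of "Suc i"] composable_pos[of "free_precat P" k l v v']
    by (auto simp: free_composable whisker_laws simp flip: numeral_2_eq_2)
qed

end

subsection \<open>Universal property\<close>

text \<open>
  For \<open>n = 1, 2, 3\<close>, a morphism of \<open>(n-1)\<close>-precategories out of the free \<open>(n-1)\<close>-precategory and a
  boundary-compatible assignment of \<open>n\<close>-cells to the \<open>n\<close>-generators extend uniquely
  (\<open>free_extension\<close>, \<open>free_unique\<close>).
\<close>

context precategory
begin

lemma bdto_low: 
  "bdto C e 0 (Suc 0) u = bd C e 0 u" "bdto C e 0 2 u = bd C e 0 (bd C e (Suc 0) u)" "bdto C e 0 3 u = bd C e 0 (bd C e (Suc 0) (bd C e 2 u))"
  "bdto C e (Suc 0) 2 u = bd C e (Suc 0) u" "bdto C e (Suc 0) 3 u = bd C e (Suc 0) (bd C e 2 u)"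
  "bdto C e 2 3 u = bd C e 2 u" "bdto C e k k u = u"
  by (simp_all add: numeral_eq_Suc) (cases k; simp)

lemma glob1: "\<lbrakk>2 \<le> n; u \<in> cells C 2\<rbrakk> \<Longrightarrow> bd C e 0 (bd C Pos (Suc 0) u) = bd C e 0 (bd C Neg (Suc 0) u)"
  using globular[of 0 u e] by (simp add: numeral_2_eq_2)
lemma glob2': "\<lbrakk>3 \<le> n; u \<in> cells C 3\<rbrakk> \<Longrightarrow> bd C e (Suc 0) (bd C Pos 2 u) = bd C e (Suc 0) (bd C Neg 2 u)"
  using globular[of 1 u e] by (simp add: numeral_2_eq_2 numeral_3_eq_3)

lemma bd_in: "1 \<le> n \<Longrightarrow> u \<in> cells C (Suc 0) \<Longrightarrow> bd C e 0 u \<in> cells C 0"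
  "2 \<le> n \<Longrightarrow> u \<in> cells C 2 \<Longrightarrow> bd C e (Suc 0) u \<in> cells C (Suc 0)"
  "3 \<le> n \<Longrightarrow> u \<in> cells C 3 \<Longrightarrow> bd C e 2 u \<in> cells C 2"
  using bd_cell[of 0 u] bd_cell[of 1 u] bd_cell[of 2 u] by (simp_all add: numeral_2_eq_2 numeral_3_eq_3)

lemma composable_iff:
  "2 \<le> n \<Longrightarrow> composable C (Suc 0) 2 u v \<longleftrightarrow> u \<in> cells C (Suc 0) \<and> v \<in> cells C 2 \<and> bd C Pos 0 u = bd C Neg 0 (bd C Neg (Suc 0) v)"
  "2 \<le> n \<Longrightarrow> composable C 2 (Suc 0) u v \<longleftrightarrow> u \<in> cells C 2 \<and> v \<in> cells C (Suc 0) \<and> bd C Pos 0 (bd C Neg (Suc 0) u) = bd C Neg 0 v"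
  "composable C (Suc 0) (Suc 0) u v \<longleftrightarrow> u \<in> cells C (Suc 0) \<and> v \<in> cells C (Suc 0) \<and> bd C Pos 0 u = bd C Neg 0 v"
  "composable C 2 2 u v \<longleftrightarrow> u \<in> cells C 2 \<and> v \<in> cells C 2 \<and> bd C Pos (Suc 0) u = bd C Neg (Suc 0) v"
  "composable C 3 3 u v \<longleftrightarrow> u \<in> cells C 3 \<and> v \<in> cells C 3 \<and> bd C Pos 2 u = bd C Neg 2 v"
  "3 \<le> n \<Longrightarrow> composable C (Suc 0) 3 u v \<longleftrightarrow> u \<in> cells C (Suc 0) \<and> v \<in> cells C 3 \<and> bd C Pos 0 u = bd C Neg 0 (bd C Neg (Suc 0) (bd C Neg 2 v))"
  "3 \<le> n \<Longrightarrow> composable C 3 (Suc 0) u v \<longleftrightarrow> u \<in> cells C 3 \<and> v \<in> cells C (Suc 0) \<and> bd C Pos 0 (bd C Neg (Suc 0) (bd C Neg 2 u)) = bd C Neg 0 v"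
  "3 \<le> n \<Longrightarrow> composable C 2 3 u v \<longleftrightarrow> u \<in> cells C 2 \<and> v \<in> cells C 3 \<and> bd C Pos (Suc 0) u = bd C Neg (Suc 0) (bd C Neg 2 v)"
  "3 \<le> n \<Longrightarrow> composable C 3 2 u v \<longleftrightarrow> u \<in> cells C 3 \<and> v \<in> cells C 2 \<and> bd C Pos (Suc 0) (bd C Neg 2 u) = bd C Neg (Suc 0) v"
  by (auto simp: composable_def bdto_low glob1 glob2' bd_in)

lemma cmp_in:
  "1 \<le> n \<Longrightarrow> composable C (Suc 0) (Suc 0) u v \<Longrightarrow> cmp C (Suc 0) (Suc 0) u v \<in> cells C (Suc 0)"
  "2 \<le> n \<Longrightarrow> composable C (Suc 0) 2 u v \<Longrightarrow> cmp C (Suc 0) 2 u v \<in> cells C 2"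
  "2 \<le> n \<Longrightarrow> composable C 2 (Suc 0) u v \<Longrightarrow> cmp C 2 (Suc 0) u v \<in> cells C 2"
  "2 \<le> n \<Longrightarrow> composable C 2 2 u v \<Longrightarrow> cmp C 2 2 u v \<in> cells C 2"
  "3 \<le> n \<Longrightarrow> composable C (Suc 0) 3 u v \<Longrightarrow> cmp C (Suc 0) 3 u v \<in> cells C 3"
  "3 \<le> n \<Longrightarrow> composable C 3 (Suc 0) u v \<Longrightarrow> cmp C 3 (Suc 0) u v \<in> cells C 3"
  "3 \<le> n \<Longrightarrow> composable C 2 3 u v \<Longrightarrow> cmp C 2 3 u v \<in> cells C 3"
  "3 \<le> n \<Longrightarrow> composable C 3 2 u v \<Longrightarrow> cmp C 3 2 u v \<in> cells C 3"
  "3 \<le> n \<Longrightarrow> composable C 3 3 u v \<Longrightarrow> cmp C 3 3 u v \<in> cells C 3"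
  using cmp_cell[of "Suc 0" "Suc 0" u v] cmp_cell[of "Suc 0" 2 u v] cmp_cell[of 2 "Suc 0" u v] cmp_cell[of 2 2 u v]
   cmp_cell[of "Suc 0" 3 u v] cmp_cell[of 3 "Suc 0" u v] cmp_cell[of 2 3 u v] cmp_cell[of 3 2 u v] cmp_cell[of 3 3 u v]
  by (auto simp: max_def)

lemma bd_cmp:
  "1 \<le> n \<Longrightarrow> composable C (Suc 0) (Suc 0) u v \<Longrightarrow> bd C Neg 0 (cmp C (Suc 0) (Suc 0) u v) = bd C Neg 0 u"
  "1 \<le> n \<Longrightarrow> composable C (Suc 0) (Suc 0) u v \<Longrightarrow> bd C Pos 0 (cmp C (Suc 0) (Suc 0) u v) = bd C Pos 0 v"
  "2 \<le> n \<Longrightarrow> composable C (Suc 0) 2 u v \<Longrightarrow> bd C e (Suc 0) (cmp C (Suc 0) 2 u v) = cmp C (Suc 0) (Suc 0) u (bd C e (Suc 0) v)"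
  "2 \<le> n \<Longrightarrow> composable C 2 (Suc 0) u v \<Longrightarrow> bd C e (Suc 0) (cmp C 2 (Suc 0) u v) = cmp C (Suc 0) (Suc 0) (bd C e (Suc 0) u) v"
  "2 \<le> n \<Longrightarrow> composable C 2 2 u v \<Longrightarrow> bd C Neg (Suc 0) (cmp C 2 2 u v) = bd C Neg (Suc 0) u"
  "2 \<le> n \<Longrightarrow> composable C 2 2 u v \<Longrightarrow> bd C Pos (Suc 0) (cmp C 2 2 u v) = bd C Pos (Suc 0) v"
  "3 \<le> n \<Longrightarrow> composable C (Suc 0) 3 u v \<Longrightarrow> bd C e 2 (cmp C (Suc 0) 3 u v) = cmp C (Suc 0) 2 u (bd C e 2 v)"
  "3 \<le> n \<Longrightarrow> composable C 3 (Suc 0) u v \<Longrightarrow> bd C e 2 (cmp C 3 (Suc 0) u v) = cmp C 2 (Suc 0) (bd C e 2 u) v"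
  "3 \<le> n \<Longrightarrow> composable C 2 3 u v \<Longrightarrow> bd C e 2 (cmp C 2 3 u v) = cmp C 2 2 u (bd C e 2 v)"
  "3 \<le> n \<Longrightarrow> composable C 3 2 u v \<Longrightarrow> bd C e 2 (cmp C 3 2 u v) = cmp C 2 2 (bd C e 2 u) v"
  "3 \<le> n \<Longrightarrow> composable C 3 3 u v \<Longrightarrow> bd C Neg 2 (cmp C 3 3 u v) = bd C Neg 2 u"
  "3 \<le> n \<Longrightarrow> composable C 3 3 u v \<Longrightarrow> bd C Pos 2 (cmp C 3 3 u v) = bd C Pos 2 v"
  using src_cmp[of "Suc 0" u v] tgt_cmp[of "Suc 0" u v] bd_cmp_less[of "Suc 0" 2 u v e] bd_cmp_greater[of "Suc 0" 2 u v e]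
  src_cmp[of 2 u v] tgt_cmp[of 2 u v] bd_cmp_less[of "Suc 0" 3 u v e] bd_cmp_greater[of "Suc 0" 3 u v e]
  bd_cmp_less[of 2 3 u v e] bd_cmp_greater[of 2 3 u v e] src_cmp[of 3 u v] tgt_cmp[of 3 u v]
  by auto

lemma composable_cells: "composable C k l u v \<Longrightarrow> u \<in> cells C k \<and> v \<in> cells C l" by (simp add: composable_def)

lemma cmp_assoc1: "\<lbrakk>1 \<le> n; u \<in> cells C (Suc 0); v \<in> cells C (Suc 0); w \<in> cells C (Suc 0); bd C Pos 0 u = bd C Neg 0 v; bd C Pos 0 v = bd C Neg 0 w\<rbrakk> \<Longrightarrow>
  cmp C (Suc 0) (Suc 0) (cmp C (Suc 0) (Suc 0) u v) w = cmp C (Suc 0) (Suc 0) u (cmp C (Suc 0) (Suc 0) v w)"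
  using cmp_assoc[of 1 1 1 0 u v w] cmp_in(1)[of u v] cmp_in(1)[of v w] by (simp add: composable_iff bd_cmp)
lemma cmp_assoc2:
  "\<lbrakk>2 \<le> n; u \<in> cells C (Suc 0); v \<in> cells C (Suc 0); w \<in> cells C 2; bd C Pos 0 u = bd C Neg 0 v; bd C Pos 0 v = bd C Neg 0 (bd C Neg (Suc 0) w)\<rbrakk> \<Longrightarrow>
  cmp C (Suc 0) 2 (cmp C (Suc 0) (Suc 0) u v) w = cmp C (Suc 0) 2 u (cmp C (Suc 0) 2 v w)"
  "\<lbrakk>2 \<le> n; u \<in> cells C (Suc 0); v \<in> cells C 2; w \<in> cells C (Suc 0); bd C Pos 0 u = bd C Neg 0 (bd C Neg (Suc 0) v); bd C Pos 0 (bd C Neg (Suc 0) v) = bd C Neg 0 w\<rbrakk> \<Longrightarrow>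
  cmp C 2 (Suc 0) (cmp C (Suc 0) 2 u v) w = cmp C (Suc 0) 2 u (cmp C 2 (Suc 0) v w)"
  "\<lbrakk>2 \<le> n; u \<in> cells C 2; v \<in> cells C (Suc 0); w \<in> cells C (Suc 0); bd C Pos 0 (bd C Neg (Suc 0) u) = bd C Neg 0 v; bd C Pos 0 v = bd C Neg 0 w\<rbrakk> \<Longrightarrow>
  cmp C 2 (Suc 0) (cmp C 2 (Suc 0) u v) w = cmp C 2 (Suc 0) u (cmp C (Suc 0) (Suc 0) v w)"
  "\<lbrakk>2 \<le> n; u \<in> cells C 2; v \<in> cells C 2; w \<in> cells C 2; bd C Pos (Suc 0) u = bd C Neg (Suc 0) v; bd C Pos (Suc 0) v = bd C Neg (Suc 0) w\<rbrakk> \<Longrightarrow>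
  cmp C 2 2 (cmp C 2 2 u v) w = cmp C 2 2 u (cmp C 2 2 v w)"
  using cmp_assoc[of "Suc 0" "Suc 0" 2 0 u v w] cmp_assoc[of "Suc 0" 2 "Suc 0" 0 u v w] cmp_assoc[of 2 "Suc 0" "Suc 0" 0 u v w] cmp_assoc[of 2 2 2 1 u v w]
  by (simp_all add: cmp_in composable_iff bd_cmp bd_in flip: numeral_2_eq_2)
lemma cmp_assoc3:
  "\<lbrakk>3 \<le> n; u \<in> cells C (Suc 0); v \<in> cells C (Suc 0); w \<in> cells C 3; bd C Pos 0 u = bd C Neg 0 v; bd C Pos 0 v = bd C Neg 0 (bd C Neg (Suc 0) (bd C Neg 2 w))\<rbrakk> \<Longrightarrow>
  cmp C (Suc 0) 3 (cmp C (Suc 0) (Suc 0) u v) w = cmp C (Suc 0) 3 u (cmp C (Suc 0) 3 v w)"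
  "\<lbrakk>3 \<le> n; u \<in> cells C (Suc 0); v \<in> cells C 3; w \<in> cells C (Suc 0); bd C Pos 0 u = bd C Neg 0 (bd C Neg (Suc 0) (bd C Neg 2 v)); bd C Pos 0 (bd C Neg (Suc 0) (bd C Neg 2 v)) = bd C Neg 0 w\<rbrakk> \<Longrightarrow>
  cmp C 3 (Suc 0) (cmp C (Suc 0) 3 u v) w = cmp C (Suc 0) 3 u (cmp C 3 (Suc 0) v w)"
  "\<lbrakk>3 \<le> n; u \<in> cells C 3; v \<in> cells C (Suc 0); w \<in> cells C (Suc 0); bd C Pos 0 (bd C Neg (Suc 0) (bd C Neg 2 u)) = bd C Neg 0 v; bd C Pos 0 v = bd C Neg 0 w\<rbrakk> \<Longrightarrow>
  cmp C 3 (Suc 0) (cmp C 3 (Suc 0) u v) w = cmp C 3 (Suc 0) u (cmp C (Suc 0) (Suc 0) v w)"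
  "\<lbrakk>3 \<le> n; u \<in> cells C 3; v \<in> cells C 3; w \<in> cells C 3; bd C Pos 2 u = bd C Neg 2 v; bd C Pos 2 v = bd C Neg 2 w\<rbrakk> \<Longrightarrow>
  cmp C 3 3 (cmp C 3 3 u v) w = cmp C 3 3 u (cmp C 3 3 v w)"
  "\<lbrakk>3 \<le> n; u \<in> cells C 2; v \<in> cells C 2; w \<in> cells C 3; bd C Pos (Suc 0) u = bd C Neg (Suc 0) v; bd C Pos (Suc 0) v = bd C Neg (Suc 0) (bd C Neg 2 w)\<rbrakk> \<Longrightarrow>
  cmp C 2 3 (cmp C 2 2 u v) w = cmp C 2 3 u (cmp C 2 3 v w)"
  "\<lbrakk>3 \<le> n; u \<in> cells C 2; v \<in> cells C 3; w \<in> cells C 2; bd C Pos (Suc 0) u = bd C Neg (Suc 0) (bd C Neg 2 v); bd C Pos (Suc 0) (bd C Neg 2 v) = bd C Neg (Suc 0) w\<rbrakk> \<Longrightarrow>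
  cmp C 3 2 (cmp C 2 3 u v) w = cmp C 2 3 u (cmp C 3 2 v w)"
  "\<lbrakk>3 \<le> n; u \<in> cells C 3; v \<in> cells C 2; w \<in> cells C 2; bd C Pos (Suc 0) (bd C Neg 2 u) = bd C Neg (Suc 0) v; bd C Pos (Suc 0) v = bd C Neg (Suc 0) w\<rbrakk> \<Longrightarrow>
  cmp C 3 2 (cmp C 3 2 u v) w = cmp C 3 2 u (cmp C 2 2 v w)"
  using cmp_assoc[of "Suc 0" "Suc 0" 3 0 u v w] cmp_assoc[of "Suc 0" 3 "Suc 0" 0 u v w] cmp_assoc[of 3 "Suc 0" "Suc 0" 0 u v w] cmp_assoc[of 3 3 3 2 u v w]
    cmp_assoc[of 2 2 3 1 u v w] cmp_assoc[of 2 3 2 1 u v w] cmp_assoc[of 3 2 2 1 u v w]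
  by (simp_all add: cmp_in composable_iff bd_cmp bd_in flip: numeral_2_eq_2)
lemma cmp_distribs:
  "\<lbrakk>2 \<le> n; u \<in> cells C (Suc 0); v \<in> cells C 2; w \<in> cells C 2; bd C Pos (Suc 0) v = bd C Neg (Suc 0) w; bd C Pos 0 u = bd C Neg 0 (bd C Neg (Suc 0) v)\<rbrakk> \<Longrightarrow>
   cmp C (Suc 0) 2 u (cmp C 2 2 v w) = cmp C 2 2 (cmp C (Suc 0) 2 u v) (cmp C (Suc 0) 2 u w)"
  "\<lbrakk>2 \<le> n; u \<in> cells C (Suc 0); v \<in> cells C 2; w \<in> cells C 2; bd C Pos (Suc 0) v = bd C Neg (Suc 0) w; bd C Pos 0 (bd C Neg (Suc 0) v) = bd C Neg 0 u\<rbrakk> \<Longrightarrow>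
   cmp C 2 (Suc 0) (cmp C 2 2 v w) u = cmp C 2 2 (cmp C 2 (Suc 0) v u) (cmp C 2 (Suc 0) w u)"
  "\<lbrakk>3 \<le> n; u \<in> cells C (Suc 0); v \<in> cells C 3; w \<in> cells C 3; bd C Pos 2 v = bd C Neg 2 w; bd C Pos 0 u = bd C Neg 0 (bd C Neg (Suc 0) (bd C Neg 2 v))\<rbrakk> \<Longrightarrow>
   cmp C (Suc 0) 3 u (cmp C 3 3 v w) = cmp C 3 3 (cmp C (Suc 0) 3 u v) (cmp C (Suc 0) 3 u w)"
  "\<lbrakk>3 \<le> n; u \<in> cells C (Suc 0); v \<in> cells C 3; w \<in> cells C 3; bd C Pos 2 v = bd C Neg 2 w; bd C Pos 0 (bd C Neg (Suc 0) (bd C Neg 2 v)) = bd C Neg 0 u\<rbrakk> \<Longrightarrow>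
   cmp C 3 (Suc 0) (cmp C 3 3 v w) u = cmp C 3 3 (cmp C 3 (Suc 0) v u) (cmp C 3 (Suc 0) w u)"
  "\<lbrakk>3 \<le> n; u \<in> cells C 2; v \<in> cells C 3; w \<in> cells C 3; bd C Pos 2 v = bd C Neg 2 w; bd C Pos (Suc 0) u = bd C Neg (Suc 0) (bd C Neg 2 v)\<rbrakk> \<Longrightarrow>
   cmp C 2 3 u (cmp C 3 3 v w) = cmp C 3 3 (cmp C 2 3 u v) (cmp C 2 3 u w)"
  "\<lbrakk>3 \<le> n; u \<in> cells C 2; v \<in> cells C 3; w \<in> cells C 3; bd C Pos 2 v = bd C Neg 2 w; bd C Pos (Suc 0) (bd C Neg 2 v) = bd C Neg (Suc 0) u\<rbrakk> \<Longrightarrow>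
   cmp C 3 2 (cmp C 3 3 v w) u = cmp C 3 3 (cmp C 3 2 v u) (cmp C 3 2 w u)"
  "\<lbrakk>3 \<le> n; u \<in> cells C (Suc 0); v \<in> cells C 2; w \<in> cells C 3; bd C Pos (Suc 0) v = bd C Neg (Suc 0) (bd C Neg 2 w); bd C Pos 0 u = bd C Neg 0 (bd C Neg (Suc 0) v)\<rbrakk> \<Longrightarrow>
   cmp C (Suc 0) 3 u (cmp C 2 3 v w) = cmp C 2 3 (cmp C (Suc 0) 2 u v) (cmp C (Suc 0) 3 u w)"
  "\<lbrakk>3 \<le> n; u \<in> cells C (Suc 0); v \<in> cells C 2; w \<in> cells C 3; bd C Pos (Suc 0) v = bd C Neg (Suc 0) (bd C Neg 2 w); bd C Pos 0 (bd C Neg (Suc 0) v) = bd C Neg 0 u\<rbrakk> \<Longrightarrow>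
   cmp C 3 (Suc 0) (cmp C 2 3 v w) u = cmp C 2 3 (cmp C 2 (Suc 0) v u) (cmp C 3 (Suc 0) w u)"
  "\<lbrakk>3 \<le> n; u \<in> cells C (Suc 0); v \<in> cells C 3; w \<in> cells C 2; bd C Pos (Suc 0) (bd C Neg 2 v) = bd C Neg (Suc 0) w; bd C Pos 0 u = bd C Neg 0 (bd C Neg (Suc 0) (bd C Neg 2 v))\<rbrakk> \<Longrightarrow>
   cmp C (Suc 0) 3 u (cmp C 3 2 v w) = cmp C 3 2 (cmp C (Suc 0) 3 u v) (cmp C (Suc 0) 2 u w)"
  "\<lbrakk>3 \<le> n; u \<in> cells C (Suc 0); v \<in> cells C 3; w \<in> cells C 2; bd C Pos (Suc 0) (bd C Neg 2 v) = bd C Neg (Suc 0) w; bd C Pos 0 (bd C Neg (Suc 0) (bd C Neg 2 v)) = bd C Neg 0 u\<rbrakk> \<Longrightarrow>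
   cmp C 3 (Suc 0) (cmp C 3 2 v w) u = cmp C 3 2 (cmp C 3 (Suc 0) v u) (cmp C 2 (Suc 0) w u)"
  using cmp_distrib_left[of 2 2 0 v w u] cmp_distrib_right[of 2 2 0 v w u] cmp_distrib_left[of 3 3 0 v w u] cmp_distrib_right[of 3 3 0 v w u]
    cmp_distrib_left[of 3 3 1 v w u] cmp_distrib_right[of 3 3 1 v w u] cmp_distrib_left[of 2 3 0 v w u] cmp_distrib_right[of 2 3 0 v w u]
    cmp_distrib_left[of 3 2 0 v w u] cmp_distrib_right[of 3 2 0 v w u]
  by (simp_all add: cmp_in composable_iff bd_cmp bd_in numeral_2_eq_2[symmetric])

end

primrec path_ext where
  "path_ext D m V W t x [] = idn D m (V x)"
| "path_ext D m V W t x (w # ws) = cmp D (Suc m) (Suc m) (W w) (path_ext D m V W t (t w) ws)"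

context precategory begin

lemma bdto_same [simp]: "bdto C e m m u = u" by (cases m) auto

lemma composable_same: "composable C (Suc m) (Suc m) u v \<longleftrightarrow> u \<in> cells C (Suc m) \<and> v \<in> cells C (Suc m) \<and> bd C Pos m u = bd C Neg m v"
  by (auto simp: composable_def)

lemma path_ext_typing:
  assumes m: "Suc m \<le> n" and V: "\<And>x. x \<in> X \<Longrightarrow> V x \<in> cells C m"
    and W: "\<And>w e. w \<in> E \<Longrightarrow> W w \<in> cells C (Suc m) \<and> bd C e m (W w) = V (d e w) \<and> d e w \<in> X"
    and x: "x \<in> X" "set ws \<subseteq> E" "chain d x ws"
  shows "path_ext C m V W (d Pos) x ws \<in> cells C (Suc m) \<and> bd C Neg m (path_ext C m V W (d Pos) x ws) = V x \<and>
     bd C Pos m (path_ext C m V W (d Pos) x ws) = V (endpoint (d Pos) x ws)"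
  using x
proof (induction ws arbitrary: x)
  case Nil
  then show ?case using m V by (simp add: idn_cell bd_idn)
next
  case (Cons w ws)
  let ?r = "path_ext C m V W (d Pos) (d Pos w) ws"
  have 1: "?r \<in> cells C (Suc m) \<and> bd C Neg m ?r = V (d Pos w) \<and> bd C Pos m ?r = V (endpoint (d Pos) (d Pos w) ws)"
    using Cons W by simp
  have "composable C (Suc m) (Suc m) (W w) ?r" using 1 W Cons.prems by (simp add: composable_same)
  then show ?case using 1 W[of w] Cons.prems m cmp_cell[of "Suc m" "Suc m" "W w" ?r] src_cmp[of "Suc m" "W w" ?r] tgt_cmp[of "Suc m" "W w" ?r]
    by auto
qed

lemma path_ext_append:
  assumes m: "Suc m \<le> n" and V: "\<And>x. x \<in> X \<Longrightarrow> V x \<in> cells C m"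
    and W: "\<And>w e. w \<in> E \<Longrightarrow> W w \<in> cells C (Suc m) \<and> bd C e m (W w) = V (d e w) \<and> d e w \<in> X"
    and x: "x \<in> X" "set (ws @ vs) \<subseteq> E" "chain d x (ws @ vs)"
  shows "path_ext C m V W (d Pos) x (ws @ vs) = cmp C (Suc m) (Suc m) (path_ext C m V W (d Pos) x ws) (path_ext C m V W (d Pos) (endpoint (d Pos) x ws) vs)"
  using x
proof (induction ws arbitrary: x)
  case Nil
  have 1: "path_ext C m V W (d Pos) x vs \<in> cells C (Suc m) \<and> bd C Neg m (path_ext C m V W (d Pos) x vs) = V x"
    using path_ext_typing[where X=X and E=E and d=d and V=V and W=W and x=x and ws=vs, OF m V W] Nil by simp
  show ?case using cmp_idn_left[of m "Suc m" "path_ext C m V W (d Pos) x vs"] m 1 by simp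
next
  case (Cons w ws)
  let ?p = "\<lambda>x ws. path_ext C m V W (d Pos) x ws"
  let ?y = "d Pos w"
  have ih: "?p ?y (ws @ vs) = cmp C (Suc m) (Suc m) (?p ?y ws) (?p (endpoint (d Pos) ?y ws) vs)"
    using Cons W by simp
  have yX: "?y \<in> X" using W Cons.prems by simp
  have a: "?p ?y ws \<in> cells C (Suc m) \<and> bd C Neg m (?p ?y ws) = V ?y \<and> bd C Pos m (?p ?y ws) = V (endpoint (d Pos) ?y ws)"
    using path_ext_typing[where X=X and E=E and d=d and V=V and W=W and x="?y" and ws=ws, OF m V W] Cons.prems yX by simp
  have eX: "endpoint (d Pos) ?y ws \<in> X" using endpoint_in[of E "d Pos" X ?y ws] W yX Cons.prems by auto
  have b: "?p (endpoint (d Pos) ?y ws) vs \<in> cells C (Suc m) \<and> bd C Neg m (?p (endpoint (d Pos) ?y ws) vs) = V (endpoint (d Pos) ?y ws)"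
    using path_ext_typing[where X=X and E=E and d=d and V=V and W=W and x="endpoint (d Pos) ?y ws" and ws=vs, OF m V W] Cons.prems eX by simp
  have w: "W w \<in> cells C (Suc m) \<and> bd C Pos m (W w) = V ?y" using W Cons.prems by simp
  have c1: "composable C (Suc m) (Suc m) (W w) (?p ?y ws)" using a w by (simp add: composable_same)
  have c2: "composable C (Suc m) (Suc m) (?p ?y ws) (?p (endpoint (d Pos) ?y ws) vs)" using a b by (simp add: composable_same)
  have c3: "composable C (Suc m) (Suc m) (cmp C (Suc m) (Suc m) (W w) (?p ?y ws)) (?p (endpoint (d Pos) ?y ws) vs)"
    using c1 m a b cmp_cell[of "Suc m" "Suc m", OF _ c1] tgt_cmp[of "Suc m", OF _ c1] by (simp add: composable_same)
  have c4: "composable C (Suc m) (Suc m) (W w) (cmp C (Suc m) (Suc m) (?p ?y ws) (?p (endpoint (d Pos) ?y ws) vs))"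
    using c2 m a b w cmp_cell[of "Suc m" "Suc m", OF _ c2] src_cmp[of "Suc m", OF _ c2] by (simp add: composable_same)
  show ?case using cmp_assoc[of "Suc m" "Suc m" "Suc m" m] c1 c2 c3 c4 m ih by simp
qed

lemma path_ext_single:
  assumes m: "Suc m \<le> n" and "W w \<in> cells C (Suc m)" "bd C Pos m (W w) = V (t w)"
  shows "path_ext C m V W t x [w] = W w"
proof -
  show ?thesis using cmp_idn_right[of m "Suc m" "W w"] assms by simp
qed

lemma path_ext_whisker:
  assumes m: "Suc m \<le> n" and V: "\<And>x. x \<in> X \<Longrightarrow> V x \<in> cells C m"
    and W: "\<And>w e. w \<in> E \<Longrightarrow> W w \<in> cells C (Suc m) \<and> bd C e m (W w) = V (d e w) \<and> d e w \<in> X"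
    and K: "\<And>w. w \<in> E \<Longrightarrow> K (d Neg w) \<Longrightarrow> K (d Pos w) \<and> W (g w) = opr (W w) \<and> d' Pos (g w) = f (d Pos w)"
    and oi: "\<And>x. x \<in> X \<Longrightarrow> K x \<Longrightarrow> opr (idn C m (V x)) = idn C m (V (f x))"
    and oc: "\<And>w u. \<lbrakk>w \<in> E; K (d Neg w); u \<in> cells C (Suc m); bd C Neg m u = V (d Pos w)\<rbrakk>
       \<Longrightarrow> opr (cmp C (Suc m) (Suc m) (W w) u) = cmp C (Suc m) (Suc m) (opr (W w)) (opr u)"
    and x: "x \<in> X" "set ws \<subseteq> E" "chain d x ws" "K x"
  shows "path_ext C m V W (d' Pos) (f x) (map g ws) = opr (path_ext C m V W (d Pos) x ws)"
  using x
proof (induction ws arbitrary: x)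
  case Nil
  then show ?case using oi by simp
next
  case (Cons w ws)
  then have w: "w \<in> E" "K (d Neg w)" "d Pos w \<in> X" using W[of w Pos] by auto
  have a: "path_ext C m V W (d Pos) (d Pos w) ws \<in> cells C (Suc m) \<and> bd C Neg m (path_ext C m V W (d Pos) (d Pos w) ws) = V (d Pos w)"
    using path_ext_typing[where X=X and E=E and d=d and V=V and W=W and x="d Pos w" and ws=ws, OF m V W] Cons.prems w by simp
  show ?case using Cons w K[OF w(1,2)] oc[OF w(1,2)] a by simp
qed

end

definition morph_ext where
  "morph_ext n G T k u = (if k < n then G k u else T u)"

locale ext3 = D: precategory n D for n and D :: "'d precat" +
  fixes P :: "('a0, 'a1, 'a2, 'a3, 'z) prepolygraph3_scheme"
    and G :: "nat \<Rightarrow> ('a0, 'a1, 'a2, 'a3) cell \<Rightarrow> 'd" and g :: "'a3 \<Rightarrow> 'd"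
  assumes n3: "3 \<le> n" and P: "prepolygraph3 P" and G: "precat_morphism 2 (free_precat P) D G"
    and g: "\<And>A e. A \<in> gens3 P \<Longrightarrow> g A \<in> cells D 3 \<and> bd D e 2 (g A) = G 2 (Cell2 (d2 P e A))"
begin

abbreviation "G0 x \<equiv> G 0 (Cell0 x)"
abbreviation "G1 x \<equiv> G (Suc 0) (Cell1 x)"
abbreviation "G2 x \<equiv> G 2 (Cell2 x)"

lemma n12: "2 \<le> n" "Suc 0 \<le> n" "1 \<le> n" using n3 by auto

lemma Gc: "x \<in> gens0 P \<Longrightarrow> G0 x \<in> cells D 0" "f \<in> cells1 P \<Longrightarrow> G1 f \<in> cells D (Suc 0)" "\<phi> \<in> cells2 P \<Longrightarrow> G2 \<phi> \<in> cells D 2"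
  using G unfolding precat_morphism_def by (force simp: free_precat_sel[OF P])+

lemma Gb: "f \<in> cells1 P \<Longrightarrow> bd D e 0 (G1 f) = G0 (bd0 P e f)" "\<phi> \<in> cells2 P \<Longrightarrow> bd D e (Suc 0) (G2 \<phi>) = G1 (bd1 P e \<phi>)"
proof -
  have *: "\<And>i u e. i < 2 \<Longrightarrow> u \<in> cells (free_precat P) (Suc i) \<Longrightarrow> G i (bd (free_precat P) e i u) = bd D e i (G (Suc i) u)"
    using G unfolding precat_morphism_def by blast
  show "f \<in> cells1 P \<Longrightarrow> bd D e 0 (G1 f) = G0 (bd0 P e f)"
    using *[of 0 "Cell1 f" e] by (auto simp: free_precat_sel[OF P])
  show "\<phi> \<in> cells2 P \<Longrightarrow> bd D e (Suc 0) (G2 \<phi>) = G1 (bd1 P e \<phi>)"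
    using *[of "Suc 0" "Cell2 \<phi>" e] by (auto simp: free_precat_sel[OF P] numeral_2_eq_2)
qed

lemma Gi: "x \<in> gens0 P \<Longrightarrow> G1 (id_path x) = idn D 0 (G0 x)" "f \<in> cells1 P \<Longrightarrow> G2 (id_path f) = idn D (Suc 0) (G1 f)"
proof -
  have *: "\<And>i u. i < 2 \<Longrightarrow> u \<in> cells (free_precat P) i \<Longrightarrow> G (Suc i) (idn (free_precat P) i u) = idn D i (G i u)"
    using G unfolding precat_morphism_def by blast
  show "x \<in> gens0 P \<Longrightarrow> G1 (id_path x) = idn D 0 (G0 x)"
    using *[of 0 "Cell0 x"] by (auto simp: free_precat_sel[OF P])
  show "f \<in> cells1 P \<Longrightarrow> G2 (id_path f) = idn D (Suc 0) (G1 f)"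
    using *[of "Suc 0" "Cell1 f"] by (auto simp: free_precat_sel[OF P] numeral_2_eq_2)
qed

lemma Gm:
  "\<lbrakk>f \<in> cells1 P; h \<in> cells1 P; bd0 P Pos f = bd0 P Neg h\<rbrakk> \<Longrightarrow> G1 (f \<odot> h) = cmp D (Suc 0) (Suc 0) (G1 f) (G1 h)"
  "\<lbrakk>f \<in> cells1 P; \<phi> \<in> cells2 P; bd0 P Pos f = bd0 P Neg (bd1 P Neg \<phi>)\<rbrakk> \<Longrightarrow> G2 (f \<rhd> \<phi>) = cmp D (Suc 0) 2 (G1 f) (G2 \<phi>)"
  "\<lbrakk>f \<in> cells1 P; \<phi> \<in> cells2 P; bd0 P Pos (bd1 P Neg \<phi>) = bd0 P Neg f\<rbrakk> \<Longrightarrow> G2 (\<phi> \<lhd> f) = cmp D 2 (Suc 0) (G2 \<phi>) (G1 f)"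
  "\<lbrakk>\<psi> \<in> cells2 P; \<phi> \<in> cells2 P; bd1 P Pos \<psi> = (bd1 P Neg \<phi>)\<rbrakk> \<Longrightarrow> G2 (\<psi> \<odot> \<phi>) = cmp D 2 2 (G2 \<psi>) (G2 \<phi>)"
proof -
  have *: "\<And>k l u v. k \<le> 2 \<Longrightarrow> l \<le> 2 \<Longrightarrow> composable (free_precat P) k l u v \<Longrightarrow> G (max k l) (cmp (free_precat P) k l u v) = cmp D k l (G k u) (G l v)"
    using G unfolding precat_morphism_def by blast
  show "\<lbrakk>f \<in> cells1 P; h \<in> cells1 P; bd0 P Pos f = bd0 P Neg h\<rbrakk> \<Longrightarrow> G1 (f \<odot> h) = cmp D (Suc 0) (Suc 0) (G1 f) (G1 h)"
    using *[of "Suc 0" "Suc 0" "Cell1 f" "Cell1 h"] by (simp add: free_precat_sel[OF P] free_composable[OF P] flip: numeral_2_eq_2)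
  show "\<lbrakk>f \<in> cells1 P; \<phi> \<in> cells2 P; bd0 P Pos f = bd0 P Neg (bd1 P Neg \<phi>)\<rbrakk> \<Longrightarrow> G2 (f \<rhd> \<phi>) = cmp D (Suc 0) 2 (G1 f) (G2 \<phi>)"
    using *[of "Suc 0" 2 "Cell1 f" "Cell2 \<phi>"] by (simp add: free_precat_sel[OF P] free_composable[OF P] flip: numeral_2_eq_2)
  show "\<lbrakk>f \<in> cells1 P; \<phi> \<in> cells2 P; bd0 P Pos (bd1 P Neg \<phi>) = bd0 P Neg f\<rbrakk> \<Longrightarrow> G2 (\<phi> \<lhd> f) = cmp D 2 (Suc 0) (G2 \<phi>) (G1 f)"
    using *[of 2 "Suc 0" "Cell2 \<phi>" "Cell1 f"] by (simp add: free_precat_sel[OF P] free_composable[OF P] flip: numeral_2_eq_2)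
  show "\<lbrakk>\<psi> \<in> cells2 P; \<phi> \<in> cells2 P; bd1 P Pos \<psi> = (bd1 P Neg \<phi>)\<rbrakk> \<Longrightarrow> G2 (\<psi> \<odot> \<phi>) = cmp D 2 2 (G2 \<psi>) (G2 \<phi>)"
    using *[of 2 2 "Cell2 \<psi>" "Cell2 \<phi>"] by (simp add: free_precat_sel[OF P] free_composable[OF P] flip: numeral_2_eq_2)
qed

primrec W where
  "W (Step k l A r m) = cmp D 3 2 (cmp D 2 3 (G2 k) (cmp D 3 (Suc 0) (cmp D (Suc 0) 3 (G1 l) (g A)) (G1 r))) (G2 m)"

lemma sandwich_facts:
  assumes "A \<in> gens3 P" "sandwich P k l (d2 P Neg A) r m"
  shows "k \<in> cells2 P" "m \<in> cells2 P" "l \<in> cells1 P" "r \<in> cells1 P" "\<And>e. d2 P e A \<in> cells2 P"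
   "bd0 P Pos l = bd0 P Neg (bd1 P Neg (d2 P Neg A))" "bd0 P Pos (bd1 P Neg (d2 P Neg A)) = bd0 P Neg r"
   "bd1 P Pos k = bd1 P Neg (l \<rhd> d2 P Neg A \<lhd> r)"
   "bd1 P Neg m = bd1 P Pos (l \<rhd> d2 P Neg A \<lhd> r)"
   "bd1 P Pos k = l \<odot> bd1 P Neg (d2 P Neg A) \<odot> r"
   "bd1 P Neg m = l \<odot> bd1 P Pos (d2 P Neg A) \<odot> r"
   "\<And>e'. bd1 P e' (d2 P Pos A) = bd1 P e' (d2 P Neg A)"
   "\<And>e. l \<rhd> d2 P e A \<in> cells2 P" "\<And>e. l \<rhd> d2 P e A \<lhd> r \<in> cells2 P"
   "\<And>e e'. bd1 P e' (l \<rhd> d2 P e A) = l \<odot> bd1 P e' (d2 P Neg A)"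
   "\<And>e e'. bd1 P e' (l \<rhd> d2 P e A \<lhd> r) = l \<odot> bd1 P e' (d2 P Neg A) \<odot> r"
proof -
  show a: "\<And>e. d2 P e A \<in> cells2 P" and b: "\<And>e'. bd1 P e' (d2 P Pos A) = bd1 P e' (d2 P Neg A)"
    using gen3_bd(1)[OF P assms(1)] gen3_bd(2)[OF P assms(1), of _ Pos] by blast+
  have b': "bd1 P e' (d2 P e A) = bd1 P e' (d2 P Neg A)" for e e' using b by (cases e) auto
  have c: "between P l (bd1 P Neg (d2 P e A)) r" for e using assms(2) unfolding b'[of Neg e] by (simp add: sandwich_def)
  have c1: "l \<in> cells1 P" "bd0 P Pos l = bd0 P Neg (bd1 P Neg (d2 P e A))" for e using c[of e] by (auto simp: between_def)
  show "l \<rhd> d2 P e A \<in> cells2 P" for e by (rule lwhisk2_in(1)[OF P c1(1) a c1(2)])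
  show "l \<rhd> d2 P e A \<lhd> r \<in> cells2 P" for e by (rule whisk2_in(1)[OF P c a])
  show "bd1 P e' (l \<rhd> d2 P e A) = l \<odot> bd1 P e' (d2 P Neg A)" for e e'
    using lwhisk2_in(2)[OF P c1(1) a c1(2), of e' e] by (simp only: b'[of e' e])
  show d: "bd1 P e' (l \<rhd> d2 P e A \<lhd> r) = l \<odot> bd1 P e' (d2 P Neg A) \<odot> r" for e e'
    using whisk2_in(2)[OF P c a, of e' e] by (simp only: b'[of e' e])
  show "k \<in> cells2 P" "m \<in> cells2 P" "l \<in> cells1 P" "r \<in> cells1 P"
   "bd0 P Pos l = bd0 P Neg (bd1 P Neg (d2 P Neg A))" "bd0 P Pos (bd1 P Neg (d2 P Neg A)) = bd0 P Neg r"
   "bd1 P Pos k = bd1 P Neg (l \<rhd> d2 P Neg A \<lhd> r)"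
   "bd1 P Neg m = bd1 P Pos (l \<rhd> d2 P Neg A \<lhd> r)"
   "bd1 P Pos k = l \<odot> bd1 P Neg (d2 P Neg A) \<odot> r"
   "bd1 P Neg m = l \<odot> bd1 P Pos (d2 P Neg A) \<odot> r"
    using assms(2) d by (simp_all add: sandwich_def between_def)
qed

lemma W_parts:
  assumes "A \<in> gens3 P" "sandwich P k l (d2 P Neg A) r m"
  defines "a \<equiv> cmp D (Suc 0) 3 (G1 l) (g A)"
  defines "b \<equiv> cmp D 3 (Suc 0) a (G1 r)"
  defines "c \<equiv> cmp D 2 3 (G2 k) b"
  shows "g A \<in> cells D 3" "\<And>e. bd D e 2 (g A) = G2 (d2 P e A)" 
    "a \<in> cells D 3" "\<And>e. bd D e 2 a = G2 (l \<rhd> d2 P e A)"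
    "b \<in> cells D 3" "\<And>e. bd D e 2 b = G2 (l \<rhd> d2 P e A \<lhd> r)"
    "c \<in> cells D 3" "\<And>e. bd D e 2 c = G2 (k \<odot> (l \<rhd> d2 P e A \<lhd> r))"
    "W (Step k l A r m) = cmp D 3 2 c (G2 m)"
    "W (Step k l A r m) \<in> cells D 3" "\<And>e. bd D e 2 (W (Step k l A r m)) = G2 (step_bd P e (Step k l A r m))"
proof -
  note f = sandwich_facts[OF assms(1,2)]
  show gA: "g A \<in> cells D 3" "\<And>e. bd D e 2 (g A) = G2 (d2 P e A)" using g assms by auto
  have Gl: "cmp D (Suc 0) 2 (G1 l) (G2 (d2 P e A)) = G2 (l \<rhd> d2 P e A)" for e
    by (rule Gm(2)[symmetric]) (use f(3,5,6,12) in \<open>cases e; simp\<close>)+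
  have Gr: "cmp D 2 (Suc 0) (G2 (l \<rhd> d2 P e A)) (G1 r) = G2 (l \<rhd> d2 P e A \<lhd> r)" for e
    by (rule Gm(3)[symmetric]) (use f in \<open>simp_all add: bd0_pcomp[OF P]\<close>)
  have Gk: "cmp D 2 2 (G2 k) (G2 (l \<rhd> d2 P e A \<lhd> r)) = G2 (k \<odot> (l \<rhd> d2 P e A \<lhd> r))" for e
    by (rule Gm(4)[symmetric]) (use f in \<open>simp_all add: bd0_pcomp[OF P]\<close>)
  have Gmm: "cmp D 2 2 (G2 (k \<odot> (l \<rhd> d2 P e A \<lhd> r))) (G2 m) = G2 ((k \<odot> (l \<rhd> d2 P e A \<lhd> r)) \<odot> m)" for e
    by (rule Gm(4)[symmetric]) (use f in \<open>simp_all add: bd1_pcomp[OF P] cells2_pcomp[OF P]\<close>)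
  show a: "a \<in> cells D 3" "\<And>e. bd D e 2 a = G2 (l \<rhd> d2 P e A)"
    unfolding a_def using gA f D.cmp_in(5)[of "G1 l" "g A"] D.bd_cmp(7)[of "G1 l" "g A"] n3 n12 
    by (auto simp: D.composable_iff Gc Gb Gl bd1_in[OF P])
  show b: "b \<in> cells D 3" "\<And>e. bd D e 2 b = G2 (l \<rhd> d2 P e A \<lhd> r)"
    unfolding b_def using a f D.cmp_in(6)[of a "G1 r"] D.bd_cmp(8)[of a "G1 r"] n3 n12 
    by (auto simp: D.composable_iff Gc Gb Gr bd0_pcomp[OF P] bd1_in[OF P] cells1_pcomp[OF P])
  show c: "c \<in> cells D 3" "\<And>e. bd D e 2 c = G2 (k \<odot> (l \<rhd> d2 P e A \<lhd> r))"
    unfolding c_def using b f D.cmp_in(7)[of "G2 k" b] D.bd_cmp(9)[of "G2 k" b] n3 n12 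
    by (auto simp: D.composable_iff Gc Gb Gk bd1_in[OF P])
  have "cmp D 3 2 c (G2 m) \<in> cells D 3" "\<And>e. bd D e 2 (cmp D 3 2 c (G2 m)) = G2 ((k \<odot> (l \<rhd> d2 P e A \<lhd> r)) \<odot> m)"
    using c f D.cmp_in(8)[of c "G2 m"] D.bd_cmp(10)[of c "G2 m"] n3 n12 
    by (auto simp: D.composable_iff Gc Gb Gmm bd1_pcomp[OF P] cells2_pcomp[OF P] bd1_in[OF P])
  then show "W (Step k l A r m) = cmp D 3 2 c (G2 m)"
    "W (Step k l A r m) \<in> cells D 3" "\<And>e. bd D e 2 (W (Step k l A r m)) = G2 (step_bd P e (Step k l A r m))"
     unfolding a_def b_def c_def by (simp_all add: pcomp_assoc)
qed

lemma W_typ: "s \<in> steps P \<Longrightarrow> W s \<in> cells D 3 \<and> bd D e 2 (W s) = G2 (step_bd P e s)"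
  using W_parts(10,11) unfolding steps_def by blast

abbreviation "E x ws \<equiv> path_ext D 2 (\<lambda>x. G2 x) W (step_bd P Pos) x ws"
definition "H = morph_ext 3 G (\<lambda>u. case u of Cell3 F \<Rightarrow> E (psrc F) (edges F))"

lemma n2: "Suc 2 \<le> n" using n3 by simp

lemmas E_typ = D.path_ext_typing[OF n2, where X="cells2 P" and E="steps P" and d="step_bd P" and V="\<lambda>x. G2 x" and W=W, simplified]
lemmas E_append = D.path_ext_append[OF n2, where X="cells2 P" and E="steps P" and d="step_bd P" and V="\<lambda>x. G2 x" and W=W, simplified]
lemmas E_op = D.path_ext_whisker[OF n2, where X="cells2 P" and E="steps P" and d="step_bd P" and d'="step_bd P" and V="\<lambda>x. G2 x" and W=W, simplified]

lemma E_in: "F \<in> cells3 P \<Longrightarrow> E (psrc F) (edges F) \<in> cells D 3 \<and> bd D e 2 (E (psrc F) (edges F)) = G2 (bd2 P e F)"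
  using E_typ[of "psrc F" "edges F"] W_typ Gc step_bd_in[OF P] 
  by (cases e) (auto simp: cells3_def paths_def path_bd.simps)

lemma E_pcomp: "\<lbrakk>F \<in> cells3 P; F' \<in> cells3 P; bd2 P Pos F = bd2 P Neg F'\<rbrakk> \<Longrightarrow>
  E (psrc (F \<odot> F')) (edges (F \<odot> F')) = cmp D 3 3 (E (psrc F) (edges F)) (E (psrc F') (edges F'))"
  using E_append[of "psrc F" "edges F" "edges F'"] W_typ Gc step_bd_in[OF P]
  by (auto simp: cells3_def paths_def path_bd.simps)

lemma W_l0:
  assumes "s \<in> steps P" "f \<in> cells1 P" "bd0 P Pos f = bd0 P Neg (bd1 P Neg (step_bd P Neg s))"
  shows "W (lstep0 f s) = cmp D (Suc 0) 3 (G1 f) (W s)"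
proof -
  obtain k l A r m where s: "s = Step k l A r m" "A \<in> gens3 P" "sandwich P k l (d2 P Neg A) r m"
    using assms by (auto simp: steps_def)
  note sf = sandwich_facts[OF s(2,3)]
  have q1: "bd0 P Pos f = bd0 P Neg (bd1 P Neg k)" using assms(3) sandwich_in(2)[OF P s(3)] by (simp add: s(1))
  have q2: "bd0 P Pos f = bd0 P Neg l" using q1 glob2[OF P sf(1), of Neg] sf by (simp add: bd0_pcomp[OF P])
  have q3: "bd0 P Pos f = bd0 P Neg (bd1 P Neg m)" using q2 sf sf(12)[of Neg] glob2[OF P sf(5)[of Neg]] by (simp add: bd0_pcomp[OF P])
  note w = W_parts[OF s(2,3)]
  let ?a = "cmp D (Suc 0) 3 (G1 l) (g A)" let ?b = "cmp D 3 (Suc 0) ?a (G1 r)" let ?c = "cmp D 2 3 (G2 k) ?b"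
  note simps = Gc Gb bd1_in[OF P] bd0_pcomp[OF P] bd1_pcomp[OF P] cells1_pcomp[OF P] cells2_pcomp[OF P]
  have "cmp D (Suc 0) 3 (G1 f) (W s) = cmp D 3 2 (cmp D (Suc 0) 3 (G1 f) ?c) (cmp D (Suc 0) 2 (G1 f) (G2 m))"
    unfolding s(1) w(9) by (rule D.cmp_distribs(9)) (use w sf assms(2) n3 q1 q2 q3 in \<open>simp_all add: simps\<close>)
  also have "cmp D (Suc 0) 3 (G1 f) ?c = cmp D 2 3 (cmp D (Suc 0) 2 (G1 f) (G2 k)) (cmp D (Suc 0) 3 (G1 f) ?b)"
    by (rule D.cmp_distribs(7)) (use w sf assms(2) n3 q1 q2 q3 in \<open>simp_all add: simps\<close>)
  also have "cmp D (Suc 0) 3 (G1 f) ?b = cmp D 3 (Suc 0) (cmp D (Suc 0) 3 (G1 f) ?a) (G1 r)"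
    by (rule D.cmp_assoc3(2)[symmetric]) (use w sf assms(2) n3 q1 q2 q3 in \<open>simp_all add: simps\<close>)
  also have "cmp D (Suc 0) 3 (G1 f) ?a = cmp D (Suc 0) 3 (cmp D (Suc 0) (Suc 0) (G1 f) (G1 l)) (g A)"
    by (rule D.cmp_assoc3(1)[symmetric]) (use w sf assms(2) n3 q1 q2 q3 in \<open>simp_all add: simps\<close>)
  finally show ?thesis using sf assms(2) q1 q2 q3 by (simp add: s(1) Gm)
qed

lemma W_r0:
  assumes "s \<in> steps P" "f \<in> cells1 P" "bd0 P Pos (bd1 P Neg (step_bd P Neg s)) = bd0 P Neg f"
  shows "W (rstep0 s f) = cmp D 3 (Suc 0) (W s) (G1 f)"
proof -
  obtain k l A r m where s: "s = Step k l A r m" "A \<in> gens3 P" "sandwich P k l (d2 P Neg A) r m"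
    using assms by (auto simp: steps_def)
  note sf = sandwich_facts[OF s(2,3)]
  have q1: "bd0 P Pos (bd1 P Neg k) = bd0 P Neg f" using assms(3) sandwich_in(2)[OF P s(3)] by (simp add: s(1))
  have q2: "bd0 P Pos r = bd0 P Neg f" using q1 glob2[OF P sf(1), of Pos] sf by (simp add: bd0_pcomp[OF P])
  have q3: "bd0 P Pos (bd1 P Neg m) = bd0 P Neg f" using q2 sf sf(12)[of Neg] glob2[OF P sf(5)[of Neg]] by (simp add: bd0_pcomp[OF P])
  note w = W_parts[OF s(2,3)]
  let ?a = "cmp D (Suc 0) 3 (G1 l) (g A)" let ?b = "cmp D 3 (Suc 0) ?a (G1 r)" let ?c = "cmp D 2 3 (G2 k) ?b"
  note simps = Gc Gb bd1_in[OF P] bd0_pcomp[OF P] bd1_pcomp[OF P] cells1_pcomp[OF P] cells2_pcomp[OF P]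
  have "cmp D 3 (Suc 0) (W s) (G1 f) = cmp D 3 2 (cmp D 3 (Suc 0) ?c (G1 f)) (cmp D 2 (Suc 0) (G2 m) (G1 f))"
    unfolding s(1) w(9) by (rule D.cmp_distribs(10)) (use w sf assms(2) n3 q1 q2 q3 in \<open>simp_all add: simps\<close>)
  also have "cmp D 3 (Suc 0) ?c (G1 f) = cmp D 2 3 (cmp D 2 (Suc 0) (G2 k) (G1 f)) (cmp D 3 (Suc 0) ?b (G1 f))"
    by (rule D.cmp_distribs(8)) (use w sf assms(2) n3 q1 q2 q3 in \<open>simp_all add: simps\<close>)
  also have "cmp D 3 (Suc 0) ?b (G1 f) = cmp D 3 (Suc 0) ?a (cmp D (Suc 0) (Suc 0) (G1 r) (G1 f))"
    by (rule D.cmp_assoc3(3)) (use w sf assms(2) n3 q1 q2 q3 in \<open>simp_all add: simps\<close>)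
  finally show ?thesis using sf assms(2) q1 q2 q3 by (simp add: s(1) Gm)
qed

lemma W_l1:
  assumes "s \<in> steps P" "f \<in> cells2 P" "bd1 P Pos f = (bd1 P Neg (step_bd P Neg s))"
  shows "W (lstep1 f s) = cmp D 2 3 (G2 f) (W s)"
proof -
  obtain k l A r m where s: "s = Step k l A r m" "A \<in> gens3 P" "sandwich P k l (d2 P Neg A) r m"
    using assms by (auto simp: steps_def)
  note sf = sandwich_facts[OF s(2,3)]
  have q1: "bd1 P Pos f = (bd1 P Neg k)" using assms(3) sandwich_in(2)[OF P s(3)] by (simp add: s(1))
  note w = W_parts[OF s(2,3)]
  let ?a = "cmp D (Suc 0) 3 (G1 l) (g A)" let ?b = "cmp D 3 (Suc 0) ?a (G1 r)" let ?c = "cmp D 2 3 (G2 k) ?b"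
  note simps = Gc Gb bd1_in[OF P] bd0_pcomp[OF P] bd1_pcomp[OF P] cells1_pcomp[OF P] cells2_pcomp[OF P]
  have "cmp D 2 3 (G2 f) (W s) = cmp D 3 2 (cmp D 2 3 (G2 f) ?c) (G2 m)"
    unfolding s(1) w(9) by (rule D.cmp_assoc3(6)[symmetric]) (use w sf assms(2) n3 q1 in \<open>simp_all add: simps\<close>)
  also have "cmp D 2 3 (G2 f) ?c = cmp D 2 3 (cmp D 2 2 (G2 f) (G2 k)) ?b"
    by (rule D.cmp_assoc3(5)[symmetric]) (use w sf assms(2) n3 q1 in \<open>simp_all add: simps\<close>)
  finally show ?thesis using sf assms(2) q1 by (simp add: s(1) Gm)
qed

lemma W_r1:
  assumes "s \<in> steps P" "f \<in> cells2 P" "bd1 P Pos (step_bd P Neg s) = bd1 P Neg f"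
  shows "W (rstep1 s f) = cmp D 3 2 (W s) (G2 f)"
proof -
  obtain k l A r m where s: "s = Step k l A r m" "A \<in> gens3 P" "sandwich P k l (d2 P Neg A) r m"
    using assms by (auto simp: steps_def)
  note sf = sandwich_facts[OF s(2,3)]
  have q1: "bd1 P Pos m = (bd1 P Neg f)" using assms(3) sandwich_in(3)[OF P s(3)] by (simp add: s(1))
  note w = W_parts[OF s(2,3)]
  let ?a = "cmp D (Suc 0) 3 (G1 l) (g A)" let ?b = "cmp D 3 (Suc 0) ?a (G1 r)" let ?c = "cmp D 2 3 (G2 k) ?b"
  note simps = Gc Gb bd1_in[OF P] bd0_pcomp[OF P] bd1_pcomp[OF P] cells1_pcomp[OF P] cells2_pcomp[OF P]
  have "cmp D 3 2 (W s) (G2 f) = cmp D 3 2 ?c (cmp D 2 2 (G2 m) (G2 f))"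
    unfolding s(1) w(9) by (rule D.cmp_assoc3(7)) (use w sf assms(2) n3 q1 in \<open>simp_all add: simps\<close>)
  then show ?thesis using sf assms(2) q1 by (simp add: s(1) Gm)
qed

lemma E_W: 
  assumes "F \<in> cells3 P"
  shows "\<lbrakk>f \<in> cells1 P; bd0 P Pos f = bd0 P Neg (bd1 P Neg (bd2 P Neg F))\<rbrakk> \<Longrightarrow>
     E (psrc (f \<rhd>\<^sub>0 F)) (edges (f \<rhd>\<^sub>0 F)) = cmp D (Suc 0) 3 (G1 f) (E (psrc F) (edges F))"
   "\<lbrakk>f \<in> cells1 P; bd0 P Pos (bd1 P Neg (bd2 P Neg F)) = bd0 P Neg f\<rbrakk> \<Longrightarrow>
     E (psrc (F \<lhd>\<^sub>0 f)) (edges (F \<lhd>\<^sub>0 f)) = cmp D 3 (Suc 0) (E (psrc F) (edges F)) (G1 f)"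
   "\<lbrakk>\<chi> \<in> cells2 P; bd1 P Pos \<chi> = (bd1 P Neg (bd2 P Neg F))\<rbrakk> \<Longrightarrow>
     E (psrc (\<chi> \<rhd>\<^sub>1 F)) (edges (\<chi> \<rhd>\<^sub>1 F)) = cmp D 2 3 (G2 \<chi>) (E (psrc F) (edges F))"
   "\<lbrakk>\<chi> \<in> cells2 P; bd1 P Pos (bd2 P Neg F) = bd1 P Neg \<chi>\<rbrakk> \<Longrightarrow>
     E (psrc (F \<lhd>\<^sub>1 \<chi>)) (edges (F \<lhd>\<^sub>1 \<chi>)) = cmp D 3 2 (E (psrc F) (edges F)) (G2 \<chi>)"
proof -
  have F: "psrc F \<in> cells2 P" "set (edges F) \<subseteq> steps P" "chain (step_bd P) (psrc F) (edges F)" "psrc F = bd2 P Neg F"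
    using assms by (auto simp: cells3_def paths_def path_bd.simps)
  have nn: "3 \<le> n" "2 \<le> n" "Suc 0 \<le> n" using n3 by auto
  note base = W_typ step_bd_in[OF P] Gc
  have sg: "bd0 P e (bd1 P Neg (step_bd P Pos w)) = bd0 P e (bd1 P Neg (step_bd P Neg w))" if "w \<in> steps P" for w e
    using step_glob0[OF P that] by simp
  have sg1: "bd1 P e (step_bd P Pos w) = bd1 P e (step_bd P Neg w)" if "w \<in> steps P" for w e
    using step_glob[OF P that] by simp
  note simps = Gc Gb bd1_in[OF P] bd2_in[OF P] bd0_pcomp[OF P] bd1_pcomp[OF P] cells1_pcomp[OF P] cells2_pcomp[OF P] 
     step_bd_in[OF P] sg sg1 W_typ
  { assume f: "f \<in> cells1 P" "bd0 P Pos f = bd0 P Neg (bd1 P Neg (bd2 P Neg F))"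
    have "E (f \<rhd> psrc F) (map (lstep0 f) (edges F)) = cmp D (Suc 0) 3 (G1 f) (E (psrc F) (edges F))"
    proof (rule E_op[where K="\<lambda>x. bd0 P Pos f = bd0 P Neg (bd1 P Neg x)" and g="lstep0 f"])
      fix x assume "x \<in> cells2 P" "bd0 P Pos f = bd0 P Neg (bd1 P Neg x)"
      then show "cmp D (Suc 0) 3 (G1 f) (idn D 2 (G2 x)) = idn D 2 (G2 (f \<rhd> x))"
        using f nn D.idn_cmp_left[of 0 2 "G1 f" "G2 x"] by (simp add: D.composable_iff simps Gm)
    next
      fix w u assume w: "w \<in> steps P" "bd0 P Pos f = bd0 P Neg (bd1 P Neg (step_bd P Neg w))" "u \<in> cells D 3" "bd D Neg 2 u = G2 (step_bd P Pos w)"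
      show "cmp D (Suc 0) 3 (G1 f) (cmp D 3 3 (W w) u) = cmp D 3 3 (cmp D (Suc 0) 3 (G1 f) (W w)) (cmp D (Suc 0) 3 (G1 f) u)"
        by (rule D.cmp_distribs(3)) (use w f nn in \<open>simp_all add: simps\<close>)
    qed (use F f lstep0_in[OF P] in \<open>auto simp: simps W_l0\<close>)
    then show "E (psrc (f \<rhd>\<^sub>0 F)) (edges (f \<rhd>\<^sub>0 F)) = cmp D (Suc 0) 3 (G1 f) (E (psrc F) (edges F))"
      by (simp add: lwhisk30_def) }
  { assume f: "f \<in> cells1 P" "bd0 P Pos (bd1 P Neg (bd2 P Neg F)) = bd0 P Neg f"
    have "E (psrc F \<lhd> f) (map (\<lambda>s. rstep0 s f) (edges F)) = cmp D 3 (Suc 0) (E (psrc F) (edges F)) (G1 f)"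
    proof (rule E_op[where K="\<lambda>x. bd0 P Pos (bd1 P Neg x) = bd0 P Neg f" and g="\<lambda>s. rstep0 s f"])
      fix x assume "x \<in> cells2 P" "bd0 P Pos (bd1 P Neg x) = bd0 P Neg f"
      then show "cmp D 3 (Suc 0) (idn D 2 (G2 x)) (G1 f) = idn D 2 (G2 (x \<lhd> f))"
        using f nn D.idn_cmp_right[of 0 2 "G2 x" "G1 f"] by (simp add: D.composable_iff simps Gm)
    next
      fix w u assume w: "w \<in> steps P" "bd0 P Pos (bd1 P Neg (step_bd P Neg w)) = bd0 P Neg f" "u \<in> cells D 3" "bd D Neg 2 u = G2 (step_bd P Pos w)"
      show "cmp D 3 (Suc 0) (cmp D 3 3 (W w) u) (G1 f) = cmp D 3 3 (cmp D 3 (Suc 0) (W w) (G1 f)) (cmp D 3 (Suc 0) u (G1 f))"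
        by (rule D.cmp_distribs(4)) (use w f nn in \<open>simp_all add: simps\<close>)
    qed (use F f rstep0_in[OF P] in \<open>auto simp: simps W_r0\<close>)
    then show "E (psrc (F \<lhd>\<^sub>0 f)) (edges (F \<lhd>\<^sub>0 f)) = cmp D 3 (Suc 0) (E (psrc F) (edges F)) (G1 f)"
      by (simp add: rwhisk30_def) }
  { assume f: "\<chi> \<in> cells2 P" "bd1 P Pos \<chi> = (bd1 P Neg (bd2 P Neg F))"
    have "E (\<chi> \<odot> psrc F) (map (lstep1 \<chi>) (edges F)) = cmp D 2 3 (G2 \<chi>) (E (psrc F) (edges F))"
    proof (rule E_op[where K="\<lambda>x. bd1 P Pos \<chi> = (bd1 P Neg x)" and g="lstep1 \<chi>"])
      fix x assume "x \<in> cells2 P" "bd1 P Pos \<chi> = (bd1 P Neg x)"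
      then show "cmp D 2 3 (G2 \<chi>) (idn D 2 (G2 x)) = idn D 2 (G2 (\<chi> \<odot> x))"
        using f nn D.idn_cmp_left[of 1 2 "G2 \<chi>" "G2 x"] by (simp add: D.composable_iff simps Gm flip: numeral_2_eq_2)
    next
      fix w u assume w: "w \<in> steps P" "bd1 P Pos \<chi> = (bd1 P Neg (step_bd P Neg w))" "u \<in> cells D 3" "bd D Neg 2 u = G2 (step_bd P Pos w)"
      show "cmp D 2 3 (G2 \<chi>) (cmp D 3 3 (W w) u) = cmp D 3 3 (cmp D 2 3 (G2 \<chi>) (W w)) (cmp D 2 3 (G2 \<chi>) u)"
        by (rule D.cmp_distribs(5)) (use w f nn in \<open>simp_all add: simps\<close>)
    qed (use F f lstep1_in[OF P] in \<open>auto simp: simps W_l1\<close>)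
    then show "E (psrc (\<chi> \<rhd>\<^sub>1 F)) (edges (\<chi> \<rhd>\<^sub>1 F)) = cmp D 2 3 (G2 \<chi>) (E (psrc F) (edges F))"
      by (simp add: lwhisk31_def) }
  { assume f: "\<chi> \<in> cells2 P" "bd1 P Pos (bd2 P Neg F) = bd1 P Neg \<chi>"
    have "E (psrc F \<odot> \<chi>) (map (\<lambda>s. rstep1 s \<chi>) (edges F)) = cmp D 3 2 (E (psrc F) (edges F)) (G2 \<chi>)"
    proof (rule E_op[where K="\<lambda>x. bd1 P Pos x = bd1 P Neg \<chi>" and g="\<lambda>s. rstep1 s \<chi>"])
      fix x assume "x \<in> cells2 P" "bd1 P Pos x = bd1 P Neg \<chi>"
      then show "cmp D 3 2 (idn D 2 (G2 x)) (G2 \<chi>) = idn D 2 (G2 (x \<odot> \<chi>))"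
        using f nn D.idn_cmp_right[of 1 2 "G2 x" "G2 \<chi>"] by (simp add: D.composable_iff simps Gm flip: numeral_2_eq_2)
    next
      fix w u assume w: "w \<in> steps P" "bd1 P Pos (step_bd P Neg w) = bd1 P Neg \<chi>" "u \<in> cells D 3" "bd D Neg 2 u = G2 (step_bd P Pos w)"
      show "cmp D 3 2 (cmp D 3 3 (W w) u) (G2 \<chi>) = cmp D 3 3 (cmp D 3 2 (W w) (G2 \<chi>)) (cmp D 3 2 u (G2 \<chi>))"
        by (rule D.cmp_distribs(6)) (use w f nn in \<open>simp_all add: simps\<close>)
    qed (use F f rstep1_in[OF P] in \<open>auto simp: simps W_r1\<close>)
    then show "E (psrc (F \<lhd>\<^sub>1 \<chi>)) (edges (F \<lhd>\<^sub>1 \<chi>)) = cmp D 3 2 (E (psrc F) (edges F)) (G2 \<chi>)"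
      by (simp add: rwhisk31_def) }
qed

end

lemma gen3_in:
  assumes "prepolygraph3 P" "A \<in> gens3 P"
  shows "gen3 P A \<in> cells3 P" "bd2 P e (gen3 P A) = d2 P e A"
   "step_bd P e (Step (id_path (bd1 P Neg (d2 P Neg A))) (id_path (bd0 P Neg (bd1 P Neg (d2 P Neg A)))) A
       (id_path (bd0 P Pos (bd1 P Neg (d2 P Neg A)))) (id_path (bd1 P Pos (d2 P Neg A)))) = d2 P e A"
   "sandwich P (id_path (bd1 P Neg (d2 P Neg A))) (id_path (bd0 P Neg (bd1 P Neg (d2 P Neg A)))) (d2 P Neg A)
       (id_path (bd0 P Pos (bd1 P Neg (d2 P Neg A)))) (id_path (bd1 P Pos (d2 P Neg A)))"
proof -
  note P = assms(1)
  let ?f = "bd1 P Neg (d2 P Neg A)" let ?f' = "bd1 P Pos (d2 P Neg A)"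
  note a = gen3_bd(1)[OF P assms(2)]
  have b: "bd1 P e' (d2 P Pos A) = bd1 P e' (d2 P Neg A)" for e' by (rule gen3_bd(2)[OF P assms(2)])
  have b': "bd1 P e' (d2 P e A) = bd1 P e' (d2 P Neg A)" for e e' using b by (cases e) auto
  have w: "id_path (bd0 P Neg ?f) \<rhd> d2 P e A \<lhd> id_path (bd0 P Pos ?f) = d2 P e A" for e
    using l2_id[OF P a[of e]] r2_id[OF P a[of e]] unfolding b'[of Neg e] by simp
  have c: "?f \<in> cells1 P" "?f' \<in> cells1 P" using a bd1_in[OF P] by auto
  show s: "sandwich P (id_path ?f) (id_path (bd0 P Neg ?f)) (d2 P Neg A) (id_path (bd0 P Pos ?f)) (id_path ?f')"
    unfolding sandwich_def between_def w using a c bd0_in[OF P] id_in[OF P] by auto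
  have pi: "id_path ?f \<odot> d2 P e A = d2 P e A" for e
    using b'[of Neg e] by (simp add: pcomp_id_left psrc_bd[of _ "whisker_bd P"])
  show t: "step_bd P e (Step (id_path ?f) (id_path (bd0 P Neg ?f)) A (id_path (bd0 P Pos ?f)) (id_path ?f')) = d2 P e A" for e
    by (simp add: w pi)
  show "gen3 P A \<in> cells3 P" 
    using s t[of Neg] a assms(2) by (auto simp: gen3_def Let_def cells3_def paths_def steps_def)
  show "bd2 P e (gen3 P A) = d2 P e A"
    using t by (cases e) (auto simp: gen3_def Let_def path_bd.simps(1,2)[of "step_bd P"])
qed

context ext3 begin

lemma H_simps: "H 0 u = G 0 u" "H (Suc 0) u = G (Suc 0) u" "H 2 u = G 2 u" "H 3 (Cell3 F) = E (psrc F) (edges F)"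
  by (auto simp: H_def morph_ext_def)

lemma Hi: "\<phi> \<in> cells2 P \<Longrightarrow> E \<phi> [] = idn D 2 (G2 \<phi>)" by simp

lemma H_morphism: "precat_morphism 3 (free_precat P) D H"
proof -
  have 1: "H k u \<in> cells D k" if "k \<le> 3" "u \<in> cells (free_precat P) k" for k u
    using that Gc E_in by (auto simp: free_precat_sel[OF P] le3_iff[OF P] H_simps)
  have 2: "H i (bd (free_precat P) e i u) = bd D e i (H (Suc i) u)" if "i < 3" "u \<in> cells (free_precat P) (Suc i)" for i u e
    using that Gb E_in unfolding less3_iff[OF P] by (auto simp: free_precat_sel[OF P] H_simps simp flip: numeral_2_eq_2)
  have 3: "H (Suc i) (idn (free_precat P) i u) = idn D i (H i u)" if "i < 3" "u \<in> cells (free_precat P) i" for i u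
    using that Gi unfolding less3_iff[OF P] by (auto simp: free_precat_sel[OF P] H_simps simp flip: numeral_2_eq_2)
  have 4: "H (max k l) (cmp (free_precat P) k l u v) = cmp D k l (H k u) (H l v)"
    if "k \<le> 3" "l \<le> 3" "composable (free_precat P) k l u v" for k l u v
    using that pos_le3[OF P, of k] pos_le3[OF P, of l] composable_pos[OF P, of "free_precat P" k l u v]
    by (auto simp: free_composable[OF P] free_precat_sel[OF P] H_simps Gm E_W[simplified psrc_whisker] E_pcomp[simplified] simp flip: numeral_2_eq_2)
  show ?thesis unfolding precat_morphism_def using 1 2 3 4 by blast
qed

lemma H_gen: "A \<in> gens3 P \<Longrightarrow> H 3 (Cell3 (gen3 P A)) = g A"
proof -
  assume A: "A \<in> gens3 P"
  let ?f = "bd1 P Neg (d2 P Neg A)" let ?f' = "bd1 P Pos (d2 P Neg A)"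
  note gi = gen3_in[OF P A]
  note w = W_parts[OF A gi(4)]
  note sf = sandwich_facts[OF A gi(4)]
  have gA: "g A \<in> cells D 3" "\<And>e. bd D e 2 (g A) = G2 (d2 P e A)" using g[OF A] by auto
  have c: "d2 P Neg A \<in> cells2 P" "?f \<in> cells1 P" "?f' \<in> cells1 P" using sf bd1_in[OF P] by auto
  have e1: "cmp D (Suc 0) 3 (G1 (id_path (bd0 P Neg ?f))) (g A) = g A"
    using D.cmp_idn_left[of 0 3 "g A"] n3 gA c by (simp add: D.bdto_low Gi Gb bd0_in[OF P])
  have e2: "cmp D 3 (Suc 0) (g A) (G1 (id_path (bd0 P Pos ?f))) = g A"
    using D.cmp_idn_right[of 0 3 "g A"] n3 gA c sf(5)[of Pos] sf(12)[of Pos] glob2[OF P c(1)] by (simp add: D.bdto_low Gi Gb bd0_in[OF P])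
  have e3: "cmp D 2 3 (G2 (id_path ?f)) (g A) = g A"
    using D.cmp_idn_left[of 1 3 "g A"] n3 gA c by (simp add: D.bdto_low Gi Gb bd0_in[OF P] flip: numeral_2_eq_2)
  have e4: "cmp D 3 2 (g A) (G2 (id_path ?f')) = g A"
    using D.cmp_idn_right[of 1 3 "g A"] n3 gA c sf(5)[of Pos] sf(12)[of Pos] by (simp add: D.bdto_low Gi Gb bd0_in[OF P] flip: numeral_2_eq_2)
  let ?s = "Step (id_path ?f) (id_path (bd0 P Neg ?f)) A (id_path (bd0 P Pos ?f)) (id_path ?f')"
  have "W ?s = g A" using e1 e2 e3 e4 by simp
  moreover have "E (d2 P Neg A) [?s] = W ?s"
    using D.path_ext_single[OF n2, of W ?s "\<lambda>x. G2 x" "step_bd P Pos"] w by simp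
  ultimately show ?thesis by (simp add: H_simps gen3_def Let_def)
qed

end

theorem free_extension3:
  assumes "prepolygraph3 P" "precategory 3 D" "precat_morphism 2 (free_precat P) D G"
    and "\<And>A e. A \<in> gens3 P \<Longrightarrow> g A \<in> cells D 3 \<and> bd D e 2 (g A) = G 2 (Cell2 (d2 P e A))"
  shows "\<exists>H. precat_morphism 3 (free_precat P) D H \<and> (\<forall>k<3. H k = G k) \<and> (\<forall>A\<in>gens3 P. H 3 (Cell3 (gen3 P A)) = g A)"
proof -
  interpret D: precategory 3 D by fact
  interpret ext3 3 D P G g by unfold_locales (use assms in auto)
  show ?thesis using H_morphism H_gen by (intro exI[of _ H]) (auto simp: H_def morph_ext_def)
qed

theorem free_unique3:
  assumes P: "prepolygraph3 P" and H: "precat_morphism 3 (free_precat P) D H" and H': "precat_morphism 3 (free_precat P) D H'"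
    and eq: "\<And>k u. k < 3 \<Longrightarrow> u \<in> cells (free_precat P) k \<Longrightarrow> H k u = H' k u"
    and g: "\<And>A. A \<in> gens3 P \<Longrightarrow> H 3 (Cell3 (gen3 P A)) = H' 3 (Cell3 (gen3 P A))"
    and u: "u \<in> cells (free_precat P) 3"
  shows "H 3 u = H' 3 u"
proof -
  obtain F where F: "u = Cell3 F" "F \<in> cells3 P" using u by (auto simp: free_precat_sel[OF P])
  have cm: "K (max k l) (cmp (free_precat P) k l u v) = cmp D k l (K k u) (K l v)"
    if "composable (free_precat P) k l u v" "k \<le> 3" "l \<le> 3" "precat_morphism 3 (free_precat P) D K" for k l u v K
    using that unfolding precat_morphism_def by blast
  have e0: "H (Suc 0) (Cell1 f) = H' (Suc 0) (Cell1 f)" if "f \<in> cells1 P" for f using eq[of "Suc 0" "Cell1 f"] that by (simp add: free_precat_sel[OF P])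
  have e2: "H 2 (Cell2 f) = H' 2 (Cell2 f)" if "f \<in> cells2 P" for f using eq[of 2 "Cell2 f"] that by (simp add: free_precat_sel[OF P])
  have st: "H 3 (Cell3 (Path (step_bd P Neg s) [s])) = H' 3 (Cell3 (Path (step_bd P Neg s) [s]))" if s: "s \<in> steps P" for s
  proof -
    obtain k l A r m where s: "s = Step k l A r m" "A \<in> gens3 P" "sandwich P k l (d2 P Neg A) r m"
      using s by (auto simp: steps_def)
    note sa = s(3)[unfolded sandwich_def between_def]
    let ?X = "gen3 P A"
    let ?a = "l \<rhd>\<^sub>0 ?X" let ?b = "?a \<lhd>\<^sub>0 r" let ?c = "k \<rhd>\<^sub>1 ?b"
    note X = gen3_in(1,2)[OF P s(2)]
    have bt: "between P l (bd1 P Neg (d2 P Neg A)) r" using s(3) by (simp add: sandwich_def)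
    have m: "psrc m = l \<odot> bd1 P Pos (d2 P Neg A) \<odot> r"
      using sa whisk2_in(2)[OF P bt, of Pos] by (simp add: psrc_bd[of m "whisker_bd P"])
    have "Path (step_bd P Neg s) [s] = ?c \<lhd>\<^sub>1 m"
      using sa m by (simp add: s(1) gen3_def Let_def whisker_pmap(3-6) pmap_def pcomp_id_left psrc_bd[of r "d0 P"] pcomp_assoc)
    have a: "?a \<in> cells3 P" "\<And>e. bd2 P e ?a = l \<rhd> d2 P e A"
      using lwhisk30_in[OF P _ X(1), of l] sa X(2) by auto
    have a': "bd0 P Pos (bd1 P Neg (bd2 P Neg ?a)) = bd0 P Neg r"
      using a(2)[of Neg] lwhisk2_in(2)[OF P _ _, of l "d2 P Neg A" Neg] sa by (simp add: bd0_pcomp[OF P])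
    have b: "?b \<in> cells3 P" "\<And>e. bd2 P e ?b = l \<rhd> d2 P e A \<lhd> r"
      using rwhisk30_in[OF P _ a(1) a'] sa a(2) by auto
    have b': "bd1 P Pos k = bd1 P Neg (bd2 P Neg ?b)" using b(2)[of Neg] sa by simp
    have c: "?c \<in> cells3 P" "\<And>e. bd2 P e ?c = k \<odot> (l \<rhd> d2 P e A \<lhd> r)"
      using lwhisk31_in[OF P _ b(1) b'] sa b(2) by auto
    have c': "bd1 P Pos (bd2 P Neg ?c) = bd1 P Neg m" using c(2)[of Neg] sa by (simp add: bd1_pcomp[OF P])
    have 1: "K 3 (Cell3 (?c \<lhd>\<^sub>1 m)) = cmp D 3 2 (cmp D 2 3 (K 2 (Cell2 k)) (cmp D 3 (Suc 0)
        (cmp D (Suc 0) 3 (K (Suc 0) (Cell1 l)) (K 3 (Cell3 ?X))) (K (Suc 0) (Cell1 r)))) (K 2 (Cell2 m))"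
      if K: "precat_morphism 3 (free_precat P) D K" for K
      using cm[OF _ _ _ K, of "Suc 0" 3 "Cell1 l" "Cell3 ?X"] cm[OF _ _ _ K, of 3 "Suc 0" "Cell3 ?a" "Cell1 r"]
        cm[OF _ _ _ K, of 2 3 "Cell2 k" "Cell3 ?b"] cm[OF _ _ _ K, of 3 2 "Cell3 ?c" "Cell2 m"]
        a' b' c' a(1) b(1) c(1) X sa
      by (simp add: free_composable[OF P] free_precat_sel[OF P])
    show ?thesis unfolding \<open>Path _ _ = _\<close> 1[OF H] 1[OF H'] using e0 e2 g[OF s(2)] sa by simp
  qed
  have "H 3 (Cell3 (Path x ws)) = H' 3 (Cell3 (Path x ws))" if "Path x ws \<in> cells3 P" for x ws
    using that
  proof (induction ws arbitrary: x)
    case Nil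
    then have x: "x \<in> cells2 P" by (simp add: cells3_def paths_def)
    have "K 3 (Cell3 (Path x [])) = idn D 2 (K 2 (Cell2 x))" if "precat_morphism 3 (free_precat P) D K" for K
    proof -
      have "Cell2 x \<in> cells (free_precat P) 2" using x by (simp add: free_precat_sel[OF P])
      moreover have "(2::nat) < 3" by simp
      ultimately have "K (Suc 2) (idn (free_precat P) 2 (Cell2 x)) = idn D 2 (K 2 (Cell2 x))"
        using that unfolding precat_morphism_def by blast
      then show ?thesis by (simp add: free_precat_sel[OF P])
    qed
    from this[OF H] this[OF H'] show ?case using e2[OF x] by simp
  next
    case (Cons w ws)
    have w: "w \<in> steps P" "x = step_bd P Neg w" and ws: "Path (step_bd P Pos w) ws \<in> cells3 P" and w1: "Path x [w] \<in> cells3 P"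
      using Cons.prems step_bd_in[OF P] by (auto simp: cells3_def paths_def)
    have "Path x (w # ws) = Path x [w] \<odot> Path (step_bd P Pos w) ws" by (simp add: pcomp_def)
    moreover have mm: "K 3 (Cell3 (Path x [w] \<odot> Path (step_bd P Pos w) ws)) = cmp D 3 3 (K 3 (Cell3 (Path x [w]))) (K 3 (Cell3 (Path (step_bd P Pos w) ws)))"
      if K: "precat_morphism 3 (free_precat P) D K" for K
      using cm[OF _ _ _ K, of 3 3 "Cell3 (Path x [w])" "Cell3 (Path (step_bd P Pos w) ws)"] ws w1
      by (simp add: free_composable[OF P] free_precat_sel[OF P] path_bd.simps)
    ultimately show ?case using mm[OF H] mm[OF H'] Cons.IH[OF ws] st[OF w(1)] w(2) by simp
  qed
  then show ?thesis using F by (cases F) auto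
qed

lemma precat_morphismD:
  assumes "precat_morphism n A D h"
  shows "k \<le> n \<Longrightarrow> u \<in> cells A k \<Longrightarrow> h k u \<in> cells D k"
    "i < n \<Longrightarrow> u \<in> cells A (Suc i) \<Longrightarrow> h i (bd A e i u) = bd D e i (h (Suc i) u)"
    "i < n \<Longrightarrow> u \<in> cells A i \<Longrightarrow> h (Suc i) (idn A i u) = idn D i (h i u)"
    "k \<le> n \<Longrightarrow> l \<le> n \<Longrightarrow> composable A k l u v \<Longrightarrow> h (max k l) (cmp A k l u v) = cmp D k l (h k u) (h l v)"
  using assms[unfolded precat_morphism_def, THEN conjunct1]
    assms[unfolded precat_morphism_def, THEN conjunct2, THEN conjunct1]
    assms[unfolded precat_morphism_def, THEN conjunct2, THEN conjunct2, THEN conjunct1]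
    assms[unfolded precat_morphism_def, THEN conjunct2, THEN conjunct2, THEN conjunct2]
  by simp_all

lemma precat_morphismI:
  assumes "\<And>k u. k \<le> n \<Longrightarrow> u \<in> cells A k \<Longrightarrow> h k u \<in> cells D k"
    "\<And>i u e. i < n \<Longrightarrow> u \<in> cells A (Suc i) \<Longrightarrow> h i (bd A e i u) = bd D e i (h (Suc i) u)"
    "\<And>i u. i < n \<Longrightarrow> u \<in> cells A i \<Longrightarrow> h (Suc i) (idn A i u) = idn D i (h i u)"
    "\<And>k l u v. k \<le> n \<Longrightarrow> l \<le> n \<Longrightarrow> composable A k l u v \<Longrightarrow> h (max k l) (cmp A k l u v) = cmp D k l (h k u) (h l v)"
  shows "precat_morphism n A D h"
  unfolding precat_morphism_def by (intro conjI allI impI ballI) (fact assms | (rule assms; assumption))+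

lemma gen2_facts:
  assumes P: "prepolygraph3 P" and a: "a \<in> gens2 P"
  shows "whisker_bd P e (Whisker (id_path (bd0 P Neg (d1 P Neg a))) a (id_path (bd0 P Pos (d1 P Neg a)))) = d1 P e a"
   "between P (id_path (bd0 P Neg (d1 P Neg a))) (d1 P Neg a) (id_path (bd0 P Pos (d1 P Neg a)))"
proof -
  have c: "bd0 P Neg (d1 P Neg a) = psrc (d1 P e a)" for e
    using gen2_bd(2)[OF P a, of Neg e] by (simp add: path_bd.simps)
  show "whisker_bd P e (Whisker (id_path (bd0 P Neg (d1 P Neg a))) a (id_path (bd0 P Pos (d1 P Neg a)))) = d1 P e a"
    using c[of e] by (simp add: pcomp_id_left)
  show "between P (id_path (bd0 P Neg (d1 P Neg a))) (d1 P Neg a) (id_path (bd0 P Pos (d1 P Neg a)))"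
    using gen2_bd[OF P a] bd0_in[OF P] id_in[OF P] by (auto simp: between_def)
qed

locale ext2 = D: precategory n D for n and D :: "'d precat" +
  fixes P :: "('a0, 'a1, 'a2, 'a3, 'z) prepolygraph3_scheme"
    and G :: "nat \<Rightarrow> ('a0, 'a1, 'a2, 'a3) cell \<Rightarrow> 'd" and g :: "'a2 \<Rightarrow> 'd"
  assumes n2: "2 \<le> n" and P: "prepolygraph3 P" and G: "precat_morphism 1 (free_precat P) D G"
    and g: "\<And>A e. A \<in> gens2 P \<Longrightarrow> g A \<in> cells D 2 \<and> bd D e (Suc 0) (g A) = G (Suc 0) (Cell1 (d1 P e A))"
begin

abbreviation "G0 x \<equiv> G 0 (Cell0 x)"
abbreviation "G1 x \<equiv> G (Suc 0) (Cell1 x)"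

lemma n12: "Suc 0 \<le> n" "1 \<le> n" using n2 by auto

lemma Gc: "x \<in> gens0 P \<Longrightarrow> G0 x \<in> cells D 0" "f \<in> cells1 P \<Longrightarrow> G1 f \<in> cells D (Suc 0)"
proof -
  have *: "\<And>k u. k \<le> 1 \<Longrightarrow> u \<in> cells (free_precat P) k \<Longrightarrow> G k u \<in> cells D k"
    using G by (rule precat_morphismD)
  show "x \<in> gens0 P \<Longrightarrow> G0 x \<in> cells D 0" "f \<in> cells1 P \<Longrightarrow> G1 f \<in> cells D (Suc 0)"
    using *[of 0 "Cell0 x"] *[of "Suc 0" "Cell1 f"] by (simp_all add: free_precat_sel[OF P])
qed

lemma Gb: "f \<in> cells1 P \<Longrightarrow> bd D e 0 (G1 f) = G0 (bd0 P e f)"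
proof -
  have *: "\<And>i u e. i < 1 \<Longrightarrow> u \<in> cells (free_precat P) (Suc i) \<Longrightarrow> G i (bd (free_precat P) e i u) = bd D e i (G (Suc i) u)"
    using G by (rule precat_morphismD)
  show "f \<in> cells1 P \<Longrightarrow> bd D e 0 (G1 f) = G0 (bd0 P e f)"
    using *[of 0 "Cell1 f" e] by (auto simp: free_precat_sel[OF P])
qed

lemma Gi: "x \<in> gens0 P \<Longrightarrow> G1 (id_path x) = idn D 0 (G0 x)"
proof -
  have *: "\<And>i u. i < 1 \<Longrightarrow> u \<in> cells (free_precat P) i \<Longrightarrow> G (Suc i) (idn (free_precat P) i u) = idn D i (G i u)"
    using G by (rule precat_morphismD)
  show "x \<in> gens0 P \<Longrightarrow> G1 (id_path x) = idn D 0 (G0 x)"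
    using *[of 0 "Cell0 x"] by (auto simp: free_precat_sel[OF P])
qed

lemma Gm:
  "\<lbrakk>f \<in> cells1 P; h \<in> cells1 P; bd0 P Pos f = bd0 P Neg h\<rbrakk> \<Longrightarrow> G1 (f \<odot> h) = cmp D (Suc 0) (Suc 0) (G1 f) (G1 h)"
proof -
  have *: "\<And>k l u v. k \<le> 1 \<Longrightarrow> l \<le> 1 \<Longrightarrow> composable (free_precat P) k l u v \<Longrightarrow> G (max k l) (cmp (free_precat P) k l u v) = cmp D k l (G k u) (G l v)"
    using G by (rule precat_morphismD)
  show "\<lbrakk>f \<in> cells1 P; h \<in> cells1 P; bd0 P Pos f = bd0 P Neg h\<rbrakk> \<Longrightarrow> G1 (f \<odot> h) = cmp D (Suc 0) (Suc 0) (G1 f) (G1 h)"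
    using *[of "Suc 0" "Suc 0" "Cell1 f" "Cell1 h"] by (simp add: free_precat_sel[OF P] free_composable[OF P])
qed

primrec W where
  "W (Whisker l a r) = cmp D 2 (Suc 0) (cmp D (Suc 0) 2 (G1 l) (g a)) (G1 r)"

lemma W_parts:
  assumes "a \<in> gens2 P" "between P l (d1 P Neg a) r"
  defines "c \<equiv> cmp D (Suc 0) 2 (G1 l) (g a)"
  shows "g a \<in> cells D 2" "\<And>e. bd D e (Suc 0) (g a) = G1 (d1 P e a)" 
    "c \<in> cells D 2" "\<And>e. bd D e (Suc 0) c = G1 (l \<odot> d1 P e a)"
    "W (Whisker l a r) = cmp D 2 (Suc 0) c (G1 r)"
    "W (Whisker l a r) \<in> cells D 2" "\<And>e. bd D e (Suc 0) (W (Whisker l a r)) = G1 (whisker_bd P e (Whisker l a r))"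
    "l \<in> cells1 P" "r \<in> cells1 P" "\<And>e. d1 P e a \<in> cells1 P" "bd0 P Pos l = bd0 P Neg (d1 P Neg a)" "bd0 P Pos (d1 P Neg a) = bd0 P Neg r"
proof -
  have b: "between P l (d1 P e a) r" for e by (rule between_gen2[OF P assms(1,2)])
  show f: "l \<in> cells1 P" "r \<in> cells1 P" "\<And>e. d1 P e a \<in> cells1 P" "bd0 P Pos l = bd0 P Neg (d1 P Neg a)" "bd0 P Pos (d1 P Neg a) = bd0 P Neg r"
    using b by (auto simp: between_def)
  show ga: "g a \<in> cells D 2" "\<And>e. bd D e (Suc 0) (g a) = G1 (d1 P e a)" using g[OF assms(1)] by auto
  have Gl: "cmp D (Suc 0) (Suc 0) (G1 l) (G1 (d1 P e a)) = G1 (l \<odot> d1 P e a)" for e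
    by (rule Gm[symmetric]) (use b[of e] in \<open>auto simp: between_def\<close>)
  have Gr: "cmp D (Suc 0) (Suc 0) (G1 (l \<odot> d1 P e a)) (G1 r) = G1 ((l \<odot> d1 P e a) \<odot> r)" for e
    by (rule Gm[symmetric]) (use b[of e] in \<open>auto simp: between_def bd0_pcomp[OF P] cells1_pcomp[OF P]\<close>)
  show c: "c \<in> cells D 2" "\<And>e. bd D e (Suc 0) c = G1 (l \<odot> d1 P e a)"
    unfolding c_def using ga f D.cmp_in(2)[of "G1 l" "g a"] D.bd_cmp(3)[of "G1 l" "g a"] n2
    by (auto simp: D.composable_iff Gc Gb Gl)
  have "cmp D 2 (Suc 0) c (G1 r) \<in> cells D 2" "\<And>e. bd D e (Suc 0) (cmp D 2 (Suc 0) c (G1 r)) = G1 ((l \<odot> d1 P e a) \<odot> r)"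
    using c f D.cmp_in(3)[of c "G1 r"] D.bd_cmp(4)[of c "G1 r"] n2
    by (auto simp: D.composable_iff Gc Gb Gr bd0_pcomp[OF P] cells1_pcomp[OF P])
  then show "W (Whisker l a r) = cmp D 2 (Suc 0) c (G1 r)"
    "W (Whisker l a r) \<in> cells D 2" "\<And>e. bd D e (Suc 0) (W (Whisker l a r)) = G1 (whisker_bd P e (Whisker l a r))"
    by (simp_all add: c_def pcomp_assoc)
qed

lemma W_typ: "s \<in> whiskers P \<Longrightarrow> W s \<in> cells D 2 \<and> bd D e (Suc 0) (W s) = G1 (whisker_bd P e s)"
  using W_parts(6,7) unfolding whiskers_def by blast

abbreviation "E x ws \<equiv> path_ext D (Suc 0) (\<lambda>x. G1 x) W (whisker_bd P Pos) x ws"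
definition "H = morph_ext 2 G (\<lambda>u. case u of Cell2 F \<Rightarrow> E (psrc F) (edges F))"

lemma n2': "Suc (Suc 0) \<le> n" using n2 by simp

lemmas E_typ = D.path_ext_typing[OF n2', where X="cells1 P" and E="whiskers P" and d="whisker_bd P" and V="\<lambda>x. G1 x" and W=W, folded numeral_2_eq_2]
lemmas E_append = D.path_ext_append[OF n2', where X="cells1 P" and E="whiskers P" and d="whisker_bd P" and V="\<lambda>x. G1 x" and W=W, folded numeral_2_eq_2]
lemmas E_op = D.path_ext_whisker[OF n2', where X="cells1 P" and E="whiskers P" and d="whisker_bd P" and d'="whisker_bd P" and V="\<lambda>x. G1 x" and W=W, folded numeral_2_eq_2]

lemma E_in: "F \<in> cells2 P \<Longrightarrow> E (psrc F) (edges F) \<in> cells D 2 \<and> bd D e (Suc 0) (E (psrc F) (edges F)) = G1 (bd1 P e F)"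
  using E_typ[of "psrc F" "edges F"] W_typ Gc whisker_bd_in[OF P] 
  by (cases e) (auto simp: cells2_def paths_def path_bd.simps)

lemma E_pcomp: "\<lbrakk>F \<in> cells2 P; F' \<in> cells2 P; bd1 P Pos F = bd1 P Neg F'\<rbrakk> \<Longrightarrow>
  E (psrc (F \<odot> F')) (edges (F \<odot> F')) = cmp D 2 2 (E (psrc F) (edges F)) (E (psrc F') (edges F'))"
  using E_append[of "psrc F" "edges F" "edges F'"] W_typ Gc whisker_bd_in[OF P]
  by (auto simp: cells2_def paths_def path_bd.simps)

lemma W_l0:
  assumes "s \<in> whiskers P" "f \<in> cells1 P" "bd0 P Pos f = bd0 P Neg (whisker_bd P Neg s)"
  shows "W (lwhisk f s) = cmp D (Suc 0) 2 (G1 f) (W s)"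
proof -
  obtain l a r where s: "s = Whisker l a r" "a \<in> gens2 P" "between P l (d1 P Neg a) r"
    using assms by (auto simp: whiskers_def)
  note w = W_parts[OF s(2,3)]
  have q: "bd0 P Pos f = bd0 P Neg l" using assms(3) w by (simp add: s(1) bd0_pcomp[OF P])
  note simps = Gc Gb bd0_pcomp[OF P] cells1_pcomp[OF P]
  let ?c = "cmp D (Suc 0) 2 (G1 l) (g a)"
  have "cmp D (Suc 0) 2 (G1 f) (W s) = cmp D 2 (Suc 0) (cmp D (Suc 0) 2 (G1 f) ?c) (G1 r)"
    unfolding s(1) w(5) by (rule D.cmp_assoc2(2)[symmetric]) (use w assms(2) n2 q in \<open>simp_all add: simps\<close>)
  also have "cmp D (Suc 0) 2 (G1 f) ?c = cmp D (Suc 0) 2 (cmp D (Suc 0) (Suc 0) (G1 f) (G1 l)) (g a)"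
    by (rule D.cmp_assoc2(1)[symmetric]) (use w assms(2) n2 q in \<open>simp_all add: simps\<close>)
  finally show ?thesis using w assms(2) q by (simp add: s(1) Gm)
qed

lemma W_r0:
  assumes "s \<in> whiskers P" "f \<in> cells1 P" "bd0 P Pos (whisker_bd P Neg s) = bd0 P Neg f"
  shows "W (rwhisk s f) = cmp D 2 (Suc 0) (W s) (G1 f)"
proof -
  obtain l a r where s: "s = Whisker l a r" "a \<in> gens2 P" "between P l (d1 P Neg a) r"
    using assms by (auto simp: whiskers_def)
  note w = W_parts[OF s(2,3)]
  have q: "bd0 P Pos r = bd0 P Neg f" using assms(3) w by (simp add: s(1) bd0_pcomp[OF P])
  note simps = Gc Gb bd0_pcomp[OF P] cells1_pcomp[OF P]
  let ?c = "cmp D (Suc 0) 2 (G1 l) (g a)"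
  have "cmp D 2 (Suc 0) (W s) (G1 f) = cmp D 2 (Suc 0) ?c (cmp D (Suc 0) (Suc 0) (G1 r) (G1 f))"
    unfolding s(1) w(5) by (rule D.cmp_assoc2(3)) (use w assms(2) n2 q in \<open>simp_all add: simps\<close>)
  then show ?thesis using w assms(2) q by (simp add: s(1) Gm)
qed

lemma E_W: 
  assumes "F \<in> cells2 P"
  shows "\<lbrakk>f \<in> cells1 P; bd0 P Pos f = bd0 P Neg (bd1 P Neg F)\<rbrakk> \<Longrightarrow>
     E (psrc (f \<rhd> F)) (edges (f \<rhd> F)) = cmp D (Suc 0) 2 (G1 f) (E (psrc F) (edges F))"
   "\<lbrakk>f \<in> cells1 P; bd0 P Pos (bd1 P Neg F) = bd0 P Neg f\<rbrakk> \<Longrightarrow>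
     E (psrc (F \<lhd> f)) (edges (F \<lhd> f)) = cmp D 2 (Suc 0) (E (psrc F) (edges F)) (G1 f)"
proof -
  have F: "psrc F \<in> cells1 P" "set (edges F) \<subseteq> whiskers P" "chain (whisker_bd P) (psrc F) (edges F)" "psrc F = bd1 P Neg F"
    using assms by (auto simp: cells2_def paths_def path_bd.simps)
  have nn: "2 \<le> n" "Suc 0 \<le> n" using n2 by auto
  have sg: "bd0 P e (whisker_bd P Pos w) = bd0 P e (whisker_bd P Neg w)" if "w \<in> whiskers P" for w e
    using whisker_glob[OF P that] by simp
  note simps = Gc Gb bd1_in[OF P] bd0_pcomp[OF P] cells1_pcomp[OF P] whisker_bd_in[OF P] sg W_typ
  { assume f: "f \<in> cells1 P" "bd0 P Pos f = bd0 P Neg (bd1 P Neg F)"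
    have "E (f \<odot> psrc F) (map (lwhisk f) (edges F)) = cmp D (Suc 0) 2 (G1 f) (E (psrc F) (edges F))"
    proof (rule E_op[where K="\<lambda>x. bd0 P Pos f = bd0 P Neg x" and g="lwhisk f"])
      fix x assume "x \<in> cells1 P" "bd0 P Pos f = bd0 P Neg x"
      then show "cmp D (Suc 0) 2 (G1 f) (idn D (Suc 0) (G1 x)) = idn D (Suc 0) (G1 (f \<odot> x))"
        using f nn D.idn_cmp_left[of 0 "Suc 0" "G1 f" "G1 x"] by (simp add: D.composable_iff simps Gm flip: numeral_2_eq_2)
    next
      fix w u assume w: "w \<in> whiskers P" "bd0 P Pos f = bd0 P Neg (whisker_bd P Neg w)" "u \<in> cells D 2" "bd D Neg (Suc 0) u = G1 (whisker_bd P Pos w)"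
      show "cmp D (Suc 0) 2 (G1 f) (cmp D 2 2 (W w) u) = cmp D 2 2 (cmp D (Suc 0) 2 (G1 f) (W w)) (cmp D (Suc 0) 2 (G1 f) u)"
        by (rule D.cmp_distribs(1)) (use w f nn in \<open>simp_all add: simps\<close>)
    qed (use F f lwhisker[OF P] in \<open>auto simp: simps W_l0\<close>)
    then show "E (psrc (f \<rhd> F)) (edges (f \<rhd> F)) = cmp D (Suc 0) 2 (G1 f) (E (psrc F) (edges F))"
      by (simp add: lwhisk2_def) }
  { assume f: "f \<in> cells1 P" "bd0 P Pos (bd1 P Neg F) = bd0 P Neg f"
    have "E (psrc F \<odot> f) (map (\<lambda>s. rwhisk s f) (edges F)) = cmp D 2 (Suc 0) (E (psrc F) (edges F)) (G1 f)"
    proof (rule E_op[where K="\<lambda>x. bd0 P Pos x = bd0 P Neg f" and g="\<lambda>s. rwhisk s f"])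
      fix x assume "x \<in> cells1 P" "bd0 P Pos x = bd0 P Neg f"
      then show "cmp D 2 (Suc 0) (idn D (Suc 0) (G1 x)) (G1 f) = idn D (Suc 0) (G1 (x \<odot> f))"
        using f nn D.idn_cmp_right[of 0 "Suc 0" "G1 x" "G1 f"] by (simp add: D.composable_iff simps Gm flip: numeral_2_eq_2)
    next
      fix w u assume w: "w \<in> whiskers P" "bd0 P Pos (whisker_bd P Neg w) = bd0 P Neg f" "u \<in> cells D 2" "bd D Neg (Suc 0) u = G1 (whisker_bd P Pos w)"
      show "cmp D 2 (Suc 0) (cmp D 2 2 (W w) u) (G1 f) = cmp D 2 2 (cmp D 2 (Suc 0) (W w) (G1 f)) (cmp D 2 (Suc 0) u (G1 f))"
        by (rule D.cmp_distribs(2)) (use w f nn in \<open>simp_all add: simps\<close>)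
    qed (use F f rwhisker[OF P] in \<open>auto simp: simps W_r0\<close>)
    then show "E (psrc (F \<lhd> f)) (edges (F \<lhd> f)) = cmp D 2 (Suc 0) (E (psrc F) (edges F)) (G1 f)"
      by (simp add: rwhisk2_def) }
qed

lemma H_simps: "H 0 u = G 0 u" "H (Suc 0) u = G (Suc 0) u" "H 2 (Cell2 F) = E (psrc F) (edges F)"
  by (auto simp: H_def morph_ext_def)

lemma less2: "i < 2 \<longleftrightarrow> i = 0 \<or> i = Suc 0" by auto
lemma range2: "0 < k \<Longrightarrow> k \<le> 2 \<Longrightarrow> k = Suc 0 \<or> k = (2::nat)" by auto

lemma H_morphism: "precat_morphism 2 (free_precat P) D H"
proof -
  have 1: "H k u \<in> cells D k" if "k \<le> 2" "u \<in> cells (free_precat P) k" for k u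
  proof -
    have "k = 0 \<or> k = Suc 0 \<or> k = 2" using that by auto
    then show ?thesis using that Gc E_in by (auto simp: free_precat_sel[OF P] H_simps)
  qed
  have 2: "H i (bd (free_precat P) e i u) = bd D e i (H (Suc i) u)" if "i < 2" "u \<in> cells (free_precat P) (Suc i)" for i u e
    using that Gb E_in unfolding less2 by (auto simp: free_precat_sel[OF P] H_simps simp flip: numeral_2_eq_2)
  have 3: "H (Suc i) (idn (free_precat P) i u) = idn D i (H i u)" if "i < 2" "u \<in> cells (free_precat P) i" for i u
    using that Gi unfolding less2 by (auto simp: free_precat_sel[OF P] H_simps simp flip: numeral_2_eq_2)
  have 4: "H (max k l) (cmp (free_precat P) k l u v) = cmp D k l (H k u) (H l v)"
    if "k \<le> 2" "l \<le> 2" "composable (free_precat P) k l u v" for k l u v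
    using that range2[of k] range2[of l] composable_pos[OF P, of "free_precat P" k l u v]
    by (auto simp: free_composable[OF P] free_precat_sel[OF P] H_simps Gm E_W[simplified psrc_whisker] E_pcomp[simplified] simp flip: numeral_2_eq_2)
  show ?thesis by (rule precat_morphismI) (fact 1 2 3 4)+
qed

lemma H_gen: "a \<in> gens2 P \<Longrightarrow> H 2 (Cell2 (gen2 P a)) = g a"
proof -
  assume a: "a \<in> gens2 P"
  note gi = gen2_facts[OF P a]
  note w = W_parts[OF a gi(2)]
  have e1: "cmp D (Suc 0) 2 (G1 (id_path (bd0 P Neg (d1 P Neg a)))) (g a) = g a"
    using D.cmp_idn_left[of 0 2 "g a"] n2 w by (simp add: D.bdto_low Gi Gb bd0_in[OF P])
  have e2: "cmp D 2 (Suc 0) (g a) (G1 (id_path (bd0 P Pos (d1 P Neg a)))) = g a"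
    using D.cmp_idn_right[of 0 2 "g a"] n2 w gen2_bd(2)[OF P a, of Pos Pos] by (simp add: D.bdto_low Gi Gb bd0_in[OF P])
  let ?s = "Whisker (id_path (bd0 P Neg (d1 P Neg a))) a (id_path (bd0 P Pos (d1 P Neg a)))"
  have "W ?s = g a" using e1 e2 by simp
  moreover have "E (d1 P Neg a) [?s] = W ?s"
    using D.path_ext_single[OF n2', of W ?s "\<lambda>x. G1 x" "whisker_bd P Pos", folded numeral_2_eq_2] w by simp
  ultimately show ?thesis by (simp add: H_simps gen2_def)
qed

end

theorem free_extension2:
  assumes "prepolygraph3 P" "precategory 2 D" "precat_morphism 1 (free_precat P) D G"
    and "\<And>a e. a \<in> gens2 P \<Longrightarrow> g a \<in> cells D 2 \<and> bd D e 1 (g a) = G 1 (Cell1 (d1 P e a))"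
  shows "\<exists>H. precat_morphism 2 (free_precat P) D H \<and> (\<forall>k<2. H k = G k) \<and> (\<forall>a\<in>gens2 P. H 2 (Cell2 (gen2 P a)) = g a)"
proof -
  interpret D: precategory 2 D by fact
  interpret ext2 2 D P G g by unfold_locales (use assms in auto)
  show ?thesis using H_morphism H_gen by (intro exI[of _ H]) (auto simp: H_def morph_ext_def)
qed

theorem free_unique2:
  assumes P: "prepolygraph3 P" and H: "precat_morphism 2 (free_precat P) D H" and H': "precat_morphism 2 (free_precat P) D H'"
    and eq: "\<And>k u. k < 2 \<Longrightarrow> u \<in> cells (free_precat P) k \<Longrightarrow> H k u = H' k u"
    and g: "\<And>a. a \<in> gens2 P \<Longrightarrow> H 2 (Cell2 (gen2 P a)) = H' 2 (Cell2 (gen2 P a))"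
    and u: "u \<in> cells (free_precat P) 2"
  shows "H 2 u = H' 2 u"
proof -
  obtain F where F: "u = Cell2 F" "F \<in> cells2 P" using u by (auto simp: free_precat_sel[OF P])
  have cm: "K (max k l) (cmp (free_precat P) k l u v) = cmp D k l (K k u) (K l v)"
    if "composable (free_precat P) k l u v" "k \<le> 2" "l \<le> 2" "precat_morphism 2 (free_precat P) D K" for k l u v K
    using precat_morphismD(4)[OF that(4) that(2,3,1)] .
  have e0: "H (Suc 0) (Cell1 f) = H' (Suc 0) (Cell1 f)" if "f \<in> cells1 P" for f using eq[of "Suc 0" "Cell1 f"] that by (simp add: free_precat_sel[OF P])
  have st: "H 2 (Cell2 (Path (whisker_bd P Neg s) [s])) = H' 2 (Cell2 (Path (whisker_bd P Neg s) [s]))" if s: "s \<in> whiskers P" for s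
  proof -
    obtain l a r where s: "s = Whisker l a r" "a \<in> gens2 P" "between P l (d1 P Neg a) r"
      using s by (auto simp: whiskers_def)
    note sa = s(3)[unfolded between_def]
    note X = gen2_in[OF P s(2)]
    have p: "Path (whisker_bd P Neg s) [s] = (l \<rhd> gen2 P a) \<lhd> r"
      using sa by (simp add: s(1) gen2_def whisker_pmap(1,2) pmap_def pcomp_id_left psrc_bd[of r "d0 P"] pcomp_assoc)
    have a: "l \<rhd> gen2 P a \<in> cells2 P" "\<And>e. bd1 P e (l \<rhd> gen2 P a) = l \<odot> d1 P e a"
      using lwhisk2_in[OF P, of l "gen2 P a"] sa X by auto
    have 1: "K 2 (Cell2 ((l \<rhd> gen2 P a) \<lhd> r)) = cmp D 2 (Suc 0)
        (cmp D (Suc 0) 2 (K (Suc 0) (Cell1 l)) (K 2 (Cell2 (gen2 P a)))) (K (Suc 0) (Cell1 r))"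
      if K: "precat_morphism 2 (free_precat P) D K" for K
      using cm[OF _ _ _ K, of "Suc 0" 2 "Cell1 l" "Cell2 (gen2 P a)"] cm[OF _ _ _ K, of 2 "Suc 0" "Cell2 (l \<rhd> gen2 P a)" "Cell1 r"]
        a X sa
      by (simp add: free_composable[OF P] free_precat_sel[OF P] bd0_pcomp[OF P] flip: numeral_2_eq_2)
    show ?thesis unfolding p 1[OF H] 1[OF H'] using e0 g[OF s(2)] sa by simp
  qed
  have "H 2 (Cell2 (Path x ws)) = H' 2 (Cell2 (Path x ws))" if "Path x ws \<in> cells2 P" for x ws
    using that
  proof (induction ws arbitrary: x)
    case Nil
    then have x: "x \<in> cells1 P" by (simp add: cells2_def paths_def)
    have "K 2 (Cell2 (Path x [])) = idn D 1 (K 1 (Cell1 x))" if "precat_morphism 2 (free_precat P) D K" for K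
    proof -
      have "Cell1 x \<in> cells (free_precat P) 1" using x by (simp add: free_precat_sel[OF P])
      moreover have "(1::nat) < 2" by simp
      ultimately have "K (Suc 1) (idn (free_precat P) 1 (Cell1 x)) = idn D 1 (K 1 (Cell1 x))"
        using precat_morphismD(3)[OF that] by blast
      then show ?thesis by (simp add: free_precat_sel[OF P] flip: numeral_2_eq_2)
    qed
    from this[OF H] this[OF H'] show ?case using e0[OF x] by simp
  next
    case (Cons w ws)
    have w: "w \<in> whiskers P" "x = whisker_bd P Neg w" and ws: "Path (whisker_bd P Pos w) ws \<in> cells2 P" and w1: "Path x [w] \<in> cells2 P"
      using Cons.prems whisker_bd_in[OF P] by (auto simp: cells2_def paths_def)
    have "Path x (w # ws) = Path x [w] \<odot> Path (whisker_bd P Pos w) ws" by (simp add: pcomp_def)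
    moreover have mm: "K 2 (Cell2 (Path x [w] \<odot> Path (whisker_bd P Pos w) ws)) = cmp D 2 2 (K 2 (Cell2 (Path x [w]))) (K 2 (Cell2 (Path (whisker_bd P Pos w) ws)))"
      if K: "precat_morphism 2 (free_precat P) D K" for K
      using cm[OF _ _ _ K, of 2 2 "Cell2 (Path x [w])" "Cell2 (Path (whisker_bd P Pos w) ws)"] ws w1
      by (simp add: free_composable[OF P] free_precat_sel[OF P] path_bd.simps)
    ultimately show ?case using mm[OF H] mm[OF H'] Cons.IH[OF ws] st[OF w(1)] w(2) by simp
  qed
  then show ?thesis using F by (cases F) auto
qed

theorem free_extension1:
  assumes P: "prepolygraph3 P" and D: "precategory 1 D" and G: "precat_morphism 0 (free_precat P) D G"
    and g: "\<And>a e. a \<in> gens1 P \<Longrightarrow> g a \<in> cells D 1 \<and> bd D e 0 (g a) = G 0 (Cell0 (d0 P e a))"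
  shows "\<exists>H. precat_morphism 1 (free_precat P) D H \<and> (\<forall>k<1. H k = G k) \<and> (\<forall>a\<in>gens1 P. H 1 (Cell1 (gen1 P a)) = g a)"
proof -
  interpret D: precategory 1 D by fact
  have Gc: "G 0 (Cell0 x) \<in> cells D 0" if "x \<in> gens0 P" for x
  proof -
    have *: "\<And>k u. k \<le> 0 \<Longrightarrow> u \<in> cells (free_precat P) k \<Longrightarrow> G k u \<in> cells D k"
      using G by (rule precat_morphismD)
    show ?thesis using *[of 0 "Cell0 x"] that by (simp add: free_precat_sel[OF P])
  qed
  have db: "d0 P e a \<in> gens0 P" if "a \<in> gens1 P" for a e using P that by (simp add: prepolygraph3_def)
  let ?E = "\<lambda>x ws. path_ext D 0 (\<lambda>x. G 0 (Cell0 x)) g (d0 P Pos) x ws"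
  define H where "H = morph_ext 1 G (\<lambda>u. case u of Cell1 F \<Rightarrow> ?E (psrc F) (edges F))"
  have Hs: "H 0 = G 0" "H (Suc 0) (Cell1 F) = ?E (psrc F) (edges F)" for F by (auto simp: H_def morph_ext_def)
  have n1: "Suc 0 \<le> 1" by simp
  note E_typ = D.path_ext_typing[OF n1, where X="gens0 P" and E="gens1 P" and d="d0 P" and V="\<lambda>x. G 0 (Cell0 x)" and W=g]
  note E_append = D.path_ext_append[OF n1, where X="gens0 P" and E="gens1 P" and d="d0 P" and V="\<lambda>x. G 0 (Cell0 x)" and W=g]
  have E_in: "?E (psrc F) (edges F) \<in> cells D (Suc 0) \<and> bd D e 0 (?E (psrc F) (edges F)) = G 0 (Cell0 (bd0 P e F))" if "F \<in> cells1 P" for F e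
    using that E_typ[of "psrc F" "edges F"] g Gc db by (cases e) (auto simp: cells1_def paths_def path_bd.simps)
  have E_pcomp: "?E (psrc (F \<odot> F')) (edges (F \<odot> F')) = cmp D (Suc 0) (Suc 0) (?E (psrc F) (edges F)) (?E (psrc F') (edges F'))"
    if "F \<in> cells1 P" "F' \<in> cells1 P" "bd0 P Pos F = bd0 P Neg F'" for F F'
    using that E_append[of "psrc F" "edges F" "edges F'"] g Gc db by (auto simp: cells1_def paths_def path_bd.simps)
  have "precat_morphism 1 (free_precat P) D H"
  proof -
    have 1: "H k u \<in> cells D k" if "k \<le> 1" "u \<in> cells (free_precat P) k" for k u
    proof -
      have "k = 0 \<or> k = Suc 0" using that by auto
      then show ?thesis using that Gc E_in by (auto simp: free_precat_sel[OF P] Hs)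
    qed
    have 2: "H i (bd (free_precat P) e i u) = bd D e i (H (Suc i) u)" if "i < 1" "u \<in> cells (free_precat P) (Suc i)" for i u e
      using that E_in by (auto simp: free_precat_sel[OF P] Hs)
    have 3: "H (Suc i) (idn (free_precat P) i u) = idn D i (H i u)" if "i < 1" "u \<in> cells (free_precat P) i" for i u
      using that by (auto simp: free_precat_sel[OF P] Hs)
    have 4: "H (max k l) (cmp (free_precat P) k l u v) = cmp D k l (H k u) (H l v)"
      if "k \<le> 1" "l \<le> 1" "composable (free_precat P) k l u v" for k l u v
    proof -
      have "k = Suc 0" "l = Suc 0" using that composable_pos[OF P, of "free_precat P" k l u v] by auto
      then show ?thesis using that by (auto simp: free_composable[OF P] free_precat_sel[OF P] Hs E_pcomp[simplified])
    qed
    show ?thesis by (rule precat_morphismI) (fact 1 2 3 4)+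
  qed
  moreover have "H 1 (Cell1 (gen1 P a)) = g a" if "a \<in> gens1 P" for a
    using D.path_ext_single[OF n1, of g a "\<lambda>x. G 0 (Cell0 x)" "d0 P Pos"] g[OF that] by (simp add: Hs gen1_def)
  moreover have "\<forall>k<1. H k = G k" by (simp add: Hs)
  ultimately show ?thesis by blast
qed

theorem free_unique1:
  assumes P: "prepolygraph3 P" and H: "precat_morphism 1 (free_precat P) D H" and H': "precat_morphism 1 (free_precat P) D H'"
    and eq: "\<And>k u. k < 1 \<Longrightarrow> u \<in> cells (free_precat P) k \<Longrightarrow> H k u = H' k u"
    and g: "\<And>a. a \<in> gens1 P \<Longrightarrow> H 1 (Cell1 (gen1 P a)) = H' 1 (Cell1 (gen1 P a))"
    and u: "u \<in> cells (free_precat P) 1"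
  shows "H 1 u = H' 1 u"
proof -
  obtain F where F: "u = Cell1 F" "F \<in> cells1 P" using u by (auto simp: free_precat_sel[OF P])
  have cm: "K (max k l) (cmp (free_precat P) k l u v) = cmp D k l (K k u) (K l v)"
    if "composable (free_precat P) k l u v" "k \<le> 1" "l \<le> 1" "precat_morphism 1 (free_precat P) D K" for k l u v K
    using precat_morphismD(4)[OF that(4) that(2,3,1)] .
  have "H (Suc 0) (Cell1 (Path x ws)) = H' (Suc 0) (Cell1 (Path x ws))" if "Path x ws \<in> cells1 P" for x ws
    using that
  proof (induction ws arbitrary: x)
    case Nil
    then have x: "x \<in> gens0 P" by (simp add: cells1_def paths_def)
    have "K 1 (Cell1 (Path x [])) = idn D 0 (K 0 (Cell0 x))" if "precat_morphism 1 (free_precat P) D K" for K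
    proof -
      have "Cell0 x \<in> cells (free_precat P) 0" using x by (simp add: free_precat_sel[OF P])
      moreover have "(0::nat) < 1" by simp
      ultimately have "K (Suc 0) (idn (free_precat P) 0 (Cell0 x)) = idn D 0 (K 0 (Cell0 x))"
        using precat_morphismD(3)[OF that] by blast
      then show ?thesis by (simp add: free_precat_sel[OF P])
    qed
    from this[OF H] this[OF H'] show ?case using eq[of 0 "Cell0 x"] x by (simp add: free_precat_sel[OF P])
  next
    case (Cons w ws)
    have w: "w \<in> gens1 P" "x = d0 P Neg w" and ws: "Path (d0 P Pos w) ws \<in> cells1 P" and w1: "Path x [w] \<in> cells1 P"
      using Cons.prems P by (auto simp: cells1_def paths_def prepolygraph3_def)
    have "Path x (w # ws) = Path x [w] \<odot> Path (d0 P Pos w) ws" by (simp add: pcomp_def)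
    moreover have mm: "K (Suc 0) (Cell1 (Path x [w] \<odot> Path (d0 P Pos w) ws)) = cmp D (Suc 0) (Suc 0) (K (Suc 0) (Cell1 (Path x [w]))) (K (Suc 0) (Cell1 (Path (d0 P Pos w) ws)))"
      if K: "precat_morphism 1 (free_precat P) D K" for K
      using cm[OF _ _ _ K, of "Suc 0" "Suc 0" "Cell1 (Path x [w])" "Cell1 (Path (d0 P Pos w) ws)"] ws w1
      by (simp add: free_composable[OF P] free_precat_sel[OF P] path_bd.simps)
    ultimately show ?case using mm[OF H] mm[OF H'] Cons.IH[OF ws] g[OF w(1)] w(2) by (simp add: gen1_def)
  qed
  then show ?thesis using F by (cases F) auto
qed

end

theory Submission
  imports Defs
begin

text \<open>
  Every local branching is a whiskering of a minimal one, and a minimal one is critical unless it is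
  trivial, independent or natural.  The boundaries of the independence and naturality generators are
  3-cells which begin with the two steps of the corresponding branching (up to whiskering), so these
  generators are themselves confluence diagrams.  Hence all local branchings are confluent and, by
  termination, Newman's argument shows that any two paths from \<open>\<phi>\<close> to a normal form are equivalent.
  Choosing such a path \<open>N\<^sub>\<phi>\<close> for every \<open>\<phi>\<close>, each 3-cell \<open>F : \<phi> \<Rrightarrow> \<psi>\<close> satisfies \<open>F *\<^sub>2 N\<^sub>\<psi> \<equiv> N\<^sub>\<phi>\<close>,
  so in the localization every 3-cell from \<open>\<phi>\<close> to \<open>\<psi>\<close> equals \<open>N\<^sub>\<phi> *\<^sub>2 N\<^sub>\<psi>\<^sup>-\<^sup>1\<close>.
\<close>

section \<open>Generated congruences and the coarsest congruence\<close>

section \<open>Congruences\<close>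

text \<open>Each closure condition passes to intersections. The witness \<open>R\<^sub>0\<close>
  keeps the family nonempty: the intersection of an empty family is \<open>UNIV\<close>, which need
  not relate only parallel cells.\<close>

lemma generated_congruence_congruence:
  assumes "congruence n C R\<^sub>0" "S \<subseteq> R\<^sub>0"
  shows "congruence n C (generated_congruence n C S)"
proof -
  let ?\<R> = "{R. congruence n C R \<and> S \<subseteq> R}"
  have ne: "R\<^sub>0 \<in> ?\<R>" using assms by simp
  have sub: "\<Inter>?\<R> \<subseteq> cells C n \<times> cells C n"
    using assms by (auto simp: congruence_def)
  have "refl_on (cells C n) (\<Inter>?\<R>)"
    by (auto simp: congruence_def equiv_def refl_on_def)
  moreover have "sym (\<Inter>?\<R>)"
    by (rule symI) (auto simp: congruence_def equiv_def dest: symD)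
  moreover have "trans (\<Inter>?\<R>)"
  proof (rule transI, rule InterI)
    fix x y z R assume xyz: "(x, y) \<in> \<Inter>?\<R>" "(y, z) \<in> \<Inter>?\<R>" and R: "R \<in> ?\<R>"
    then have "trans R" by (simp add: congruence_def equiv_def)
    moreover have "(x, y) \<in> R" "(y, z) \<in> R" using xyz R by blast+
    ultimately show "(x, z) \<in> R" by (rule transD)
  qed
  ultimately have "equiv (cells C n) (\<Inter>?\<R>)"
    using sub by (simp add: equiv_def)
  moreover have "\<forall>e. bd C e (n - 1) u = bd C e (n - 1) u'" if "(u, u') \<in> \<Inter>?\<R>" for u u'
    using that ne by (fastforce simp: congruence_def)
  moreover have "(cmp C n (Suc i) (cmp C (Suc i) n v u) w,
      cmp C n (Suc i) (cmp C (Suc i) n v u') w) \<in> \<Inter>?\<R>"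
    if "(u, u') \<in> \<Inter>?\<R>" "i < n" "composable C (Suc i) n v u"
      "composable C n (Suc i) (cmp C (Suc i) n v u) w" for u u' i v w
  proof (rule InterI)
    fix R assume R: "R \<in> ?\<R>"
    then have "(u, u') \<in> R" using that(1) by blast
    then show "(cmp C n (Suc i) (cmp C (Suc i) n v u) w, cmp C n (Suc i) (cmp C (Suc i) n v u') w) \<in> R"
      using R that(2-4) unfolding congruence_def by blast
  qed
  ultimately show ?thesis
    unfolding generated_congruence_def congruence_def[of n C "\<Inter>?\<R>"] using sub by blast
qed

lemma generated_congruence_incl: "S \<subseteq> generated_congruence n C S"
  by (auto simp: generated_congruence_def)

context precategory
begin

text \<open>By definition every congruence is contained in this relation; shown below to be a
  congruence itself, it is the coarsest one.\<close>

definition parallel :: "'c \<Rightarrow> 'c \<Rightarrow> bool" where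
  "parallel u v \<longleftrightarrow> u \<in> cells C n \<and> v \<in> cells C n \<and> (\<forall>e. bd C e (n - 1) u = bd C e (n - 1) v)"

lemma parallel_bdto:
  assumes "parallel u u'" "i < n"
  shows "bdto C e i n u = bdto C e i n u'"
proof (cases n)
  case (Suc m)
  have "bd C e m u = bd C e m u'" using assms(1) Suc unfolding parallel_def by simp
  then show ?thesis using assms(2) Suc by simp
qed (use assms in simp)

lemma parallel_cmp_left:
  assumes uu: "parallel u u'" and i: "i < n" and c: "composable C (Suc i) n v u"
  shows "parallel (cmp C (Suc i) n v u) (cmp C (Suc i) n v u')"
proof -
  have c': "composable C (Suc i) n v u'"
    using uu i c parallel_bdto[OF uu, of i] by (simp add: composable_def parallel_def min_absorb1)
  \<comment> \<open>For composition along the top boundary, the source comes from \<open>v\<close>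
    and the target from \<open>u\<close> or \<open>u'\<close>. In lower dimension, the boundary of
    the composite is \<open>v\<close> composed with the boundary of \<open>u\<close> or
    \<open>u'\<close>. In both cases only the boundary of \<open>u\<close> enters.\<close>
  have "bd C e (n - 1) (cmp C (Suc i) n v u) = bd C e (n - 1) (cmp C (Suc i) n v u')" for e
  proof (cases "Suc i = n")
    case True
    then show ?thesis using c c' src_cmp[of n v] tgt_cmp[of n v] uu
      by (cases e) (auto simp: parallel_def)
  next
    case False
    then show ?thesis using i uu bd_cmp_less[OF _ _ c, of e] bd_cmp_less[OF _ _ c', of e]
      by (simp add: parallel_def)
  qed
  then show ?thesis
    using cmp_cell[OF _ c] cmp_cell[OF _ c'] i by (simp add: parallel_def max_absorb2)
qed

lemma parallel_cmp_right:
  assumes uu: "parallel u u'" and i: "i < n" and c: "composable C n (Suc i) u w"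
  shows "parallel (cmp C n (Suc i) u w) (cmp C n (Suc i) u' w)"
proof -
  have c': "composable C n (Suc i) u' w"
    using uu i c parallel_bdto[OF uu, of i] by (simp add: composable_def parallel_def min_absorb2)
  have "bd C e (n - 1) (cmp C n (Suc i) u w) = bd C e (n - 1) (cmp C n (Suc i) u' w)" for e
  proof (cases "Suc i = n")
    case True
    then show ?thesis using c c' src_cmp[of n _ w] tgt_cmp[of n _ w] uu
      by (cases e) (auto simp: parallel_def)
  next
    case False
    then show ?thesis using i uu bd_cmp_greater[OF _ _ c, of e] bd_cmp_greater[OF _ _ c', of e]
      by (simp add: parallel_def)
  qed
  then show ?thesis
    using cmp_cell[OF _ c] cmp_cell[OF _ c'] i by (simp add: parallel_def max_absorb1)
qed

text \<open>This supplies the bounding congruence \<open>R\<^sub>0\<close> of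
  \<open>generated_congruence_congruence\<close> whenever the generating pairs are parallel.\<close>

lemma congruence_parallel: "congruence n C {(u, u'). parallel u u'}"
proof -
  have "equiv (cells C n) {(u, u'). parallel u u'}"
    by (auto simp: equiv_def refl_on_def sym_def trans_def parallel_def)
  moreover have "parallel (cmp C n (Suc i) (cmp C (Suc i) n v u) w) (cmp C n (Suc i) (cmp C (Suc i) n v u') w)"
    if "parallel u u'" "i < n" "composable C (Suc i) n v u"
      "composable C n (Suc i) (cmp C (Suc i) n v u) w" for u u' i v w
    using that by (blast intro: parallel_cmp_left parallel_cmp_right)
  ultimately show ?thesis
    unfolding congruence_def by (fastforce simp: parallel_def equiv_def)
qed

end

section \<open>Coherence of a localization from a natural choice of cells\<close>

section \<open>Coherence of localizations\<close>

lemma bdto_same: "bdto C e k k u = u"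
  by (cases k) auto

lemma bdto_pred: "0 < n \<Longrightarrow> bdto C e (n - Suc 0) n u = bd C e (n - Suc 0) u"
  by (cases n) (auto simp: bdto_same)

lemma zigzag_composable:
  assumes "0 < n" "z \<in> zigzags n C" "z' \<in> zigzags n C"
    and "path_bd (edge_bd n C) Pos z = psrc z'"
  shows "composable (zigzag_precat n C) n n (Zigzag z) (Zigzag z')"
  using assms by (simp add: composable_def bdto_pred) (simp add: zigzag_precat_def path_bd.simps(1))

text \<open>The cells \<open>N x\<close> form a compatible choice of paths out of all objects
  \<open>x\<close>. Once they are inverted, \<open>N_cmp\<close> says that \<open>F\<close> equals
  \<open>N\<close> of its source followed by the inverse of \<open>N\<close> of its target, so a
  cell is determined by its boundary. \<open>N_tgt\<close> makes that zigzag well formed.\<close>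

lemma coherent_localization:
  fixes C :: "'c precat"
  assumes n: "0 < n"
    and bds: "\<And>F e. F \<in> cells C n \<Longrightarrow> bd C e (n - 1) F \<in> cells C (n - 1)"
    and N: "\<And>x. x \<in> cells C (n - 1) \<Longrightarrow> N x \<in> cells C n \<and> bd C Neg (n - 1) (N x) = x"
    and N_tgt: "\<And>F. F \<in> cells C n \<Longrightarrow>
      bd C Pos (n - 1) (N (bd C Pos (n - 1) F)) = bd C Pos (n - 1) (N (bd C Neg (n - 1) F))"
    and N_cmp: "\<And>F. F \<in> cells C n \<Longrightarrow> cmp C n n F (N (bd C Pos (n - 1) F)) = N (bd C Neg (n - 1) F)"
  shows "coherent n (localization n C)"
proof -
  define Z where "Z = zigzag_precat n C"
  define R where "R = generated_congruence n Z (zigzag_rel n C)"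
  have cellsZ: "cells Z n = Zigzag ` zigzags n C"
    by (simp add: Z_def zigzag_precat_def)
  have L: "cells (localization n C) n = (\<lambda>u. R `` {u}) ` Zigzag ` zigzags n C"
    "bd (localization n C) e i U = bd Z e i ` U" for e i U
    by (simp_all add: localization_def quotient_precat_def quot_class_def R_def Z_def zigzag_precat_def)
  show ?thesis
  proof (cases "\<exists>R\<^sub>0. congruence n Z R\<^sub>0 \<and> zigzag_rel n C \<subseteq> R\<^sub>0")
    case False
    \<comment> \<open>The intersection defining \<open>R\<close> is empty; treating this case separately makes it unnecessary
      to show that zigzags form a precategory.\<close>
    then have "R = UNIV" by (auto simp: R_def generated_congruence_def)
    then show ?thesis by (auto simp: coherent_def L)
  next
    case True
    then have cong: "congruence n Z R"
      unfolding R_def using generated_congruence_congruence by blast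
    note eqv = cong[unfolded congruence_def, THEN conjunct2, THEN conjunct1]
    define eq (infix "\<approx>" 50) where "z \<approx> z' \<longleftrightarrow> (Zigzag z, Zigzag z') \<in> R" for z z'
    let ?d = "edge_bd n C"
    have eq_refl: "z \<approx> z" if "z \<in> zigzags n C" for z
      using that eqv by (auto simp: eq_def equiv_def refl_on_def cellsZ)
    have eq_sym: "z' \<approx> z" if "z \<approx> z'" for z z'
      using that eqv by (auto simp: eq_def equiv_def dest: symD)
    have eq_trans [trans]: "z \<approx> z''" if "z \<approx> z'" "z' \<approx> z''" for z z' z''
      using that eqv unfolding eq_def equiv_def by (meson transD)
    have eq_in: "z \<in> zigzags n C" "z' \<in> zigzags n C" if "z \<approx> z'" for z z'
    proof -
      have "R \<subseteq> cells Z n \<times> cells Z n" using cong by (simp add: congruence_def)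
      then show "z \<in> zigzags n C" "z' \<in> zigzags n C" using that by (auto simp: eq_def cellsZ)
    qed
    have zz_in: "Path x ws \<in> zigzags n C \<longleftrightarrow>
        x \<in> cells C (n - 1) \<and> (\<forall>w\<in>set ws. fst w \<in> cells C n) \<and> chain ?d x ws" for x ws
      by (auto simp: zigzags_def paths_def)
    have ctx: "a \<odot> z \<odot> b \<approx> a \<odot> z' \<odot> b"
      if zz: "z \<approx> z'" and a: "a \<in> zigzags n C" "path_bd ?d Pos a = psrc z"
        and b: "b \<in> zigzags n C" "path_bd ?d Pos z = psrc b" for a b z z'
    proof -
      have az: "a \<odot> z \<in> zigzags n C" "path_bd ?d Pos (a \<odot> z) = psrc b"
        using a b eq_in[OF zz] unfolding zigzags_def by (auto intro!: pcomp_paths simp: path_bd.simps)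
      have c: "composable Z n n (Zigzag a) (Zigzag z)" "composable Z n n (Zigzag (a \<odot> z)) (Zigzag b)"
        unfolding Z_def using n a b az eq_in[OF zz] by (blast intro: zigzag_composable)+
      have cmpZ: "cmp Z n n (Zigzag p) (Zigzag q) = Zigzag (p \<odot> q)" for p q
        by (simp add: Z_def zigzag_precat_def)
      have "(cmp Z n (Suc i) (cmp Z (Suc i) n v u) w, cmp Z n (Suc i) (cmp Z (Suc i) n v u') w) \<in> R"
        if "(u, u') \<in> R" "i < n" "composable Z (Suc i) n v u" "composable Z n (Suc i) (cmp Z (Suc i) n v u) w"
        for u u' i v w
        using cong that unfolding congruence_def by blast
      \<comment> \<open>Stability is applied with \<open>i = n - 1\<close>, where the composition of
        zigzags is concatenation.\<close>
      from this[of "Zigzag z" "Zigzag z'" "n - 1" "Zigzag a" "Zigzag b"]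
      have "(cmp Z n n (cmp Z n n (Zigzag a) (Zigzag z)) (Zigzag b),
          cmp Z n n (cmp Z n n (Zigzag a) (Zigzag z')) (Zigzag b)) \<in> R"
        using zz c n cmpZ by (simp add: eq_def)
      then show ?thesis by (simp add: cmpZ eq_def pcomp_assoc)
    qed
    have rel: "z \<approx> z'" if "(Zigzag z, Zigzag z') \<in> zigzag_rel n C" for z z'
      using that generated_congruence_incl by (auto simp: eq_def R_def)
    let ?s = "bd C Neg (n - 1)" and ?t = "bd C Pos (n - 1)"
    \<comment> \<open>The canonical zigzag from \<open>x\<close> to \<open>y\<close>: forward along
      \<open>N x\<close>, then backward along \<open>N y\<close>. It depends on the end points
      alone.\<close>
    define nm where "nm x y = Path x [(N x, Pos), (N y, Neg)]" for x y
    note invr = rel[OF zz_inv_right] and invl = rel[OF zz_inv_left]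
    \<comment> \<open>A forward edge \<open>F\<close> is followed by \<open>N (?t F)\<close> and its
      inverse, and then \<open>F\<close> and \<open>N (?t F)\<close> merge into
      \<open>N (?s F)\<close>. A backward edge is followed by \<open>N (?s F)\<close> and its
      inverse; \<open>N (?s F)\<close> is expanded into \<open>F\<close> and
      \<open>N (?t F)\<close>, and the two occurrences of \<open>F\<close> cancel.\<close>
    have single: "Path (?d Neg w) [w] \<approx> nm (?d Neg w) (?d Pos w)" if w: "fst w \<in> cells C n" for w
    proof -
      obtain F e where Fe: "w = (F, e)" by (cases w)
      have F: "F \<in> cells C n" using w Fe by simp
      note Fs = bds[OF F] N[OF bds[OF F]] N_tgt[OF F] N_cmp[OF F]
      have comp: "Path (?s F) [(F, Pos), (N (?t F), Pos)] \<approx> Path (?s F) [(N (?s F), Pos)]"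
        using rel[OF zz_cmp, of F "N (?t F)"] Fs F n by (simp add: composable_def bdto_pred)
      show ?thesis
      proof (cases e)
        case Pos
        have "Path (?s F) [(F, Pos)] \<approx> Path (?s F) [(F, Pos), (N (?t F), Pos), (N (?t F), Neg)]"
          using ctx[OF eq_sym[OF invr[of "N (?t F)"]], of "Path (?s F) [(F, Pos)]" "id_path (?t F)"] F Fs
          by (simp add: zz_in pcomp_def path_bd.simps)
        also have "\<dots> \<approx> nm (?s F) (?t F)"
          using ctx[OF comp, of "id_path (?s F)" "Path (?t (N (?t F))) [(N (?t F), Neg)]"] F Fs bds[of "N (?s F)"]
          by (simp add: zz_in pcomp_def path_bd.simps nm_def)
        finally show ?thesis using Pos Fe by simp
      next
        case Neg
        have "Path (?t F) [(F, Neg)] \<approx> Path (?t F) [(F, Neg), (N (?s F), Pos), (N (?s F), Neg)]"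
          using ctx[OF eq_sym[OF invr[of "N (?s F)"]], of "Path (?t F) [(F, Neg)]" "id_path (?s F)"] F Fs
          by (simp add: zz_in pcomp_def path_bd.simps)
        also have "\<dots> \<approx> Path (?t F) [(F, Neg), (F, Pos), (N (?t F), Pos), (N (?s F), Neg)]"
          using ctx[OF eq_sym[OF comp], of "Path (?t F) [(F, Neg)]" "Path (?t (N (?s F))) [(N (?s F), Neg)]"] F Fs bds[of "N (?s F)"]
          by (simp add: zz_in pcomp_def path_bd.simps)
        also have "\<dots> \<approx> nm (?t F) (?s F)"
          using ctx[OF invl[OF F], of "id_path (?t F)" "Path (?t F) [(N (?t F), Pos), (N (?s F), Neg)]"] F Fs
          by (simp add: zz_in pcomp_def path_bd.simps nm_def)
        finally show ?thesis using Neg Fe by simp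
      qed
    qed
    have ebd: "?d e w \<in> cells C (n - 1)" if "fst w \<in> cells C n" for e w
      using bds[of "fst w"] that by (cases w; cases "snd w"; cases e) auto
    \<comment> \<open>Canonical zigzags compose: in \<open>nm x y \<odot> nm y z\<close> the inverse
      of \<open>N y\<close> meets \<open>N y\<close> and cancels. An induction on the edges thus
      reduces every zigzag to a canonical one.\<close>
    have main: "Path x ws \<approx> nm x (endpoint (?d Pos) x ws)" if "Path x ws \<in> zigzags n C" for x ws
      using that
    proof (induction ws arbitrary: x)
      case Nil
      then show ?case using N[of x] eq_sym[OF invr[of "N x"]] by (simp add: zz_in nm_def)
    next
      case (Cons w ws)
      define y where "y = ?d Pos w"
      define z where "z = endpoint (?d Pos) y ws"
      have w: "fst w \<in> cells C n" "x = ?d Neg w" and x: "x \<in> cells C (n - 1)"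
        using Cons.prems by (auto simp: zz_in)
      have y: "y \<in> cells C (n - 1)" unfolding y_def using ebd[OF w(1)] .
      have ws: "Path y ws \<in> zigzags n C" using Cons.prems y by (simp add: zz_in y_def)
      have z: "z \<in> cells C (n - 1)"
        unfolding z_def using y ws by (intro endpoint_in[of "{w. fst w \<in> cells C n}"]) (auto simp: zz_in intro!: ebd[simplified])
      note IH = Cons.IH[OF ws, folded z_def]
      note xy = single[OF w(1), folded y_def w(2)]
      note inx = eq_in(2)[OF xy, unfolded nm_def] and iny = eq_in(2)[OF IH, unfolded nm_def]
      have "Path x (w # ws) \<approx> nm x y \<odot> Path y ws"
        using ctx[OF xy, of "id_path x" "Path y ws"] ws x w by (simp add: zz_in pcomp_def path_bd.simps y_def nm_def)
      also have "\<dots> \<approx> nm x y \<odot> nm y z"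
        using ctx[OF IH, of "nm x y" "id_path z"] inx ws z N[OF y] iny
        by (simp add: zz_in pcomp_def path_bd.simps nm_def z_def)
      also have "\<dots> \<approx> nm x z"
        using ctx[OF invl[of "N y"], of "Path x [(N x, Pos)]" "Path (?t (N y)) [(N z, Neg)]"] inx iny N[OF x] N[OF y] bds[of "N x"]
        by (simp add: zz_in pcomp_def path_bd.simps nm_def)
      finally show ?case by (simp add: y_def z_def)
    qed
    show ?thesis
      unfolding coherent_def
    proof (intro ballI impI)
      fix u v assume u: "u \<in> cells (localization n C) n" and v: "v \<in> cells (localization n C) n"
        and uv: "\<forall>e. bd (localization n C) e (n - 1) u = bd (localization n C) e (n - 1) v"
      obtain p q where p: "u = R `` {Zigzag p}" "p \<in> zigzags n C" and q: "v = R `` {Zigzag q}" "q \<in> zigzags n C"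
        using u v by (auto simp: L)
      \<comment> \<open>The boundary of a class is the image of the whole class. It is a singleton
        because congruent zigzags have the same end points.\<close>
      have bdR: "bd Z e (n - 1) ` (R `` {Zigzag r}) = {Base (path_bd ?d e r)}" if "r \<in> zigzags n C" for e r
      proof -
        have "bd Z e (n - 1) s = bd Z e (n - 1) (Zigzag r)" if "s \<in> R `` {Zigzag r}" for s
          using that cong unfolding congruence_def by fastforce
        moreover have "Zigzag r \<in> R `` {Zigzag r}" using eq_refl[OF that] by (simp add: eq_def)
        moreover have "bd Z e (n - 1) (Zigzag r) = Base (path_bd ?d e r)"
          using n by (simp add: Z_def zigzag_precat_def)
        ultimately show ?thesis by (metis (no_types, lifting) image_cong image_constant)
      qed
      have pq: "path_bd ?d e p = path_bd ?d e q" for e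
        using uv unfolding L p(1) q(1) bdR[OF p(2)] bdR[OF q(2)] by simp
      have "p \<approx> nm (path_bd ?d Neg p) (path_bd ?d Pos p)" "q \<approx> nm (path_bd ?d Neg q) (path_bd ?d Pos q)"
        using main[of "psrc p" "edges p"] main[of "psrc q" "edges q"] p q by (simp_all add: path_bd.simps)
      then have "p \<approx> q" using pq eq_sym eq_trans by metis
      then show "u = v" using p q eqv by (simp add: eq_def equiv_class_eq)
    qed
  qed
qed

section \<open>Steps as single-edge paths, and normalization by well-founded induction\<close>

section \<open>Rewriting steps and rewriting paths\<close>

abbreviation whisk3 where
  "whisk3 \<kappa> l F r \<rho> \<equiv> \<kappa> \<rhd>\<^sub>1 (l \<rhd>\<^sub>0 F \<lhd>\<^sub>0 r) \<lhd>\<^sub>1 \<rho>"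

lemma cells3_first:
  assumes "Path x (s # ss) \<in> cells3 P"
  shows "s \<in> steps P" "step_bd P Neg s = x" "x \<in> cells2 P"
  using assms by (auto simp: cells3_def paths_def)

text \<open>The first edge determines the source of a nonempty path. Whiskered 3-cells can therefore
  be identified later by computing their edges only.\<close>

lemma cells3_eqI:
  assumes "F \<in> cells3 P" "G \<in> cells3 P" "edges F = edges G" "edges F \<noteq> []"
  shows "F = G"
  using assms by (cases F; cases G; cases "edges F") (auto dest: cells3_first(2))

context
  fixes P :: "('a0, 'a1, 'a2, 'a3, 'z) prepolygraph3_scheme"
  assumes P: "prepolygraph3 P"
begin

lemma cells3_Cons:
  "Path x (s # ss) \<in> cells3 P \<longleftrightarrow>
     s \<in> steps P \<and> x = step_bd P Neg s \<and> Path (step_bd P Pos s) ss \<in> cells3 P"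
  using step_bd_in[OF P] by (auto simp: cells3_def paths_def)

lemma step_in: "s \<in> steps P \<Longrightarrow> Path (step_bd P Neg s) [s] \<in> cells3 P"
  using step_bd_in[OF P] by (simp add: cells3_Cons id_in[OF P])

lemma bd2_step [simp]: "bd2 P e (Path (step_bd P Neg s) [s]) = step_bd P e s"
  by (cases e) (simp_all add: path_bd.simps)

lemma cells3_decomp:
  assumes "F \<in> cells3 P" "edges F = s # ss"
  defines "F' \<equiv> Path (step_bd P Pos s) ss"
  shows "s \<in> steps P" "bd2 P Neg F = step_bd P Neg s" "F' \<in> cells3 P" "bd2 P Pos F' = bd2 P Pos F"
    "F = Path (step_bd P Neg s) [s] \<odot> F'"
  using assms by (cases F; auto simp: cells3_Cons path_bd.simps pcomp_def)+

text \<open>This translates between the algebraic description of a rewriting step, as a whiskered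
  generator, and its normal form as a path with one edge.\<close>

lemma whisk3_gen3:
  assumes "A \<in> gens3 P" "sandwich P \<kappa> l (d2 P Neg A) r \<rho>"
  shows "whisk3 \<kappa> l (gen3 P A) r \<rho> = Path (step_bd P Neg (Step \<kappa> l A r \<rho>)) [Step \<kappa> l A r \<rho>]"
proof -
  note sa = assms(2)[unfolded sandwich_def between_def]
  \<comment> \<open>Whiskering leaves an identity in front of \<open>\<rho>\<close>. It is absorbed
    because its object is the source of \<open>\<rho>\<close>.\<close>
  have eq: "l \<odot> bd1 P Pos (d2 P Neg A) \<odot> r = psrc \<rho>" 
    using whisk2_in(2)[OF P, of l "d2 P Neg A" r Pos] assms(2) by (simp add: sandwich_def path_bd.simps(1))
  show ?thesis
    using sa eq by (simp add: gen3_def Let_def lwhisk31_def rwhisk31_def lwhisk30_def rwhisk30_def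
      pcomp_id_left pcomp_assoc psrc_bd[of r "d0 P"] gen3_bd(1)[OF P assms(1)] lr2)
qed

lemma rewriting_step_iff:
  "rewriting_step P S \<longleftrightarrow> (\<exists>s\<in>steps P. S = Path (step_bd P Neg s) [s])"
  by (fastforce simp: rewriting_step_def steps_def whisk3_gen3)

lemma sandwich_parallel:
  assumes "sandwich P \<kappa> l \<phi> r \<rho>" "\<phi>' \<in> cells2 P" "\<And>e. bd1 P e \<phi>' = bd1 P e \<phi>"
  shows "sandwich P \<kappa> l \<phi>' r \<rho>"
  using assms whisk2_in[OF P, of l \<phi> r] whisk2_in[OF P, of l \<phi>' r] by (simp add: sandwich_def)

lemma whisk3_in:
  assumes F: "F \<in> cells3 P" and sa: "sandwich P \<kappa> l (bd2 P Neg F) r \<rho>"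
  shows "whisk3 \<kappa> l F r \<rho> \<in> cells3 P" "bd2 P e (whisk3 \<kappa> l F r \<rho>) = \<kappa> \<odot> (l \<rhd> bd2 P e F \<lhd> r) \<odot> \<rho>"
proof -
  note b = sa[unfolded sandwich_def between_def]
  have 1: "l \<rhd>\<^sub>0 F \<in> cells3 P" "\<And>e. bd2 P e (l \<rhd>\<^sub>0 F) = l \<rhd> bd2 P e F"
    using lwhisk30_in[OF P, of l F] F b by auto
  have 2: "bd1 P e (l \<rhd> bd2 P Neg F) = l \<odot> bd1 P e (bd2 P Neg F)" for e
    using lwhisk2_in(2)[OF P] b by auto
  have 3: "l \<rhd>\<^sub>0 F \<lhd>\<^sub>0 r \<in> cells3 P" "\<And>e. bd2 P e (l \<rhd>\<^sub>0 F \<lhd>\<^sub>0 r) = l \<rhd> bd2 P e F \<lhd> r"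
    using rwhisk30_in[OF P, of r "l \<rhd>\<^sub>0 F"] 1 2 b by (auto simp: bd0_pcomp[OF P])
  have 4: "\<kappa> \<rhd>\<^sub>1 (l \<rhd>\<^sub>0 F \<lhd>\<^sub>0 r) \<in> cells3 P" "\<And>e. bd2 P e (\<kappa> \<rhd>\<^sub>1 (l \<rhd>\<^sub>0 F \<lhd>\<^sub>0 r)) = \<kappa> \<odot> (l \<rhd> bd2 P e F \<lhd> r)"
    using lwhisk31_in[OF P, of \<kappa>] 3 b by auto
  have 5: "bd1 P Pos (bd2 P Neg (\<kappa> \<rhd>\<^sub>1 (l \<rhd>\<^sub>0 F \<lhd>\<^sub>0 r))) = bd1 P Neg \<rho>"
    using 4(2) b by (simp add: bd1_pcomp[OF P])
  show "whisk3 \<kappa> l F r \<rho> \<in> cells3 P" "bd2 P e (whisk3 \<kappa> l F r \<rho>) = \<kappa> \<odot> (l \<rhd> bd2 P e F \<lhd> r) \<odot> \<rho>"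
    using rwhisk31_in[OF P, of \<rho> "\<kappa> \<rhd>\<^sub>1 (l \<rhd>\<^sub>0 F \<lhd>\<^sub>0 r)"] 4 5 b by (auto simp: pcomp_assoc)
qed

subsection \<open>Normalizing paths\<close>

text \<open>The target stands first, so that termination becomes well-foundedness.\<close>

definition rewrites_to where
  "rewrites_to = {(step_bd P Pos s, step_bd P Neg s) | s. s \<in> steps P}"

lemma wf_rewrites_to:
  assumes "terminating P"
  shows "wf rewrites_to"
  unfolding wf_iff_no_infinite_down_chain
proof
  assume "\<exists>f. \<forall>i. (f (Suc i), f i) \<in> rewrites_to"
  then obtain f where "\<forall>i. (f (Suc i), f i) \<in> rewrites_to" ..
  then have "\<forall>i. \<exists>s. s \<in> steps P \<and> f (Suc i) = step_bd P Pos s \<and> f i = step_bd P Neg s"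
    by (auto simp: rewrites_to_def)
  then obtain s where s: "\<And>i. s i \<in> steps P" "\<And>i. f (Suc i) = step_bd P Pos (s i)" "\<And>i. f i = step_bd P Neg (s i)"
    by metis
  have "\<exists>S. \<forall>i. rewriting_step P (S i) \<and> bd2 P Pos (S i) = bd2 P Neg (S (Suc i))"
  proof (intro exI allI conjI)
    fix i show "rewriting_step P (Path (step_bd P Neg (s i)) [s i])"
      using s(1) by (auto simp: rewriting_step_iff)
    show "bd2 P Pos (Path (step_bd P Neg (s i)) [s i]) = bd2 P Neg (Path (step_bd P Neg (s (Suc i))) [s (Suc i)])"
      using s by (metis bd2_step)
  qed
  then show False using assms by (simp add: terminating_def)
qed

definition irreducible where
  "irreducible \<phi> \<longleftrightarrow> (\<forall>s\<in>steps P. step_bd P Neg s \<noteq> \<phi>)"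

definition normalizes where
  "normalizes F \<longleftrightarrow> F \<in> cells3 P \<and> irreducible (bd2 P Pos F)"

lemma normalizes_pcomp:
  "\<lbrakk>F \<in> cells3 P; normalizes G; bd2 P Pos F = bd2 P Neg G\<rbrakk> \<Longrightarrow> normalizes (F \<odot> G)"
  by (simp add: normalizes_def cells3_pcomp[OF P] bd2_pcomp[OF P])

lemma normalizing_path_exists:
  assumes wf: "terminating P" and "\<phi> \<in> cells2 P"
  shows "\<exists>F. normalizes F \<and> bd2 P Neg F = \<phi>"
  using wf_rewrites_to[OF wf] assms(2)
proof (induction \<phi> rule: wf_induct_rule)
  case (less \<phi>)
  show ?case
  proof (cases "irreducible \<phi>")
    case True
    then show ?thesis using less.prems
      by (intro exI[of _ "id_path \<phi>"]) (auto simp: normalizes_def id_in[OF P])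
  next
    case False
    then obtain s where s: "s \<in> steps P" "\<phi> = step_bd P Neg s" by (auto simp: irreducible_def)
    then obtain F where F: "normalizes F" "bd2 P Neg F = step_bd P Pos s"
      using less.IH[of "step_bd P Pos s"] step_bd_in[OF P] by (auto simp: rewrites_to_def)
    then have "normalizes (Path (step_bd P Neg s) [s] \<odot> F)"
      using s step_in by (intro normalizes_pcomp) auto
    then show ?thesis using s(2) by (metis bd2_step src_pcomp)
  qed
qed

end

section \<open>The presented congruence, confluence diagrams and Newman's argument\<close>

section \<open>Confluence modulo the presented congruence\<close>

abbreviation equiv3 where
  "equiv3 Q F G \<equiv> (Cell3 F, Cell3 G) \<in> presentation_cong Q"

abbreviation (input) confluent where
  "confluent Q \<equiv> confluent_branching Q (presentation_cong Q)"

context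
  fixes Q :: "('a0, 'a1, 'a2, 'a3, 'a4, 'z) prepolygraph4_scheme"
  assumes Q: "prepolygraph4 Q"
begin

lemma prepolygraph3: "prepolygraph3 Q"
  using Q by (simp add: prepolygraph4_def)

text \<open>The two boundaries of a 4-generator are parallel 3-cells, so parallelism is a congruence
  that contains all generating pairs.\<close>

lemma congruence_presentation_cong: "congruence 3 (free_precat Q) (presentation_cong Q)"
proof -
  interpret F: precategory 3 "free_precat Q" by (rule free_precategory[OF prepolygraph3])
  have "{(Cell3 (d3 Q Neg R), Cell3 (d3 Q Pos R)) | R. R \<in> gens4 Q} \<subseteq> {(u, u'). F.parallel u u'}"
  proof clarify
    fix R assume "R \<in> gens4 Q"
    then show "F.parallel (Cell3 (d3 Q Neg R)) (Cell3 (d3 Q Pos R))"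
      using Q by (auto simp: F.parallel_def prepolygraph4_def free_precat_sel[OF prepolygraph3])
  qed
  with F.congruence_parallel show ?thesis
    unfolding presentation_cong_def by (rule generated_congruence_congruence)
qed

lemma equiv_presentation_cong: "equiv (Cell3 ` cells3 Q) (presentation_cong Q)"
  using congruence_presentation_cong by (simp add: congruence_def free_precat_sel[OF prepolygraph3])

lemma equiv3_in: "equiv3 Q F G \<Longrightarrow> F \<in> cells3 Q \<and> G \<in> cells3 Q"
  using equiv_presentation_cong by (auto simp: equiv_def)

lemma equiv3_bd2: "equiv3 Q F G \<Longrightarrow> bd2 Q e F = bd2 Q e G"
  using congruence_presentation_cong by (fastforce simp: congruence_def free_precat_sel[OF prepolygraph3])

lemma equiv3_refl: "F \<in> cells3 Q \<Longrightarrow> equiv3 Q F F"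
  using equiv_presentation_cong by (auto simp: equiv_def refl_on_def)

lemma equiv3_sym: "equiv3 Q F G \<Longrightarrow> equiv3 Q G F"
  using equiv_presentation_cong by (auto simp: equiv_def dest: symD)

lemma equiv3_trans: "equiv3 Q F G \<Longrightarrow> equiv3 Q G H \<Longrightarrow> equiv3 Q F H"
  using equiv_presentation_cong unfolding equiv_def by (meson transD)

lemma equiv3_gen4: "has_gen4 Q F G \<Longrightarrow> equiv3 Q F G"
  unfolding presentation_cong_def has_gen4_def
  by (rule subsetD[OF generated_congruence_incl]) auto

text \<open>Composition in \<open>free_precat\<close> does not inspect its dimension arguments, so
  contexts for all three compositions are covered at once: \<open>k\<close> is the dimension of
  \<open>v\<close> and \<open>w\<close>, hence \<open>k - 1\<close> that of the boundary composed
  along.\<close>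

lemma presentation_cong_ctx:
  assumes "(u, u') \<in> presentation_cong Q" "k = Suc 0 \<or> k = 2 \<or> k = 3"
    and "composable (free_precat Q) k 3 v u" "composable (free_precat Q) 3 k (free_cmp v u) w"
  shows "(free_cmp (free_cmp v u) w, free_cmp (free_cmp v u') w) \<in> presentation_cong Q"
proof -
  have "\<forall>i<3. \<forall>v w. composable (free_precat Q) (Suc i) 3 v u \<and> composable (free_precat Q) 3 (Suc i) (free_cmp v u) w
      \<longrightarrow> (free_cmp (free_cmp v u) w, free_cmp (free_cmp v u') w) \<in> presentation_cong Q"
    using congruence_presentation_cong assms(1) by (auto simp: congruence_def free_precat_sel[OF prepolygraph3])
  from this[rule_format, of "k - 1" v w] show ?thesis
    using assms(2-4) by (auto simp flip: numeral_2_eq_2)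
qed

lemma equiv3_pcomp:
  assumes "equiv3 Q F F'" "G \<in> cells3 Q" "H \<in> cells3 Q"
    and "bd2 Q Pos G = bd2 Q Neg F" "bd2 Q Pos F = bd2 Q Neg H"
  shows "equiv3 Q (G \<odot> F \<odot> H) (G \<odot> F' \<odot> H)"
  using presentation_cong_ctx[OF assms(1), of 3 "Cell3 G" "Cell3 H"] assms equiv3_in[OF assms(1)]
  by (simp add: free_composable[OF prepolygraph3] cells3_pcomp[OF prepolygraph3] bd2_pcomp[OF prepolygraph3] pcomp_assoc)

lemma equiv3_pcomp_left:
  assumes "equiv3 Q F F'" "G \<in> cells3 Q" "bd2 Q Pos G = bd2 Q Neg F"
  shows "equiv3 Q (G \<odot> F) (G \<odot> F')"
  using equiv3_pcomp[OF assms(1,2) id_in(3)[OF prepolygraph3 bd2_in[OF prepolygraph3]] assms(3), of F Pos] equiv3_in[OF assms(1)] by simp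

lemma equiv3_pcomp_right:
  assumes "equiv3 Q F F'" "H \<in> cells3 Q" "bd2 Q Pos F = bd2 Q Neg H"
  shows "equiv3 Q (F \<odot> H) (F' \<odot> H)"
  using equiv3_pcomp[OF assms(1) id_in(3)[OF prepolygraph3 bd2_in[OF prepolygraph3]] assms(2) _ assms(3), of F Neg]
    equiv3_in[OF assms(1)] equiv3_bd2[OF assms(1), of Neg] by (simp add: pcomp_id_left path_bd.simps(1))

text \<open>Two applications of stability: first whiskering by the 1-cells \<open>l\<close> and
  \<open>r\<close>, then by the 2-cells \<open>\<kappa>\<close> and \<open>\<rho>\<close>.\<close>

lemma equiv3_whisk3:
  assumes eq: "equiv3 Q F F'" and sa: "sandwich Q \<kappa> l (bd2 Q Neg F) r \<rho>"
  shows "equiv3 Q (whisk3 \<kappa> l F r \<rho>) (whisk3 \<kappa> l F' r \<rho>)"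
proof -
  note F = equiv3_in[OF eq, THEN conjunct1]
  note b = sa[unfolded sandwich_def between_def]
  have 1: "l \<rhd>\<^sub>0 F \<in> cells3 Q" "\<And>e. bd2 Q e (l \<rhd>\<^sub>0 F) = l \<rhd> bd2 Q e F"
    using lwhisk30_in[OF prepolygraph3, of l F] F b by auto
  have 2: "bd1 Q e (l \<rhd> bd2 Q Neg F) = l \<odot> bd1 Q e (bd2 Q Neg F)" for e
    using lwhisk2_in(2)[OF prepolygraph3] b by auto
  have 3: "l \<rhd>\<^sub>0 F \<lhd>\<^sub>0 r \<in> cells3 Q" "\<And>e. bd2 Q e (l \<rhd>\<^sub>0 F \<lhd>\<^sub>0 r) = l \<rhd> bd2 Q e F \<lhd> r"
    using rwhisk30_in[OF prepolygraph3, of r "l \<rhd>\<^sub>0 F"] 1 2 b by (auto simp: bd0_pcomp[OF prepolygraph3])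
  have 4: "\<kappa> \<rhd>\<^sub>1 (l \<rhd>\<^sub>0 F \<lhd>\<^sub>0 r) \<in> cells3 Q" "\<And>e. bd2 Q e (\<kappa> \<rhd>\<^sub>1 (l \<rhd>\<^sub>0 F \<lhd>\<^sub>0 r)) = \<kappa> \<odot> (l \<rhd> bd2 Q e F \<lhd> r)"
    using lwhisk31_in[OF prepolygraph3, of \<kappa>] 3 b by auto
  have "equiv3 Q (l \<rhd>\<^sub>0 F \<lhd>\<^sub>0 r) (l \<rhd>\<^sub>0 F' \<lhd>\<^sub>0 r)"
    using presentation_cong_ctx[OF eq, of "Suc 0" "Cell1 l" "Cell1 r"] F b 1 2
    by (simp add: free_composable[OF prepolygraph3] bd0_pcomp[OF prepolygraph3])
  from presentation_cong_ctx[OF this, of 2 "Cell2 \<kappa>" "Cell2 \<rho>"] show ?thesis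
    using b 3 4 by (simp add: free_composable[OF prepolygraph3] bd1_pcomp[OF prepolygraph3])
qed

lemma confluentI:
  "\<lbrakk>G\<^sub>1 \<in> cells3 Q; G\<^sub>2 \<in> cells3 Q; bd2 Q Pos F\<^sub>1 = bd2 Q Neg G\<^sub>1; bd2 Q Pos F\<^sub>2 = bd2 Q Neg G\<^sub>2;
    bd2 Q Pos G\<^sub>1 = bd2 Q Pos G\<^sub>2; equiv3 Q (F\<^sub>1 \<odot> G\<^sub>1) (F\<^sub>2 \<odot> G\<^sub>2)\<rbrakk> \<Longrightarrow> confluent Q F\<^sub>1 F\<^sub>2"
  unfolding confluent_branching_def by blast

lemma confluentE:
  assumes "confluent Q F\<^sub>1 F\<^sub>2"
  obtains G\<^sub>1 G\<^sub>2 where "G\<^sub>1 \<in> cells3 Q" "G\<^sub>2 \<in> cells3 Q" "bd2 Q Pos F\<^sub>1 = bd2 Q Neg G\<^sub>1" "bd2 Q Pos F\<^sub>2 = bd2 Q Neg G\<^sub>2"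
    "bd2 Q Pos G\<^sub>1 = bd2 Q Pos G\<^sub>2" "equiv3 Q (F\<^sub>1 \<odot> G\<^sub>1) (F\<^sub>2 \<odot> G\<^sub>2)"
  using assms unfolding confluent_branching_def by (elim bexE conjE) (rule that)

lemma confluent_sym: "confluent Q S\<^sub>1 S\<^sub>2 \<Longrightarrow> confluent Q S\<^sub>2 S\<^sub>1"
  by (erule confluentE, rule confluentI, assumption+, erule sym, erule equiv3_sym)

lemma confluent_refl: "S \<in> cells3 Q \<Longrightarrow> confluent Q S S"
  by (rule confluentI[of "id_path (bd2 Q Pos S)" "id_path (bd2 Q Pos S)"])
    (simp_all add: equiv3_refl id_in[OF prepolygraph3] bd2_in[OF prepolygraph3])

text \<open>The closing paths are whiskered along with the branching, and whiskering distributes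
  over \<open>\<odot>\<close>.\<close>

lemma confluent_whisk3:
  assumes conf: "confluent Q S\<^sub>1 S\<^sub>2" and br: "branching Q S\<^sub>1 S\<^sub>2" and sa: "sandwich Q \<kappa> l (bd2 Q Neg S\<^sub>1) r \<rho>"
  shows "confluent Q (whisk3 \<kappa> l S\<^sub>1 r \<rho>) (whisk3 \<kappa> l S\<^sub>2 r \<rho>)"
proof -
  from conf obtain G\<^sub>1 G\<^sub>2 where G: "G\<^sub>1 \<in> cells3 Q" "G\<^sub>2 \<in> cells3 Q" "bd2 Q Pos S\<^sub>1 = bd2 Q Neg G\<^sub>1"
    "bd2 Q Pos S\<^sub>2 = bd2 Q Neg G\<^sub>2" "bd2 Q Pos G\<^sub>1 = bd2 Q Pos G\<^sub>2" "equiv3 Q (S\<^sub>1 \<odot> G\<^sub>1) (S\<^sub>2 \<odot> G\<^sub>2)"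
    by (elim confluentE)
  have S: "S\<^sub>1 \<in> cells3 Q" "S\<^sub>2 \<in> cells3 Q" "bd2 Q Neg S\<^sub>1 = bd2 Q Neg S\<^sub>2" using br by (auto simp: branching_def)
  \<comment> \<open>All sources and targets in the diagram are parallel 2-cells, so the same context
    fits each of them.\<close>
  have sa': "sandwich Q \<kappa> l (bd2 Q e S) r \<rho>" if "S = S\<^sub>1 \<or> S = S\<^sub>2" for e S
    using that S by (intro sandwich_parallel[OF prepolygraph3 sa]) (cases e; auto simp: bd2_in[OF prepolygraph3] glob3[OF prepolygraph3])+
  note w = whisk3_in[OF prepolygraph3]
  have sG: "sandwich Q \<kappa> l (bd2 Q Neg G\<^sub>1) r \<rho>" "sandwich Q \<kappa> l (bd2 Q Neg G\<^sub>2) r \<rho>"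
    using sa'[of S\<^sub>1 Pos] sa'[of S\<^sub>2 Pos] G by auto
  have "equiv3 Q (whisk3 \<kappa> l (S\<^sub>1 \<odot> G\<^sub>1) r \<rho>) (whisk3 \<kappa> l (S\<^sub>2 \<odot> G\<^sub>2) r \<rho>)"
    using equiv3_whisk3[OF G(6)] sa by simp
  then show ?thesis
    using w[OF S(1) sa'[of S\<^sub>1 Neg]] w[OF S(2) sa'[of S\<^sub>2 Neg]] w[OF G(1) sG(1)] w[OF G(2) sG(2)] G(3-5)
    by (intro confluentI[of "whisk3 \<kappa> l G\<^sub>1 r \<rho>" "whisk3 \<kappa> l G\<^sub>2 r \<rho>"]) (simp_all add: w3_pcomp)
qed

text \<open>A 4-generator with nonempty boundaries is a confluence diagram for the first steps of
  these boundaries; the remaining steps are the closing paths.\<close>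

lemma confluent_gen4:
  assumes gen: "has_gen4 Q F G" and F: "edges F = s # ss" and G: "edges G = t # ts"
  shows "branching Q (Path (psrc F) [s]) (Path (psrc F) [t])" "confluent Q (Path (psrc F) [s]) (Path (psrc F) [t])"
proof -
  note eq = equiv3_gen4[OF gen]
  have in3: "F \<in> cells3 Q" "G \<in> cells3 Q" using equiv3_in[OF eq] by auto
  note dF = cells3_decomp[OF prepolygraph3 in3(1) F] and dG = cells3_decomp[OF prepolygraph3 in3(2) G]
  have src: "psrc F = step_bd Q Neg s" "psrc F = step_bd Q Neg t"
    using dF(2) dG(2) equiv3_bd2[OF eq, of Neg] by (simp_all add: path_bd.simps(1))
  show "branching Q (Path (psrc F) [s]) (Path (psrc F) [t])"
    using step_in[OF prepolygraph3 dF(1)] step_in[OF prepolygraph3 dG(1)] src unfolding branching_def by (simp add: path_bd.simps(1))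
  show "confluent Q (Path (psrc F) [s]) (Path (psrc F) [t])"
  proof (rule confluentI)
    show "equiv3 Q (Path (psrc F) [s] \<odot> Path (step_bd Q Pos s) ss) (Path (psrc F) [t] \<odot> Path (step_bd Q Pos t) ts)"
      using eq dF(5) dG(5) src by simp
    show "bd2 Q Pos (Path (step_bd Q Pos s) ss) = bd2 Q Pos (Path (step_bd Q Pos t) ts)"
      using dF(4) dG(4) equiv3_bd2[OF eq, of Pos] by simp
  qed (use dF dG in \<open>simp_all add: path_bd.simps\<close>)
qed

subsection \<open>From local confluence to uniqueness of normalizing paths\<close>

text \<open>Newman's argument, with equality of normal forms strengthened to equivalence of the
  paths that reach them. The induction is on the common source.\<close>

lemma normalizing_paths_equiv:
  assumes wf: "terminating Q"
    and loc: "\<And>S\<^sub>1 S\<^sub>2. local_branching Q S\<^sub>1 S\<^sub>2 \<Longrightarrow> confluent Q S\<^sub>1 S\<^sub>2"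
    and "normalizes Q F\<^sub>1" "normalizes Q F\<^sub>2" "bd2 Q Neg F\<^sub>1 = bd2 Q Neg F\<^sub>2"
  shows "equiv3 Q F\<^sub>1 F\<^sub>2"
  using wf_rewrites_to[OF prepolygraph3 wf] assms(3-5)
proof (induction "bd2 Q Neg F\<^sub>1" arbitrary: F\<^sub>1 F\<^sub>2 rule: wf_induct_rule)
  case less
  have F: "F\<^sub>1 \<in> cells3 Q" "F\<^sub>2 \<in> cells3 Q" using less.prems by (auto simp: normalizes_def[OF prepolygraph3])
  show ?case
  proof (cases "edges F\<^sub>1 = [] \<or> edges F\<^sub>2 = []")
    case True
    \<comment> \<open>If one path is empty, the common source is irreducible, so the other path has
      no first step either.\<close>
    have "F\<^sub>1 = F\<^sub>2"
    proof (cases "edges F\<^sub>1"; cases "edges F\<^sub>2")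
      assume "edges F\<^sub>1 = []" "edges F\<^sub>2 = []"
      then show ?thesis using less.prems(3) by (simp add: path_bd.simps(1) path.expand)
    next
      fix s ss assume e: "edges F\<^sub>1 = []" "edges F\<^sub>2 = s # ss"
      then have "bd2 Q Pos F\<^sub>1 = step_bd Q Neg s" using less.prems(3) cells3_decomp(2)[OF prepolygraph3 F(2) e(2)] by (simp add: path_bd.simps)
      then show ?thesis using less.prems(1) cells3_decomp(1)[OF prepolygraph3 F(2) e(2)]
        by (auto simp: normalizes_def[OF prepolygraph3] irreducible_def[OF prepolygraph3])
    next
      fix s ss assume e: "edges F\<^sub>2 = []" "edges F\<^sub>1 = s # ss"
      then have "bd2 Q Pos F\<^sub>2 = step_bd Q Neg s" using less.prems(3) cells3_decomp(2)[OF prepolygraph3 F(1) e(2)] by (simp add: path_bd.simps)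
      then show ?thesis using less.prems(2) cells3_decomp(1)[OF prepolygraph3 F(1) e(2)]
        by (auto simp: normalizes_def[OF prepolygraph3] irreducible_def[OF prepolygraph3])
    qed (use True in auto)
    then show ?thesis using F equiv3_refl by simp
  next
    case False
    then obtain s ss t ts where e: "edges F\<^sub>1 = s # ss" "edges F\<^sub>2 = t # ts" by (meson list.exhaust)
    note d1 = cells3_decomp[OF prepolygraph3 F(1) e(1)] and d2 = cells3_decomp[OF prepolygraph3 F(2) e(2)]
    define S T F\<^sub>1' F\<^sub>2' where defs: "S = Path (step_bd Q Neg s) [s]" "T = Path (step_bd Q Neg t) [t]"
      "F\<^sub>1' = Path (step_bd Q Pos s) ss" "F\<^sub>2' = Path (step_bd Q Pos t) ts"
    note d1 = d1[folded defs] and d2 = d2[folded defs]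
    have ST: "S \<in> cells3 Q" "T \<in> cells3 Q" "bd2 Q e S = step_bd Q e s" "bd2 Q e T = step_bd Q e t" for e
      using step_in[OF prepolygraph3] d1(1) d2(1) bd2_step[OF prepolygraph3] by (simp_all add: defs)
    have srcs: "step_bd Q Neg s = step_bd Q Neg t" using d1(2) d2(2) less.prems(3) by simp
    have src': "bd2 Q Neg F\<^sub>1' = step_bd Q Pos s" "bd2 Q Neg F\<^sub>2' = step_bd Q Pos t" by (simp_all add: defs path_bd.simps)
    have n': "normalizes Q F\<^sub>1'" "normalizes Q F\<^sub>2'"
      using less.prems(1,2) d1(3,4) d2(3,4) by (simp_all add: normalizes_def[OF prepolygraph3])
    have "local_branching Q S T"
      using ST srcs d1(1) d2(1) by (auto simp: local_branching_def branching_def rewriting_step_iff[OF prepolygraph3] defs)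
    then obtain G\<^sub>1 G\<^sub>2 where G: "G\<^sub>1 \<in> cells3 Q" "G\<^sub>2 \<in> cells3 Q" "bd2 Q Neg G\<^sub>1 = step_bd Q Pos s"
      "bd2 Q Neg G\<^sub>2 = step_bd Q Pos t" "bd2 Q Pos G\<^sub>1 = bd2 Q Pos G\<^sub>2" "equiv3 Q (S \<odot> G\<^sub>1) (T \<odot> G\<^sub>2)"
      using confluentE[OF loc[of S T]] ST(3,4) by metis
    \<comment> \<open>\<open>H\<close> continues the closed local branching to a normal form. The
      induction hypothesis, applied at the targets of \<open>s\<close> and \<open>t\<close>,
      compares each given tail with a closing path followed by \<open>H\<close>.\<close>
    obtain H where H: "normalizes Q H" "bd2 Q Neg H = bd2 Q Pos G\<^sub>1"
      using normalizing_path_exists[OF prepolygraph3 wf, of "bd2 Q Pos G\<^sub>1"] bd2_in[OF prepolygraph3] G(1) by auto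
    have H3: "H \<in> cells3 Q" using H(1) by (simp add: normalizes_def[OF prepolygraph3])
    have rel: "(bd2 Q Neg F\<^sub>1', bd2 Q Neg F\<^sub>1) \<in> rewrites_to Q" "(bd2 Q Neg F\<^sub>2', bd2 Q Neg F\<^sub>1) \<in> rewrites_to Q"
      using d1(1,2) d2(1) srcs by (auto simp: rewrites_to_def[OF prepolygraph3] src')
    have "equiv3 Q F\<^sub>1' (G\<^sub>1 \<odot> H)"
      by (rule less.hyps[OF rel(1) n'(1) normalizes_pcomp[OF prepolygraph3 G(1) H(1)]]) (use G H src' in simp_all)
    then have 1: "equiv3 Q (S \<odot> F\<^sub>1') (S \<odot> G\<^sub>1 \<odot> H)"
      by (rule equiv3_pcomp_left) (use ST src' in simp_all)
    have "equiv3 Q F\<^sub>2' (G\<^sub>2 \<odot> H)"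
      by (rule less.hyps[OF rel(2) n'(2) normalizes_pcomp[OF prepolygraph3 G(2) H(1)]]) (use G H src' in simp_all)
    then have 2: "equiv3 Q (T \<odot> F\<^sub>2') (T \<odot> G\<^sub>2 \<odot> H)"
      by (rule equiv3_pcomp_left) (use ST src' in simp_all)
    have 3: "equiv3 Q (S \<odot> G\<^sub>1 \<odot> H) (T \<odot> G\<^sub>2 \<odot> H)"
      using equiv3_pcomp_right[OF G(6) H3] G ST H by (simp add: bd2_pcomp[OF prepolygraph3] pcomp_assoc)
    show ?thesis using equiv3_trans[OF equiv3_trans[OF 1 3] equiv3_sym[OF 2]] d1(5) d2(5) by simp
  qed
qed

end

section \<open>Generators as confluence diagrams, and reduction to critical branchings\<close>

section \<open>Local confluence\<close>

text \<open>The outer loop counts \<open>i\<close> downwards and the inner one counts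
  \<open>j\<close> upwards, so the first swap moves the last whisker of \<open>\<phi>\<close> past
  the first of \<open>\<psi>\<close>. This is the swap that occurs in natural branchings.\<close>

lemma edges_interchange_cell:
  assumes "edges \<phi> \<noteq> []" "edges \<psi> \<noteq> []"
  shows "\<exists>ss. edges (interchange_cell Q \<phi> \<psi>) = edges (swap Q \<phi> \<psi> (length (edges \<phi>) - 1) 0) @ ss"
proof -
  have fold: "edges (foldl (\<odot>) p ps) = edges p @ concat (map edges ps)" for p :: "('x, 'w) path" and ps
    by (induction ps arbitrary: p) auto
  have "rev [0..<length (edges \<phi>)] = (length (edges \<phi>) - 1) # rev [0..<length (edges \<phi>) - 1]"
    using assms(1) by (cases "length (edges \<phi>)") auto
  moreover have "[0..<length (edges \<psi>)] = 0 # [1..<length (edges \<psi>)]"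
    using assms(2) by (simp add: upt_conv_Cons)
  ultimately show ?thesis
    by (simp add: interchange_cell_def fold)
qed

text \<open>With no typing assumptions, the identities contained in \<open>gen3\<close> cannot be
  absorbed; they survive as explicit sources in the last two components.\<close>

lemma edges_swap:
  fixes Q :: "('a0, 'a1, 'a2, 'a3, 'a4, 'z) gray_scheme"
  assumes "edges \<phi> ! i = Whisker f a g" "edges \<psi> ! j = Whisker f' b g'"
  defines "X \<equiv> interchange Q a (g \<odot> f') b"
  shows "edges (swap Q \<phi> \<psi> i j) = [Step
     ((pre2 i \<phi> \<lhd> psrc \<psi>) \<odot> ((f \<odot> d1 Q Neg a \<odot> g) \<rhd> pre2 j \<psi>)) f X (Path (bd0 Q Pos (bd1 Q Neg (d2 Q Neg X))) (edges g'))
     (Path (f \<odot> bd1 Q Pos (d2 Q Neg X) \<odot> g') (edges ((f \<odot> d1 Q Pos a \<odot> g) \<rhd> suf2 Q (Suc j) \<psi>) @ edges (suf2 Q (Suc i) \<phi> \<lhd> bd1 Q Pos \<psi>)))]"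
  using assms by (simp add: swap_def gen3_def Let_def lwhisk31_def rwhisk31_def lwhisk30_def rwhisk30_def pcomp_def path_bd.simps(1)[of "whisker_bd Q"])

context
  fixes Q :: "('a0, 'a1, 'a2, 'a3, 'a4, 'z) gray_scheme"
  assumes gray: "gray_presentation Q"
begin

lemma gray_prepolygraph4: "prepolygraph4 Q" and gray_prepolygraph3: "prepolygraph3 Q"
  using gray by (simp_all add: gray_presentation_def prepolygraph4_def)

lemma confluent_independent:
  assumes "independent_branching Q S\<^sub>1 S\<^sub>2"
  shows "confluent Q S\<^sub>1 S\<^sub>2"
proof -
  obtain A B e h e' h' \<chi> where A: "A \<in> gens3 Q" "B \<in> gens3 Q" "\<chi> \<in> cells2 Q"
    "between Q e (bd1 Q Neg (d2 Q Neg A)) h" "between Q e' (bd1 Q Neg (d2 Q Neg B)) h'"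
    "bd1 Q Pos (e \<rhd> d2 Q Neg A \<lhd> h) = bd1 Q Neg \<chi>" "bd1 Q Pos \<chi> = bd1 Q Neg (e' \<rhd> d2 Q Neg B \<lhd> h')"
    and S: "S\<^sub>1 = (e \<rhd>\<^sub>0 gen3 Q A \<lhd>\<^sub>0 h) \<lhd>\<^sub>1 (\<chi> \<odot> (e' \<rhd> d2 Q Neg B \<lhd> h'))"
      "S\<^sub>2 = ((e \<rhd> d2 Q Neg A \<lhd> h) \<odot> \<chi>) \<rhd>\<^sub>1 (e' \<rhd>\<^sub>0 gen3 Q B \<lhd>\<^sub>0 h')"
    using assms by (auto simp: independent_branching_def Let_def)
  define F where "F = S\<^sub>1 \<odot> (((e \<rhd> d2 Q Pos A \<lhd> h) \<odot> \<chi>) \<rhd>\<^sub>1 (e' \<rhd>\<^sub>0 gen3 Q B \<lhd>\<^sub>0 h'))"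
  define G where "G = S\<^sub>2 \<odot> ((e \<rhd>\<^sub>0 gen3 Q A \<lhd>\<^sub>0 h) \<lhd>\<^sub>1 (\<chi> \<odot> (e' \<rhd> d2 Q Pos B \<lhd> h')))"
  have gen: "has_gen4 Q F G"
    using gray A unfolding F_def G_def S gray_presentation_def has_independence_gens_def Let_def by blast
  obtain s t where st: "edges S\<^sub>1 = [s]" "edges S\<^sub>2 = [t]"
    by (simp add: S gen3_def Let_def lwhisk31_def rwhisk31_def lwhisk30_def rwhisk30_def)
  then obtain ss ts where e: "edges F = s # ss" "edges G = t # ts" by (simp add: F_def G_def)
  \<comment> \<open>\<open>confluent_gen4\<close> writes both steps with source
    \<open>psrc F\<close>, whereas \<open>S\<^sub>2\<close> inherits its source from
    \<open>G\<close>.\<close>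
  have "psrc G = psrc F"
    using equiv3_bd2[OF gray_prepolygraph4 equiv3_gen4[OF gray_prepolygraph4 gen], of Neg] by (simp add: path_bd.simps(1))
  then have "S\<^sub>1 = Path (psrc F) [s]" "S\<^sub>2 = Path (psrc F) [t]"
    using st by (cases S\<^sub>1; cases S\<^sub>2; simp add: F_def G_def)+
  then show ?thesis using confluent_gen4(2)[OF gray_prepolygraph4 gen e] by simp
qed

lemma confluent_gen4_whisk3:
  assumes gen: "has_gen4 Q F G" and e: "edges F = s # ss" "edges G = t # ts"
    and sa: "sandwich Q \<kappa> l (psrc F) r \<rho>"
    and S: "S\<^sub>1 \<in> cells3 Q" "S\<^sub>2 \<in> cells3 Q"
      "edges S\<^sub>1 = [rstep1 (lstep1 \<kappa> (rstep0 (lstep0 l s) r)) \<rho>]"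
      "edges S\<^sub>2 = [rstep1 (lstep1 \<kappa> (rstep0 (lstep0 l t) r)) \<rho>]"
  shows "confluent Q S\<^sub>1 S\<^sub>2"
proof -
  let ?S = "\<lambda>s :: (('a0, 'a1) cell1, ('a0, 'a1, 'a2) cell2, 'a3) step. Path (psrc F) [s]"
  note c = confluent_gen4[OF gray_prepolygraph4 gen e]
  have sa': "sandwich Q \<kappa> l (bd2 Q Neg (?S s)) r \<rho>" for s using sa by (simp add: path_bd.simps(1))
  have ed: "edges (whisk3 \<kappa> l (?S s) r \<rho>) = [rstep1 (lstep1 \<kappa> (rstep0 (lstep0 l s) r)) \<rho>]" for s
    by (simp add: lwhisk31_def rwhisk31_def lwhisk30_def rwhisk30_def)
  have "S\<^sub>1 = whisk3 \<kappa> l (?S s) r \<rho>" "S\<^sub>2 = whisk3 \<kappa> l (?S t) r \<rho>"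
    using S c(1) ed whisk3_in(1)[OF gray_prepolygraph3 _ sa'] by (auto intro!: cells3_eqI simp: branching_def)
  then show ?thesis using confluent_whisk3[OF gray_prepolygraph4 c(2,1) sa'] by simp
qed

lemma gen4_steps:
  assumes "has_gen4 Q F G" "edges F = s # ss" "edges G = t # ts"
  shows "s \<in> steps Q" "t \<in> steps Q" "step_bd Q Neg s = psrc F" "step_bd Q Neg t = psrc F"
proof -
  note eq = equiv3_gen4[OF gray_prepolygraph4 assms(1)]
  have in3: "F \<in> cells3 Q" "G \<in> cells3 Q" using equiv3_in[OF gray_prepolygraph4 eq] by auto
  show "s \<in> steps Q" "t \<in> steps Q" "step_bd Q Neg s = psrc F" "step_bd Q Neg t = psrc F"
    using cells3_decomp(1,2)[OF gray_prepolygraph3 in3(1) assms(2)] cells3_decomp(1,2)[OF gray_prepolygraph3 in3(2) assms(3)]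
      equiv3_bd2[OF gray_prepolygraph4 eq, of Neg] by (simp_all add: path_bd.simps(1))
qed

text \<open>The context of the first kind of natural branching: \<open>r\<close> is the right part
  of the first whisker of \<open>\<psi>\<close>, and \<open>\<rho>\<close> comes from its later
  whiskers. The identities on the other sides disappear from the steps.\<close>

lemma confluent_gen4_rwhisk:
  assumes gen: "has_gen4 Q F G" and e: "edges F = s # ss" "edges G = t # ts"
    and r: "r \<in> cells1 Q" "\<rho> \<in> cells2 Q" "bd0 Q Pos (bd1 Q Neg (psrc F)) = bd0 Q Neg r" "bd1 Q Pos (psrc F) \<odot> r = bd1 Q Neg \<rho>"
    and S: "S\<^sub>1 \<in> cells3 Q" "S\<^sub>2 \<in> cells3 Q" "edges S\<^sub>1 = [rstep1 (rstep0 s r) \<rho>]" "edges S\<^sub>2 = [rstep1 (rstep0 t r) \<rho>]"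
  shows "confluent Q S\<^sub>1 S\<^sub>2"
proof -
  let ?f = "bd1 Q Neg (psrc F)"
  note st = gen4_steps[OF gen e]
  have \<sigma>: "psrc F \<in> cells2 Q" using st step_bd_in[OF gray_prepolygraph3] by metis
  have f: "?f \<in> cells1 Q" "bd0 Q Neg ?f \<in> gens0 Q" using \<sigma> bd1_in[OF gray_prepolygraph3] bd0_in[OF gray_prepolygraph3] by blast+
  have b: "between Q (id_path (bd0 Q Neg ?f)) ?f r"
    using r f by (simp add: between_def id_in[OF gray_prepolygraph3])
  have i: "id_path (bd0 Q Neg ?f) \<odot> bd1 Q e (psrc F) = bd1 Q e (psrc F)" for e
    using glob2[OF gray_prepolygraph3 \<sigma>, of Neg] by (cases e) (simp_all add: pcomp_id_left path_bd.simps(1)[of "d0 Q"])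
  have sa: "sandwich Q (id_path (?f \<odot> r)) (id_path (bd0 Q Neg ?f)) (psrc F) r \<rho>"
    unfolding sandwich_def using b r \<sigma> f whisk2_in(2)[OF gray_prepolygraph3 b \<sigma>] i
    by (simp add: id_in[OF gray_prepolygraph3] cells1_pcomp[OF gray_prepolygraph3] flip: pcomp_assoc)
  have "rstep0 u r \<in> steps Q" "step_bd Q Neg (rstep0 u r) = psrc F \<lhd> r" if "u \<in> steps Q" "step_bd Q Neg u = psrc F" for u
    using rstep0_in[OF gray_prepolygraph3 that(1), of r Neg] that r by auto
  moreover have "bd1 Q Neg (psrc F \<lhd> r) = ?f \<odot> r" by (simp add: path_bd.simps(1)[of "whisker_bd Q"])
  ultimately have "lstep1 (id_path (?f \<odot> r)) (rstep0 (lstep0 (id_path (bd0 Q Neg ?f)) u) r) = rstep0 u r"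
    if "u \<in> steps Q" "step_bd Q Neg u = psrc F" for u
    using that by (simp add: lstep0_id[OF gray_prepolygraph3] lstep1_id[OF gray_prepolygraph3])
  then show ?thesis
    using confluent_gen4_whisk3[OF gen e sa S(1,2)] S(3,4) st by simp
qed

text \<open>The mirror context, for the second kind: \<open>l\<close> is the left part of the last
  whisker of \<open>\<phi>\<close>, and \<open>\<kappa>\<close> comes from the whiskers before
  it.\<close>

lemma confluent_gen4_lwhisk:
  assumes gen: "has_gen4 Q F G" and e: "edges F = s # ss" "edges G = t # ts"
    and l: "l \<in> cells1 Q" "\<kappa> \<in> cells2 Q" "bd0 Q Pos l = bd0 Q Neg (bd1 Q Neg (psrc F))" "bd1 Q Pos \<kappa> = l \<odot> bd1 Q Neg (psrc F)"
    and S: "S\<^sub>1 \<in> cells3 Q" "S\<^sub>2 \<in> cells3 Q" "edges S\<^sub>1 = [lstep1 \<kappa> (lstep0 l s)]" "edges S\<^sub>2 = [lstep1 \<kappa> (lstep0 l t)]"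
  shows "confluent Q S\<^sub>1 S\<^sub>2"
proof -
  let ?f = "bd1 Q Neg (psrc F)"
  note st = gen4_steps[OF gen e]
  have \<sigma>: "psrc F \<in> cells2 Q" using st step_bd_in[OF gray_prepolygraph3] by metis
  have f: "?f \<in> cells1 Q" "bd0 Q Pos ?f \<in> gens0 Q" using \<sigma> bd1_in[OF gray_prepolygraph3] bd0_in[OF gray_prepolygraph3] by blast+
  have b: "between Q l ?f (id_path (bd0 Q Pos ?f))"
    using l f by (simp add: between_def id_in[OF gray_prepolygraph3])
  have f': "l \<odot> bd1 Q Pos (psrc F) \<in> cells1 Q"
    using l \<sigma> bd1_in[OF gray_prepolygraph3] glob2[OF gray_prepolygraph3 \<sigma>] by (auto intro: cells1_pcomp[OF gray_prepolygraph3])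
  have sa: "sandwich Q \<kappa> l (psrc F) (id_path (bd0 Q Pos ?f)) (id_path (l \<odot> bd1 Q Pos (psrc F)))"
    unfolding sandwich_def using b l \<sigma> f f' whisk2_in(2)[OF gray_prepolygraph3 b \<sigma>]
    by (simp add: id_in[OF gray_prepolygraph3])
  have "lstep0 l u \<in> steps Q" "step_bd Q Neg (lstep0 l u) = l \<rhd> psrc F" if "u \<in> steps Q" "step_bd Q Neg u = psrc F" for u
    using lstep0_in[OF gray_prepolygraph3 that(1), of l Neg] that l by auto
  moreover have "bd1 Q Neg (l \<rhd> psrc F) = l \<odot> ?f" by (simp add: path_bd.simps(1)[of "whisker_bd Q"])
  ultimately have "rstep1 (lstep1 \<kappa> (rstep0 (lstep0 l u) (id_path (bd0 Q Pos ?f)))) (id_path (l \<odot> bd1 Q Pos (psrc F)))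
      = lstep1 \<kappa> (lstep0 l u)"
    if "u \<in> steps Q" "step_bd Q Neg u = psrc F" for u
    using that l lstep1_in[OF gray_prepolygraph3, of "lstep0 l u" \<kappa>] by (simp add: rstep0_id[OF gray_prepolygraph3] rstep1_id[OF gray_prepolygraph3])
  then show ?thesis
    using confluent_gen4_whisk3[OF gen e sa S(1,2)] S(3,4) st by simp
qed

text \<open>Naturality generators exist for a single 2-generator \<open>b\<close>, while
  \<open>\<psi>\<close> is arbitrary. The swap involves only the first whisker
  \<open>Whisker l b r\<close> of \<open>\<psi>\<close>, so the generator for \<open>A\<close>,
  \<open>g \<odot> l\<close> and \<open>b\<close> suffices, whiskered by \<open>r\<close> and
  followed by the rest of \<open>\<psi>\<close>.\<close>

lemma confluent_natural_left:
  assumes A: "A \<in> gens3 Q" and \<psi>: "\<psi> \<in> cells2 Q"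
    and b: "between Q (bd1 Q Neg (d2 Q Neg A)) g (bd1 Q Neg \<psi>)" and ne: "edges (d2 Q Neg A) \<noteq> []" "edges \<psi> \<noteq> []"
    and S\<^sub>1: "S\<^sub>1 = (gen3 Q A \<lhd>\<^sub>0 (g \<odot> bd1 Q Neg \<psi>)) \<lhd>\<^sub>1 ((bd1 Q Pos (d2 Q Neg A) \<odot> g) \<rhd> \<psi>)"
    and S\<^sub>2: "S\<^sub>2 = swap Q (d2 Q Neg A) (g \<rhd> \<psi>) (length (edges (d2 Q Neg A)) - 1) 0"
    and S: "S\<^sub>1 \<in> cells3 Q" "S\<^sub>2 \<in> cells3 Q"
  shows "confluent Q S\<^sub>1 S\<^sub>2"
proof -
  let ?\<phi> = "d2 Q Neg A" and ?k = "length (edges (d2 Q Neg A)) - 1"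
  let ?f = "bd1 Q Neg ?\<phi>" and ?f' = "bd1 Q Pos ?\<phi>"
  obtain w ws where w: "edges \<psi> = w # ws" using ne(2) by (cases "edges \<psi>") auto
  obtain l b r where lbr: "w = Whisker l b r" by (cases w)
  have w3: "b \<in> gens2 Q" "between Q l (d1 Q Neg b) r" and src\<psi>: "psrc \<psi> = l \<odot> d1 Q Neg b \<odot> r"
    and tail: "Path (l \<odot> d1 Q Pos b \<odot> r) ws \<in> cells2 Q"
    using \<psi> w lbr whisker_bd_in[OF gray_prepolygraph3, of w Pos] by (auto simp: cells2_def paths_def whiskers_def)
  obtain p a q where paq: "edges ?\<phi> ! ?k = Whisker p a q" by (cases "edges ?\<phi> ! ?k")
  have \<phi>: "?\<phi> \<in> cells2 Q" using gen3_bd(1)[OF gray_prepolygraph3 A] .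
  \<comment> \<open>The swap whiskers the rest of \<open>\<psi>\<close> by the target of the last
    whisker of \<open>d2 Q Neg A\<close>, the step \<open>S\<^sub>1\<close> by the target of the
    whole 2-cell; the two agree.\<close>
  have f': "?f' = p \<odot> d1 Q Pos a \<odot> q"
  proof -
    have "last (edges ?\<phi>) = Whisker p a q" using ne(1) paq by (simp add: last_conv_nth)
    then have "edges ?\<phi> = butlast (edges ?\<phi>) @ [Whisker p a q]" using ne(1) by (metis append_butlast_last_id)
    then show ?thesis by (metis path_bd.simps(2) endpoint_append endpoint.simps whisker_bd.simps)
  qed
  define G where "G = g \<odot> l"
  define \<beta> where "\<beta> = G \<rhd> gen2 Q b"
  have bG: "between Q ?f G (d1 Q Neg b)"
    using b w3(2) src\<psi> unfolding G_def between_def by (auto simp: cells1_pcomp[OF gray_prepolygraph3] bd0_pcomp[OF gray_prepolygraph3] path_bd.simps(1)[of "whisker_bd Q"])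
  define F where "F = ((gen3 Q A \<lhd>\<^sub>0 (G \<odot> d1 Q Neg b)) \<lhd>\<^sub>1 ((?f' \<odot> G) \<rhd> gen2 Q b)) \<odot> interchange_cell Q (d2 Q Pos A) \<beta>"
  define F' where "F' = interchange_cell Q ?\<phi> \<beta> \<odot> (((?f \<odot> G) \<rhd> gen2 Q b) \<rhd>\<^sub>1 (gen3 Q A \<lhd>\<^sub>0 (G \<odot> d1 Q Pos b)))"
  have gen: "has_gen4 Q F F'"
    using gray A w3 bG unfolding F_def F'_def \<beta>_def gray_presentation_def has_naturality_gens_def Let_def by blast
  \<comment> \<open>\<open>s\<close>, and \<open>t\<close> below, are the first steps of the two
    boundaries of the generator. Identity factors are kept so that they match the unfolded
    \<open>gen3\<close> and \<open>swap\<close>.\<close>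
  define s where "s = Step (id_path ?f \<lhd> (G \<odot> d1 Q Neg b)) (id_path (bd0 Q Neg ?f)) A
    (id_path (bd0 Q Pos ?f) \<odot> G \<odot> d1 Q Neg b) ((id_path ?f' \<lhd> (G \<odot> d1 Q Neg b)) \<odot> ((?f' \<odot> G) \<rhd> gen2 Q b))"
  obtain ss where eF: "edges F = s # ss"
    by (simp add: F_def gen3_def Let_def rwhisk31_def rwhisk30_def s_def)
  have e\<beta>: "edges \<beta> = [Whisker G b (id_path (bd0 Q Pos (d1 Q Neg b)))]" "psrc \<beta> = G \<odot> d1 Q Neg b"
    by (simp_all add: \<beta>_def gen2_def lwhisk2_def)
  define X where "X = interchange Q a (q \<odot> G) b"
  define t where "t = Step ((pre2 ?k ?\<phi> \<lhd> (G \<odot> d1 Q Neg b)) \<odot> ((p \<odot> d1 Q Neg a \<odot> q) \<rhd> id_path (G \<odot> d1 Q Neg b)))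
    p X (id_path (bd0 Q Pos (bd1 Q Neg (d2 Q Neg X)))) (id_path (p \<odot> bd1 Q Pos (d2 Q Neg X) \<odot> id_path (bd0 Q Pos (d1 Q Neg b))))"
  have t: "edges (swap Q ?\<phi> \<beta> ?k 0) = [t]"
    using edges_swap[where Q=Q, OF paq, of \<beta> 0 G b] e\<beta> ne(1)
    by (simp add: t_def X_def pre2_def suf2_def lwhisk2_def rwhisk2_def)
  obtain ts where eF': "edges F' = t # ts"
    using edges_interchange_cell[of ?\<phi> \<beta> Q] ne(1) e\<beta> t by (auto simp: F'_def)
  \<comment> \<open>The whiskers of \<open>\<psi>\<close> after the first, placed to the right of
    the target of \<open>A\<close>.\<close>
  define \<rho> where "\<rho> = (?f' \<odot> g) \<rhd> Path (l \<odot> d1 Q Pos b \<odot> r) ws"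
  have r: "r \<in> cells1 Q" "l \<in> cells1 Q" "bd0 Q Pos l = bd0 Q Neg (d1 Q Neg b)" "bd0 Q Pos (d1 Q Neg b) = bd0 Q Neg r"
    using w3(2) by (simp_all add: between_def)
  have fG: "?f \<in> cells1 Q" "G \<in> cells1 Q" "bd0 Q Pos ?f = bd0 Q Neg G" "bd0 Q Pos G = bd0 Q Neg (d1 Q Neg b)"
    using bG by (simp_all add: between_def)
  have f'G: "?f' \<in> cells1 Q" "bd0 Q Pos ?f' = bd0 Q Neg G"
    using bd1_in[OF gray_prepolygraph3 \<phi>] glob2[OF gray_prepolygraph3 \<phi>] fG by auto
  have f'g: "?f' \<odot> g \<in> cells1 Q" "bd0 Q Pos (?f' \<odot> g) = bd0 Q Neg l"
  proof -
    have "bd0 Q Neg (bd1 Q Neg \<psi>) = bd0 Q Neg l"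
      using src\<psi> r by (simp add: path_bd.simps(1))
    then show "?f' \<odot> g \<in> cells1 Q" "bd0 Q Pos (?f' \<odot> g) = bd0 Q Neg l"
      using b f'G fG by (auto simp: between_def bd0_pcomp[OF gray_prepolygraph3] cells1_pcomp[OF gray_prepolygraph3])
  qed
  note \<beta>' = gen2_in[OF gray_prepolygraph3 w3(1)]
  have srcF: "psrc F = (?\<phi> \<lhd> (G \<odot> d1 Q Neg b)) \<odot> ((?f' \<odot> G) \<rhd> gen2 Q b)"
    by (simp add: F_def gen3_def Let_def)
  show ?thesis
  proof (rule confluent_gen4_rwhisk[OF gen eF eF'])
    show "r \<in> cells1 Q" by (fact r)
    show "bd0 Q Pos (bd1 Q Neg (psrc F)) = bd0 Q Neg r"
    proof -
      have "bd1 Q Neg (psrc F) = ?f \<odot> G \<odot> d1 Q Neg b"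
        by (simp add: srcF path_bd.simps(1)[of "whisker_bd Q"])
      then show ?thesis using fG r by (simp add: bd0_pcomp[OF gray_prepolygraph3])
    qed
    show "\<rho> \<in> cells2 Q"
      unfolding \<rho>_def
      by (rule lwhisk2_in(1)[OF gray_prepolygraph3 f'g(1) tail]) (simp add: f'g(2) path_bd.simps(1))
    show "bd1 Q Pos (psrc F) \<odot> r = bd1 Q Neg \<rho>"
    proof -
      have 1: "bd1 Q Pos (?\<phi> \<lhd> (G \<odot> d1 Q Neg b)) = ?f' \<odot> G \<odot> d1 Q Neg b"
        using fG gen2_bd(1)[OF gray_prepolygraph3 w3(1)] by (intro rwhisk2_in(2)[OF gray_prepolygraph3 _ \<phi>]) (simp_all add: cells1_pcomp[OF gray_prepolygraph3] bd0_pcomp[OF gray_prepolygraph3])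
      have 2: "bd1 Q e ((?f' \<odot> G) \<rhd> gen2 Q b) = (?f' \<odot> G) \<odot> d1 Q e b" for e
        using f'G fG \<beta>' lwhisk2_in(2)[OF gray_prepolygraph3, of "?f' \<odot> G" "gen2 Q b" e] by (simp add: cells1_pcomp[OF gray_prepolygraph3] bd0_pcomp[OF gray_prepolygraph3])
      have "bd1 Q Pos (psrc F) = (?f' \<odot> G) \<odot> d1 Q Pos b"
        using 1 2 by (simp add: srcF bd1_pcomp[OF gray_prepolygraph3] pcomp_assoc)
      then show ?thesis by (simp add: \<rho>_def path_bd.simps(1)[of "whisker_bd Q"] G_def pcomp_assoc)
    qed
    show "edges S\<^sub>1 = [rstep1 (rstep0 s r) \<rho>]"
      using w lbr src\<psi> r(4)
      by (simp add: S\<^sub>1 s_def \<rho>_def G_def gen3_def gen2_def Let_def lwhisk31_def rwhisk31_def lwhisk30_def rwhisk30_def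
        lwhisk2_def rwhisk2_def pcomp_def path_bd.simps(1))
    show "edges S\<^sub>2 = [rstep1 (rstep0 t r) \<rho>]"
      using edges_swap[where Q=Q, OF paq, of "g \<rhd> \<psi>" 0 "g \<odot> l" b r] w lbr src\<psi> ne(1) f'
      by (simp add: S\<^sub>2 t_def X_def \<rho>_def G_def pre2_def suf2_def lwhisk2_def rwhisk2_def rwhisk_comp lwhisk_comp pcomp_assoc o_def) (simp add: pcomp_def)
  qed (fact S)+
qed

text \<open>Dually, only the last whisker \<open>Whisker l a r\<close> of \<open>\<phi>\<close>
  takes part in the swap: \<open>r\<close> is absorbed into the middle 1-cell, \<open>l\<close>
  whiskers on the left, and the earlier whiskers of \<open>\<phi>\<close> come before the
  diagram.\<close>

lemma confluent_natural_right:
  assumes B: "B \<in> gens3 Q" and \<phi>: "\<phi> \<in> cells2 Q"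
    and bt: "between Q (bd1 Q Neg \<phi>) g (bd1 Q Neg (d2 Q Neg B))" and ne: "edges \<phi> \<noteq> []" "edges (d2 Q Neg B) \<noteq> []"
    and S\<^sub>1: "S\<^sub>1 = (\<phi> \<lhd> (g \<odot> bd1 Q Neg (d2 Q Neg B))) \<rhd>\<^sub>1 ((bd1 Q Pos \<phi> \<odot> g) \<rhd>\<^sub>0 gen3 Q B)"
    and S\<^sub>2: "S\<^sub>2 = swap Q (\<phi> \<lhd> g) (d2 Q Neg B) (length (edges \<phi>) - 1) 0"
    and S: "S\<^sub>1 \<in> cells3 Q" "S\<^sub>2 \<in> cells3 Q"
  shows "confluent Q S\<^sub>1 S\<^sub>2"
proof -
  let ?\<psi> = "d2 Q Neg B" and ?k = "length (edges \<phi>) - 1"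
  let ?h = "bd1 Q Neg ?\<psi>"
  define ws where "ws = butlast (edges \<phi>)"
  obtain l a r where lar: "last (edges \<phi>) = Whisker l a r" by (cases "last (edges \<phi>)")
  have e\<phi>: "edges \<phi> = ws @ [Whisker l a r]"
    using ne(1) lar unfolding ws_def by (metis append_butlast_last_id)
  have f': "bd1 Q Pos \<phi> = l \<odot> d1 Q Pos a \<odot> r"
    by (simp add: path_bd.simps(2) e\<phi>)
  have w3: "a \<in> gens2 Q" "between Q l (d1 Q Neg a) r" and init: "Path (psrc \<phi>) ws \<in> cells2 Q"
    and tgt_ws: "endpoint (whisker_bd Q Pos) (psrc \<phi>) ws = l \<odot> d1 Q Neg a \<odot> r"
    using \<phi> by (auto simp: cells2_def paths_def e\<phi> whiskers_def)
  obtain p b q where pbq: "edges ?\<psi> ! 0 = Whisker p b q" by (cases "edges ?\<psi> ! 0")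
  have \<psi>: "?\<psi> \<in> cells2 Q" using gen3_bd(1)[OF gray_prepolygraph3 B] .
  have r: "r \<in> cells1 Q" "l \<in> cells1 Q" "bd0 Q Pos l = bd0 Q Neg (d1 Q Neg a)" "bd0 Q Pos (d1 Q Neg a) = bd0 Q Neg r"
    "d1 Q Neg a \<in> cells1 Q"
    using w3(2) by (simp_all add: between_def)
  define G where "G = r \<odot> g"
  have g: "g \<in> cells1 Q" "?h \<in> cells1 Q" "bd0 Q Pos g = bd0 Q Neg ?h" "bd0 Q Pos (bd1 Q Pos \<phi>) = bd0 Q Neg g"
    "bd0 Q Pos (bd1 Q Neg \<phi>) = bd0 Q Neg g"
    using bt glob2[OF gray_prepolygraph3 \<phi>] by (simp_all add: between_def)
  have a': "bd0 Q e (d1 Q Pos a) = bd0 Q e (d1 Q Neg a)" "d1 Q Pos a \<in> cells1 Q" for e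
    using gen2_bd[OF gray_prepolygraph3 w3(1)] by blast+
  have rg: "bd0 Q Pos r = bd0 Q Neg g"
    using g(4) r a' by (simp add: f' bd0_pcomp[OF gray_prepolygraph3])
  have bG: "between Q (d1 Q Neg a) G ?h"
    using r g rg by (simp add: between_def G_def cells1_pcomp[OF gray_prepolygraph3] bd0_pcomp[OF gray_prepolygraph3])
  define \<alpha> where "\<alpha> = gen2 Q a \<lhd> G"
  define F where "F = ((gen2 Q a \<lhd> (G \<odot> ?h)) \<rhd>\<^sub>1 ((d1 Q Pos a \<odot> G) \<rhd>\<^sub>0 gen3 Q B)) \<odot> interchange_cell Q \<alpha> (d2 Q Pos B)"
  define F' where "F' = interchange_cell Q \<alpha> ?\<psi> \<odot> (((d1 Q Neg a \<odot> G) \<rhd>\<^sub>0 gen3 Q B) \<lhd>\<^sub>1 (gen2 Q a \<lhd> (G \<odot> bd1 Q Pos ?\<psi>)))"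
  have gen: "has_gen4 Q F F'"
    using gray B w3 bG unfolding F_def F'_def \<alpha>_def gray_presentation_def has_naturality_gens_def Let_def by blast
  define s where "s = lstep1 (gen2 Q a \<lhd> (G \<odot> ?h)) (lstep0 (d1 Q Pos a \<odot> G)
    (Step (id_path ?h) (id_path (bd0 Q Neg ?h)) B (id_path (bd0 Q Pos ?h)) (id_path (bd1 Q Pos ?\<psi>))))"
  obtain ss where eF: "edges F = s # ss"
    by (simp add: F_def gen3_def Let_def lwhisk31_def lwhisk30_def s_def)
  \<comment> \<open>The source and target of \<open>a\<close> start at the same 0-cell, so the
    identity to the left of \<open>a\<close> in \<open>gen2\<close> can be absorbed.\<close>
  have src_a: "bd0 Q Neg (d1 Q e a) = psrc (d1 Q Neg a)" for e
    using a'(1)[of Neg] by (cases e) (simp_all add: path_bd.simps(1))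
  have e\<alpha>: "edges \<alpha> = [Whisker (id_path (psrc (d1 Q Neg a))) a G]" "psrc \<alpha> = d1 Q Neg a \<odot> G"
    using bG by (simp_all add: \<alpha>_def gen2_def rwhisk2_def src_a pcomp_id_left between_def path_bd.simps(1)[of "d0 Q"])
  define X where "X = interchange Q a (G \<odot> p) b"
  define t where "t = Step (id_path (d1 Q Neg a \<odot> G \<odot> psrc ?\<psi>)) (id_path (psrc (d1 Q Neg a))) X
    (Path (bd0 Q Pos (bd1 Q Neg (d2 Q Neg X))) (edges q))
    (Path (id_path (psrc (d1 Q Neg a)) \<odot> bd1 Q Pos (d2 Q Neg X) \<odot> q) (edges ((d1 Q Pos a \<odot> G) \<rhd> suf2 Q (Suc 0) ?\<psi>)))"
  have src_a': "psrc (d1 Q Pos a) = psrc (d1 Q Neg a)" using src_a[of Pos] by (simp add: path_bd.simps(1)[of "d0 Q"])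
  have t: "edges (swap Q \<alpha> ?\<psi> 0 0) = [t]"
    using edges_swap[where Q=Q, of \<alpha> 0 _ a G ?\<psi> 0 p b q] e\<alpha> pbq src_a'
    by (simp add: t_def X_def pre2_def suf2_def lwhisk2_def rwhisk2_def pcomp_id_left pcomp_assoc)
  obtain ts where eF': "edges F' = t # ts"
    using edges_interchange_cell[of \<alpha> ?\<psi> Q] ne(2) e\<alpha> t by (auto simp: F'_def)
  have srcF: "psrc F = (gen2 Q a \<lhd> (G \<odot> ?h)) \<odot> ((d1 Q Pos a \<odot> G) \<rhd> ?\<psi>)"
    by (simp add: F_def gen3_def Let_def)
  then have bd_srcF: "bd1 Q Neg (psrc F) = d1 Q Neg a \<odot> G \<odot> ?h"
    by (simp add: path_bd.simps(1)[of "whisker_bd Q"] gen2_def)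
  \<comment> \<open>The whiskers of \<open>\<phi>\<close> before the last, placed to the left of the
    source of \<open>B\<close>.\<close>
  define \<kappa> where "\<kappa> = Path (psrc \<phi>) ws \<lhd> (g \<odot> ?h)"
  have gh: "g \<odot> ?h \<in> cells1 Q" using g by (simp add: cells1_pcomp[OF gray_prepolygraph3])
  have cond: "bd0 Q Pos (bd1 Q Neg (Path (psrc \<phi>) ws)) = bd0 Q Neg (g \<odot> ?h)"
    using g by (simp add: path_bd.simps(1)[of "whisker_bd Q"] bd0_pcomp[OF gray_prepolygraph3])
  note \<kappa>' = rwhisk2_in[OF gray_prepolygraph3 gh init cond, folded \<kappa>_def]
  show ?thesis
  proof (rule confluent_gen4_lwhisk[OF gen eF eF'])
    show "l \<in> cells1 Q" by (fact r)
    show "\<kappa> \<in> cells2 Q" by (fact \<kappa>')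
    show "bd0 Q Pos l = bd0 Q Neg (bd1 Q Neg (psrc F))"
      using r by (simp add: bd_srcF path_bd.simps(1)[of "d0 Q"])
    show "bd1 Q Pos \<kappa> = l \<odot> bd1 Q Neg (psrc F)"
      unfolding \<kappa>'(2) bd_srcF by (simp add: path_bd.simps(2)[of _ "Path (psrc \<phi>) ws"] tgt_ws G_def pcomp_assoc)
    show "edges S\<^sub>1 = [lstep1 \<kappa> (lstep0 l s)]"
      using e\<phi> f' r(4) src_a'
      by (simp add: S\<^sub>1 s_def \<kappa>_def G_def gen3_def gen2_def Let_def lwhisk31_def rwhisk31_def lwhisk30_def rwhisk30_def
        lwhisk2_def rwhisk2_def pcomp_def path_bd.simps(1))
    show "edges S\<^sub>2 = [lstep1 \<kappa> (lstep0 l t)]"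
    proof -
      have "edges (\<phi> \<lhd> g) ! ?k = Whisker l a (r \<odot> g)" by (simp add: rwhisk2_def e\<phi> nth_append)
      from edges_swap[where Q=Q, OF this pbq] show ?thesis
        unfolding S\<^sub>2 using e\<phi> src_a'
        by (simp add: t_def X_def \<kappa>_def G_def pre2_def suf2_def lwhisk2_def rwhisk2_def rwhisk_comp lwhisk_comp pcomp_assoc o_def path_bd.simps(1))
          (simp add: pcomp_def)
    qed
  qed (fact S)+
qed

end

text \<open>The size of the context around the generator. Removing a nontrivial context from a
  branching lowers it strictly.\<close>

fun step_size :: "(('a0, 'a1) cell1, ('a0, 'a1, 'a2) cell2, 'a3) step \<Rightarrow> nat" where
  "step_size (Step \<kappa> l A r \<rho>) = length (edges \<kappa>) + length (edges l) + length (edges r) + length (edges \<rho>)"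

text \<open>Induction on the context of the first step; as both steps of a whiskered branching carry
  the added context, measuring one of them is enough. A minimal branching falls under one of the
  excluded kinds or is critical.\<close>

lemma local_branching_confluent:
  assumes gray: "gray_presentation Q"
    and crit: "\<And>S\<^sub>1 S\<^sub>2. critical_branching Q S\<^sub>1 S\<^sub>2 \<Longrightarrow> confluent Q S\<^sub>1 S\<^sub>2"
    and "local_branching Q S\<^sub>1 S\<^sub>2"
  shows "confluent Q S\<^sub>1 S\<^sub>2"
  using assms(3)
proof (induction "step_size (hd (edges S\<^sub>1))" arbitrary: S\<^sub>1 S\<^sub>2 rule: less_induct)
  case less
  note Q4 = gray_prepolygraph4[OF gray] and Q3 = gray_prepolygraph3[OF gray]
  have br: "branching Q S\<^sub>1 S\<^sub>2" using less.prems by (simp add: local_branching_def)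
  then have S: "S\<^sub>1 \<in> cells3 Q" "S\<^sub>2 \<in> cells3 Q" by (simp_all add: branching_def)
  have nat: "confluent Q T\<^sub>1 T\<^sub>2"
    if "natural_branching Q T\<^sub>1 T\<^sub>2" "T\<^sub>1 \<in> cells3 Q" "T\<^sub>2 \<in> cells3 Q" for T\<^sub>1 T\<^sub>2
    using that confluent_natural_left[OF gray _ _ _ _ _ _ _ that(2,3)] confluent_natural_right[OF gray _ _ _ _ _ _ _ that(2,3)]
    unfolding natural_branching_def Let_def by metis
  show ?case
  proof (cases "minimal_branching Q S\<^sub>1 S\<^sub>2")
    case True
    then consider "S\<^sub>1 = S\<^sub>2" | "independent_branching Q S\<^sub>1 S\<^sub>2" | "independent_branching Q S\<^sub>2 S\<^sub>1"
      | "natural_branching Q S\<^sub>1 S\<^sub>2" | "natural_branching Q S\<^sub>2 S\<^sub>1" | "critical_branching Q S\<^sub>1 S\<^sub>2"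
      using less.prems by (auto simp: critical_branching_def)
    then show ?thesis
    proof cases
      case 1 then show ?thesis using confluent_refl[OF Q4] S by simp
    next
      case 2 then show ?thesis by (rule confluent_independent[OF gray])
    next
      case 3 then show ?thesis by (rule confluent_sym[OF Q4 confluent_independent[OF gray]])
    next
      case 4 then show ?thesis using nat S by simp
    next
      case 5 then show ?thesis by (rule confluent_sym[OF Q4 nat]) (fact S)+
    next
      case 6 then show ?thesis by (rule crit)
    qed
  next
    case False
    then obtain T\<^sub>1 T\<^sub>2 \<kappa> l r \<rho> where T: "local_branching Q T\<^sub>1 T\<^sub>2" "sandwich Q \<kappa> l (bd2 Q Neg T\<^sub>1) r \<rho>"
      "S\<^sub>1 = whisk3 \<kappa> l T\<^sub>1 r \<rho>" "S\<^sub>2 = whisk3 \<kappa> l T\<^sub>2 r \<rho>"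
      and ne: "\<not> (edges l = [] \<and> edges r = [] \<and> edges \<kappa> = [] \<and> edges \<rho> = [])"
      unfolding minimal_branching_def by metis
    obtain s where s: "edges T\<^sub>1 = [s]"
      using T(1) by (auto simp: local_branching_def rewriting_step_iff[OF Q3])
    have "step_size (hd (edges T\<^sub>1)) < step_size (hd (edges S\<^sub>1))"
      using ne s by (cases s) (auto simp: T(3) lwhisk31_def rwhisk31_def lwhisk30_def rwhisk30_def lwhisk2_def rwhisk2_def)
    then have "confluent Q T\<^sub>1 T\<^sub>2"
      using less.hyps T(1) by blast
    then show ?thesis
      unfolding T(3,4) using T(1,2) by (intro confluent_whisk3[OF Q4]) (auto simp: local_branching_def)
  qed
qed

section \<open>Transfer to the presented precategory\<close>

section \<open>Coherence\<close>

text \<open>Boundaries and composites in the quotient are formed from all members of the classes.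
  Compatibility of the congruence with boundaries and with \<open>\<odot>\<close> allows them to be
  computed on representatives.\<close>

lemma presented_precat_sel:
  assumes Q: "prepolygraph4 Q"
  defines "R \<equiv> presentation_cong Q" and "C \<equiv> presented_precat Q"
  shows "cells C 3 = (\<lambda>F. R `` {Cell3 F}) ` cells3 Q" "cells C 2 = (\<lambda>\<phi>. {Cell2 \<phi>}) ` cells2 Q"
    and "\<And>F e. F \<in> cells3 Q \<Longrightarrow> bd C e 2 (R `` {Cell3 F}) = {Cell2 (bd2 Q e F)}"
    and "\<And>F G. \<lbrakk>F \<in> cells3 Q; G \<in> cells3 Q; bd2 Q Pos F = bd2 Q Neg G\<rbrakk> \<Longrightarrow>
      cmp C 3 3 (R `` {Cell3 F}) (R `` {Cell3 G}) = R `` {Cell3 (F \<odot> G)}"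
proof -
  note P = prepolygraph3[OF Q]
  have R3: "\<exists>G. u = Cell3 G \<and> equiv3 Q F G" if "(Cell3 F, u) \<in> R" for F u
    using that equiv_presentation_cong[OF Q] unfolding R_def equiv_def by blast
  show "cells C 3 = (\<lambda>F. R `` {Cell3 F}) ` cells3 Q" "cells C 2 = (\<lambda>\<phi>. {Cell2 \<phi>}) ` cells2 Q"
    by (auto simp: C_def R_def presented_precat_def quotient_precat_def quot_class_def free_precat_sel[OF P])
  show "bd C e 2 (R `` {Cell3 F}) = {Cell2 (bd2 Q e F)}" if F: "F \<in> cells3 Q" for F e
  proof -
    have "free_bd Q e u = Cell2 (bd2 Q e F)" if "u \<in> R `` {Cell3 F}" for u
      using that R3[of F u] equiv3_bd2[OF Q, of F _ e] by auto
    moreover have "Cell3 F \<in> R `` {Cell3 F}" using equiv3_refl[OF Q F] by (simp add: R_def)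
    ultimately have "free_bd Q e ` (R `` {Cell3 F}) = {Cell2 (bd2 Q e F)}" by force
    then show ?thesis by (simp add: C_def presented_precat_def quotient_precat_def free_precat_sel[OF P])
  qed
  show "cmp C 3 3 (R `` {Cell3 F}) (R `` {Cell3 G}) = R `` {Cell3 (F \<odot> G)}"
    if FG: "F \<in> cells3 Q" "G \<in> cells3 Q" "bd2 Q Pos F = bd2 Q Neg G" for F G
  proof -
    let ?S = "{free_cmp u v | u v. u \<in> R `` {Cell3 F} \<and> v \<in> R `` {Cell3 G}}"
    have "R `` {w} = R `` {Cell3 (F \<odot> G)}"
      if uvw: "w = free_cmp u v" "u \<in> R `` {Cell3 F}" "v \<in> R `` {Cell3 G}" for u v w
    proof -
      obtain F' G' where w: "w = Cell3 (F' \<odot> G')" "equiv3 Q F F'" "equiv3 Q G G'"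
        using uvw R3[of F u] R3[of G v] by auto
      have "equiv3 Q (F \<odot> G) (F' \<odot> G)" using equiv3_pcomp_right[OF Q w(2)] FG by simp
      moreover have "equiv3 Q (F' \<odot> G) (F' \<odot> G')"
        using equiv3_pcomp_left[OF Q w(3)] FG equiv3_bd2[OF Q w(2)] equiv3_in[OF Q w(2)] by simp
      ultimately have "equiv3 Q (F \<odot> G) (F' \<odot> G')" by (rule equiv3_trans[OF Q])
      then show ?thesis
        using equiv_class_eq[OF equiv_presentation_cong[OF Q]] w(1) unfolding R_def by metis
    qed
    then have "\<forall>w\<in>?S. R `` {w} = R `` {Cell3 (F \<odot> G)}" by blast
    moreover have "Cell3 (F \<odot> G) \<in> ?S"
    proof -
      have "Cell3 (F \<odot> G) = free_cmp (Cell3 F) (Cell3 G)" by simp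
      moreover have "Cell3 F \<in> R `` {Cell3 F}" "Cell3 G \<in> R `` {Cell3 G}"
        using equiv3_refl[OF Q] FG by (simp_all add: R_def)
      ultimately show ?thesis by blast
    qed
    ultimately have "R `` ?S = R `` {Cell3 (F \<odot> G)}"
      unfolding Image_eq_UN[of R ?S] by (intro UN_constant_eq)
    then show ?thesis
      by (simp add: C_def R_def presented_precat_def quotient_precat_def quot_class_def free_precat_sel[OF P])
  qed
qed

theorem mainTheorem4:
  fixes Q :: "('a0, 'a1, 'a2, 'a3, 'a4) gray"
  assumes "gray_presentation Q"
    and "terminating Q"
    and "\<And>S\<^sub>1 S\<^sub>2. critical_branching Q S\<^sub>1 S\<^sub>2 \<Longrightarrow>
      confluent_branching Q (presentation_cong Q) S\<^sub>1 S\<^sub>2"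
  shows "coherent_gray_presentation Q"
proof -
  note Q4 = gray_prepolygraph4[OF assms(1)] and Q3 = gray_prepolygraph3[OF assms(1)]
  note sel = presented_precat_sel[OF Q4]
  have unique: "equiv3 Q F G" if "normalizes Q F" "normalizes Q G" "bd2 Q Neg F = bd2 Q Neg G" for F G
    using normalizing_paths_equiv[OF Q4 assms(2) local_branching_confluent[OF assms(1,3)] that] by blast
  obtain nf where nf: "\<And>\<phi>. \<phi> \<in> cells2 Q \<Longrightarrow> normalizes Q (nf \<phi>) \<and> bd2 Q Neg (nf \<phi>) = \<phi>"
    using normalizing_path_exists[OF Q3 assms(2)] by metis
  then have nf3: "\<And>\<phi>. \<phi> \<in> cells2 Q \<Longrightarrow> nf \<phi> \<in> cells3 Q" by (simp add: normalizes_def[OF Q3])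
  \<comment> \<open>A 2-cell of the quotient is a singleton \<open>{Cell2 \<phi>}\<close>; the
    description operator recovers \<open>\<phi>\<close>.\<close>
  define N where "N U = presentation_cong Q `` {Cell3 (nf (THE \<phi>. U = {Cell2 \<phi>}))}" for U :: "('a0, 'a1, 'a2, 'a3) cell set"
  have N: "N {Cell2 \<phi>} = presentation_cong Q `` {Cell3 (nf \<phi>)}" for \<phi>
    by (simp add: N_def)
  \<comment> \<open>Following \<open>F\<close> by the chosen path out of its target gives another
    normalizing path out of its source; uniqueness yields the equivalence, and hence equality of the
    two final targets.\<close>
  have nat: "equiv3 Q (F \<odot> nf (bd2 Q Pos F)) (nf (bd2 Q Neg F))" "bd2 Q Pos (nf (bd2 Q Pos F)) = bd2 Q Pos (nf (bd2 Q Neg F))"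
    if F: "F \<in> cells3 Q" for F
  proof -
    note b = bd2_in[OF Q3 F]
    have "normalizes Q (F \<odot> nf (bd2 Q Pos F))"
      using F nf[OF b] by (intro normalizes_pcomp[OF Q3]) auto
    then show eq: "equiv3 Q (F \<odot> nf (bd2 Q Pos F)) (nf (bd2 Q Neg F))"
      using nf[OF b] by (intro unique) auto
    show "bd2 Q Pos (nf (bd2 Q Pos F)) = bd2 Q Pos (nf (bd2 Q Neg F))"
      using equiv3_bd2[OF Q4 eq, of Pos] nf[OF b] by (simp add: bd2_pcomp[OF Q3])
  qed
  have "coherent 3 (localization 3 (presented_precat Q))"
  proof (rule coherent_localization[where N=N])
    fix F e assume "F \<in> cells (presented_precat Q) 3"
    then obtain G where G: "G \<in> cells3 Q" "F = presentation_cong Q `` {Cell3 G}" by (auto simp: sel)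
    note b = bd2_in[OF Q3 G(1)]
    show "bd (presented_precat Q) e (3 - 1) F \<in> cells (presented_precat Q) (3 - 1)"
      using G b by (simp add: sel)
    show "bd (presented_precat Q) Pos (3 - 1) (N (bd (presented_precat Q) Pos (3 - 1) F)) =
        bd (presented_precat Q) Pos (3 - 1) (N (bd (presented_precat Q) Neg (3 - 1) F))"
      using G b nf3 nat by (simp add: sel N)
    show "cmp (presented_precat Q) 3 3 F (N (bd (presented_precat Q) Pos (3 - 1) F)) =
        N (bd (presented_precat Q) Neg (3 - 1) F)"
      using G b nf3 nf equiv_class_eq[OF equiv_presentation_cong[OF Q4] nat(1)[OF G(1)]]
      by (simp add: sel N)
  next
    fix x assume "x \<in> cells (presented_precat Q) (3 - 1)"
    then show "N x \<in> cells (presented_precat Q) 3 \<and> bd (presented_precat Q) Neg (3 - 1) (N x) = x"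
      using nf nf3 by (auto simp: sel N)
  qed simp
  then show ?thesis using assms(1) by (simp add: coherent_gray_presentation_def)
qed

end
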